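(* Let $n\in\mathbb{N}^{\ast}$ and $X=K^{n}$. Let $M\geq 1$, $\omega_1,\dots,\omega_M\in Lip(T)$ with Lipschitz constants $r_i=\|\omega_i\|_L$, and $R_1,\dots,R_M\in\mathcal{L}(K^n)$; let $H:cabv(K^n)\to cabv(K^n)$ be given by $H(\mu)=\sum_{i=1}^{M}R_i\circ\omega_i(\mu)$. Assume: (a) $\sum_{i=1}^{M}R_i=Id_{K^n}$; (b) $c=\sum_{i=1}^{M}\|R_i\|_o\, r_i<1$ (this holds if all $\omega_i$ are contractions and $\sum_{i=1}^{M}\|R_i\|_o=1$); (c) $0<a<\infty$ and $v\in K^n$ are such that $\|v\|\leq a$; (d) $\emptyset\neq A\subseteq B_a(K^n,v)$ is such that $H(A)\subseteq A$ and $A$ is weak$^{\ast}$ closed. (In the particular case when $\|H(\mu)\|\leq\|\mu\|$ for any $\mu\in cabv(K^n)$, one can take $A=B_a(K^n,v)$. More particularly, if $\sum_{i=1}^{M}\|R_i\|_o=1$, it follows that $\|H(\mu)\|\leq\|\mu\|$ for any $\mu\in cabv(K^n)$.) Under these hypotheses, define $H_1:A\to A$ via $H_1(\mu)=H(\mu)$ for any $\mu\in A$. Then $H_1$ is a contraction with contraction factor $\leq c$ if $A$ is equipped with the metric $d_{MK}^{\ast}(\mu,\nu)=\|\mu-\nu\|_{MK}^{\ast}$. There exists a unique $\mu^{\ast}\in A$ such that $H_1(\mu^{\ast})=\mu^{\ast}$.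
   Context: $K$ is $\mathbb{R}$ or $\mathbb{C}$; $K^n$ carries the standard scalar product $\langle x,y\rangle=\sum_i x_i\overline{y_i}$ and the Euclidean norm. $(T,d)$ is a compact metric space with at least two elements, $\mathcal{B}$ its Borel $\sigma$-algebra. $\mathbb{N}^{\ast}=\{1,2,\dots\}$. For metric spaces and $f:T\to Y$, $(Y,\rho)$ metric, $\|f\|_L=\sup\{\rho(f(x),f(y))/d(x,y): x\neq y\}$; $Lip(T,Y)$ is the set of $f$ with $\|f\|_L<\infty$, $Lip(T)=Lip(T,T)$; a contraction is a Lipschitz self-map with $\|f\|_L<1$, and $\|f\|_L$ is its contraction factor. $\mathcal{L}(X)$ is the space of continuous linear operators on $X$, with operator norm $\|\cdot\|_o$. $cabv(X)$ is the space of $\sigma$-additive $\mu:\mathcal{B}\to X$ with finite total variation $\|\mu\|=|\mu|(T)=\sup\sum_i\|\mu(A_i)\|$ (supremum over finite Borel partitions $(A_i)$ of $T$); this is the variational norm. For continuous $h:T\to T$, $h(\mu)(B)=\mu(h^{-1}(B))$ for $B\in\mathcal{B}$; for $R\in\mathcal{L}(X)$, $(R\circ h(\mu))(B)=R(\mu(h^{-1}(B)))$. $B_a(X)=\{\mu\in cabv(X):\|\mu\|\leq a\}$, $cabv(X,v)=\{\mu\in cabv(X):\mu(T)=v\}$, $B_a(X,v)=B_a(X)\cap cabv(X,v)$. Integral: for a simple function $f=\sum_i\varphi_{A_i}x_i$ ($(A_i)$ a finite Borel partition of $T$, $x_i\in X$, $\varphi_{A}$ the indicator function of $A$), $\int f\,d\mu=\sum_i\langle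 x_i,\mu(A_i)\rangle$; for $f$ a uniform limit of simple functions $f_m$ (in particular for $f\in C(T,X)$, the continuous functions), $\int f\,d\mu=\lim_m\int f_m\,d\mu$. For $\mu\in cabv(X,0)$, $\|\mu\|_{MK}^{\ast}=\sup\{|\int f\,d\mu|: f\in Lip(T,X),\ \|f\|_L\leq 1\}$ (a norm on $cabv(X,0)$). The weak$^{\ast}$ topology on $cabv(K^n)$ is the one obtained from the identification $cabv(X)\equiv C(T,X)'$, $\mu\mapsto(f\mapsto\int f\,d\mu)$, i.e. the coarsest topology making all maps $\mu\mapsto\int f\,d\mu$, $f\in C(T,X)$, continuous. *)

theory Defs
  imports "HOL-Analysis.Analysis"
begin

section \<open>The scalar field\<close>

text \<open>
  The class of the fields \<open>\<real>\<close> and \<open>\<complex>\<close>. With \<open>i = 0\<close> the axiom says that every scalar is real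
  and conjugation is the identity; with \<open>i\<^sup>2 = -1\<close> it is the usual description of the complex
  numbers and their conjugation. The lemma \<open>rc_mult_cnj\<close> below shows that the norm is then
  the usual absolute value.
\<close>

class real_or_complex = real_normed_field + euclidean_space +
  fixes rc_cnj :: "'a \<Rightarrow> 'a"
  assumes rc_cases: "\<exists>i. (i = 0 \<or> i * i = - 1) \<and>
    (\<forall>x. \<exists>a b. x = a *\<^sub>R 1 + b *\<^sub>R i \<and> rc_cnj x = a *\<^sub>R 1 - b *\<^sub>R i)"

lemma rc_cases_of_real: "\<exists>i::'k::real_or_complex. (i = 0 \<or> i * i = - 1) \<and>
    (\<forall>x. \<exists>a b. x = of_real a + of_real b * i \<and> rc_cnj x = of_real a - of_real b * i)"
  using rc_cases[where 'a='k] by (simp add: scaleR_conv_of_real)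

instantiation real :: real_or_complex
begin
definition rc_cnj_real :: "real \<Rightarrow> real" where "rc_cnj_real x = x"
instance
  by standard (intro exI[of _ 0] conjI, simp_all add: rc_cnj_real_def)
end

instantiation complex :: real_or_complex
begin
definition rc_cnj_complex :: "complex \<Rightarrow> complex" where "rc_cnj_complex = cnj"
instance
proof
  show "\<exists>i::complex. (i = 0 \<or> i * i = - 1) \<and>
    (\<forall>x. \<exists>a b. x = a *\<^sub>R 1 + b *\<^sub>R i \<and> rc_cnj x = a *\<^sub>R 1 - b *\<^sub>R i)"
  proof (intro exI[of _ \<i>] conjI allI)
    fix x :: complex
    show "\<exists>a b. x = a *\<^sub>R 1 + b *\<^sub>R \<i> \<and> rc_cnj x = a *\<^sub>R 1 - b *\<^sub>R \<i>"
      by (intro exI[of _ "Re x"] exI[of _ "Im x"])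
         (auto simp: rc_cnj_complex_def complex_eq_iff)
  qed simp
qed
end

lemma rc_mult_cnj: "x * rc_cnj x = of_real ((norm (x::'k::real_or_complex))\<^sup>2)"
proof -
  obtain i :: 'k where i: "i = 0 \<or> i * i = - 1"
    and dec: "\<And>x::'k. \<exists>a b. x = of_real a + of_real b * i \<and> rc_cnj x = of_real a - of_real b * i"
    using rc_cases_of_real[where 'k='k] by auto
  obtain a b where x: "x = of_real a + of_real b * i" and cx: "rc_cnj x = of_real a - of_real b * i"
    using dec by blast
  show ?thesis
  proof (cases "i = 0")
    case True
    then have "x = of_real a" "rc_cnj x = of_real a" using x cx by simp_all
    then show ?thesis by (metis norm_of_real of_real_mult power2_abs power2_eq_square)
  next
    case False
    then have ii: "i * i = - 1" using i by simp
    have "norm i * norm i = 1"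
      using arg_cong[OF ii, of norm] by (simp add: norm_mult)
    then have ni: "i \<bullet> i = 1"
      by (simp add: dot_square_norm power2_eq_square)
    have n1: "(1::'k) \<bullet> 1 = 1"
      by (simp add: dot_square_norm)
    have sq: "(norm (of_real p + of_real q * i))\<^sup>2 = p\<^sup>2 + q\<^sup>2 + 2 * p * q * ((1::'k) \<bullet> i)" for p q
    proof -
      have "(of_real p :: 'k) + of_real q * i = p *\<^sub>R 1 + q *\<^sub>R i"
        by (simp add: scaleR_conv_of_real)
      then show ?thesis
        by (simp only: power2_norm_eq_inner)
           (simp add: inner_simps ni n1 inner_commute[of i 1] power2_eq_square algebra_simps)
    qed
    let ?s = "(1::'k) \<bullet> i"
    have "(1 + i) * (1 - i) = 2"
      using ii by (simp add: algebra_simps)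
    then have "norm (1 + i) * norm (1 - i) = 2"
      by (metis norm_mult norm_numeral)
    then have "(norm (1 + i))\<^sup>2 * (norm (1 - i))\<^sup>2 = 4"
      by (simp flip: power_mult_distrib)
    moreover have "(norm (1 + i))\<^sup>2 = 2 + 2 * ?s" using sq[of 1 1] by simp
    moreover have "(norm (1 - i))\<^sup>2 = 2 - 2 * ?s" using sq[of 1 "-1"] by simp
    ultimately have "?s * ?s = 0" by (simp add: algebra_simps)
    then have s: "?s = 0" by simp
    have "x * rc_cnj x = of_real (a\<^sup>2) - of_real (b\<^sup>2) * (i * i)"
      unfolding cx by (subst x) (simp add: algebra_simps power2_eq_square)
    also have "\<dots> = of_real (a\<^sup>2 + b\<^sup>2)" by (simp add: ii)
    also have "\<dots> = of_real ((norm x)\<^sup>2)" using sq[of a b] by (simp add: s flip: x)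
    finally show ?thesis .
  qed
qed

definition scalar_prod :: "'k::real_or_complex ^ 'n \<Rightarrow> 'k ^ 'n \<Rightarrow> 'k" where
  "scalar_prod x y = (\<Sum>i\<in>UNIV. x $ i * rc_cnj (y $ i))"

definition continuous_linear_ops :: "('k::real_or_complex ^ 'n \<Rightarrow> 'k ^ 'n) set" where
  "continuous_linear_ops = {R. Vector_Spaces.linear (*s) (*s) R \<and> continuous_on UNIV R}"


section \<open>Lipschitz maps\<close>

text \<open>The supremum is taken in \<^typ>\<open>ennreal\<close>: it is \<open>\<infinity>\<close> for maps that are not Lipschitz, and \<open>0\<close>
  on a one-point space.\<close>

definition lip_norm_on ::
    "'a set \<Rightarrow> ('a \<Rightarrow> 'a \<Rightarrow> real) \<Rightarrow> ('b \<Rightarrow> 'b \<Rightarrow> real) \<Rightarrow> ('a \<Rightarrow> 'b) \<Rightarrow> ennreal" where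
  "lip_norm_on S d \<rho> f = (SUP (x, y)\<in>{(x, y). x \<in> S \<and> y \<in> S \<and> x \<noteq> y}. ennreal (\<rho> (f x) (f y) / d x y))"

abbreviation lip_norm :: "('a::metric_space \<Rightarrow> 'b::metric_space) \<Rightarrow> ennreal" where
  "lip_norm \<equiv> lip_norm_on UNIV dist dist"

definition Lip :: "('a::metric_space \<Rightarrow> 'b::metric_space) set" where
  "Lip = {f. lip_norm f < \<infinity>}"

definition contraction_on :: "'a set \<Rightarrow> ('a \<Rightarrow> 'a \<Rightarrow> real) \<Rightarrow> ('a \<Rightarrow> 'a) \<Rightarrow> bool" where
  "contraction_on S d f \<longleftrightarrow> f \<in> S \<rightarrow> S \<and> lip_norm_on S d d f < 1"


section \<open>Vector measures of bounded variation\<close>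

definition variation :: "('t::topological_space set \<Rightarrow> 'x::real_normed_vector) \<Rightarrow> ennreal" where
  "variation \<mu> = (SUP P\<in>{P. finite P \<and> P \<subseteq> sets borel \<and> partition_on UNIV P}.
     \<Sum>A\<in>P. ennreal (norm (\<mu> A)))"

text \<open>A set function on the Borel sets is represented by its extension by \<open>0\<close> to all sets, so that
  equality of functions is equality on the Borel sets.\<close>

definition cabv :: "('t::topological_space set \<Rightarrow> 'x::real_normed_vector) set" where
  "cabv = {\<mu>. (\<forall>A. A \<notin> sets borel \<longrightarrow> \<mu> A = 0) \<and>
     (\<forall>A :: nat \<Rightarrow> 't set. range A \<subseteq> sets borel \<and> disjoint_family A \<longrightarrow>
        (\<lambda>i. \<mu> (A i)) sums \<mu> (\<Union>i. A i)) \<and>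
     variation \<mu> < \<infinity>}"

definition cabv_mass :: "'x \<Rightarrow> ('t::topological_space set \<Rightarrow> 'x::real_normed_vector) set" where
  "cabv_mass v = {\<mu> \<in> cabv. \<mu> UNIV = v}"

definition cabv_ball :: "real \<Rightarrow> ('t::topological_space set \<Rightarrow> 'x::real_normed_vector) set" where
  "cabv_ball a = {\<mu> \<in> cabv. variation \<mu> \<le> ennreal a}"

definition image_measure ::
    "('t::topological_space \<Rightarrow> 't) \<Rightarrow> ('t set \<Rightarrow> 'x::real_normed_vector) \<Rightarrow> 't set \<Rightarrow> 'x" where
  "image_measure h \<mu> = (\<lambda>B. if B \<in> sets borel then \<mu> (h -` B) else 0)"

definition iter_op ::
    "nat \<Rightarrow> (nat \<Rightarrow> 'x \<Rightarrow> 'x) \<Rightarrow> (nat \<Rightarrow> 't \<Rightarrow> 't) \<Rightarrow>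
     ('t::topological_space set \<Rightarrow> 'x::real_normed_vector) \<Rightarrow> 't set \<Rightarrow> 'x" where
  "iter_op M R \<omega> \<mu> = (\<lambda>B. \<Sum>i=1..M. R i (image_measure (\<omega> i) \<mu> B))"


section \<open>The integral\<close>

text \<open>The integral of a simple function is written with its canonical partition into level sets;
  \<open>simple_vintegral_partition\<close> below gives the value for an arbitrary partition.\<close>

definition simple_vintegral ::
    "('t::topological_space set \<Rightarrow> 'k::real_or_complex ^ 'n) \<Rightarrow> ('t \<Rightarrow> 'k ^ 'n) \<Rightarrow> 'k" where
  "simple_vintegral \<mu> f = (\<Sum>x\<in>range f. scalar_prod x (\<mu> (f -` {x})))"

definition has_vintegral ::
    "('t::topological_space set \<Rightarrow> 'k::real_or_complex ^ 'n) \<Rightarrow> ('t \<Rightarrow> 'k ^ 'n) \<Rightarrow> 'k \<Rightarrow> bool" where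
  "has_vintegral \<mu> f L \<longleftrightarrow> (\<exists>s. (\<forall>m. simple_function borel (s m)) \<and>
     uniform_limit UNIV s f sequentially \<and> (\<lambda>m. simple_vintegral \<mu> (s m)) \<longlonglongrightarrow> L)"

definition vintegral ::
    "('t::topological_space set \<Rightarrow> 'k::real_or_complex ^ 'n) \<Rightarrow> ('t \<Rightarrow> 'k ^ 'n) \<Rightarrow> 'k" where
  "vintegral \<mu> f = (THE L. has_vintegral \<mu> f L)"

lemma rc_cnj_add: "rc_cnj (x + y) = rc_cnj x + rc_cnj (y::'k::real_or_complex)"
proof -
  obtain i :: 'k where i: "i = 0 \<or> i * i = - 1"
    and dec: "\<And>x::'k. \<exists>a b. x = of_real a + of_real b * i \<and> rc_cnj x = of_real a - of_real b * i"
    using rc_cases_of_real[where 'k='k] by auto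
  have uniq: "p = r \<and> (q = s \<or> i = 0)"
    if "of_real p + of_real q * i = of_real r + of_real s * i" for p q r s
  proof (cases "i = 0")
    case False
    then have ii: "i * i = - 1" using i by simp
    have *: "of_real (p - r) = of_real (s - q) * i"
      using that by (simp add: algebra_simps)
    then have "of_real (p - r) * of_real (p - r) = of_real (s - q) * i * (of_real (s - q) * i)"
      by metis
    also have "\<dots> = of_real (s - q) * of_real (s - q) * (i * i)"
      by (simp only: mult_ac)
    also have "\<dots> = of_real (- ((s - q) * (s - q)))"
      unfolding ii by simp
    finally have "(of_real ((p - r) * (p - r)) :: 'k) = of_real (- ((s - q) * (s - q)))"
      by simp
    then have "(p - r) * (p - r) = - ((s - q) * (s - q))"
      using of_real_eq_iff by blast
    then have "(p - r)\<^sup>2 + (s - q)\<^sup>2 = 0"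
      by (simp add: power2_eq_square)
    then show ?thesis by (simp add: sum_power2_eq_zero_iff)
  qed (use that in auto)
  obtain a b where x: "x = of_real a + of_real b * i" "rc_cnj x = of_real a - of_real b * i"
    using dec by blast
  obtain a' b' where y: "y = of_real a' + of_real b' * i" "rc_cnj y = of_real a' - of_real b' * i"
    using dec by blast
  obtain p q where z: "x + y = of_real p + of_real q * i" "rc_cnj (x + y) = of_real p - of_real q * i"
    using dec by blast
  have "of_real p + of_real q * i = of_real (a + a') + of_real (b + b') * i"
    using z(1) unfolding x(1) y(1) by (simp add: algebra_simps)
  from uniq[OF this] have "p = a + a'" "q = b + b' \<or> i = 0" by auto
  then show ?thesis unfolding z(2) x(2) y(2) by (auto simp: algebra_simps)
qed

lemma scalar_prod_add_right: "scalar_prod x (y + z) = scalar_prod x y + scalar_prod x z"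
  by (simp add: scalar_prod_def rc_cnj_add algebra_simps sum.distrib)

lemma scalar_prod_zero_right [simp]: "scalar_prod x 0 = 0"
  using scalar_prod_add_right[of x 0 0] by simp

lemma cabv_empty: "\<mu> \<in> cabv \<Longrightarrow> \<mu> {} = 0"
proof -
  assume "\<mu> \<in> cabv"
  then have "(\<lambda>i::nat. \<mu> {}) sums \<mu> (\<Union>i::nat. {})"
    unfolding cabv_def mem_Collect_eq
    by (elim conjE allE[of _ "\<lambda>i::nat. {}"]) (auto simp: disjoint_family_on_def)
  then show ?thesis using sums_summable summable_const_iff by blast
qed

lemma cabv_Un:
  assumes "\<mu> \<in> cabv" "A \<in> sets borel" "B \<in> sets borel" "A \<inter> B = {}"
  shows "\<mu> (A \<union> B) = \<mu> A + \<mu> B"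
proof -
  have "(\<lambda>i. \<mu> (binaryset A B i)) sums \<mu> (\<Union>i. binaryset A B i)"
    using assms unfolding cabv_def mem_Collect_eq
    by (elim conjE allE[of _ "binaryset A B"])
       (auto simp: disjoint_family_on_def binaryset_def split: if_splits)
  moreover have "(\<lambda>i. \<mu> (binaryset A B i)) sums (\<mu> A + \<mu> B)"
    by (rule binaryset_sums) (simp add: cabv_empty[OF assms(1)])
  ultimately show ?thesis by (simp add: UN_binaryset_eq sums_unique2)
qed

lemma cabv_UN:
  assumes "\<mu> \<in> cabv" "finite I" "\<And>i. i \<in> I \<Longrightarrow> A i \<in> sets borel" "disjoint_family_on A I"
  shows "\<mu> (\<Union>i\<in>I. A i) = (\<Sum>i\<in>I. \<mu> (A i))"
  using assms(2-)
proof (induction I rule: finite_induct)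
  case (insert i I)
  have "A i \<inter> (\<Union>j\<in>I. A j) = {}"
    using insert.prems(2) insert.hyps(2) by (fastforce simp: disjoint_family_on_def)
  moreover have "disjoint_family_on A I"
    using insert.prems(2) by (auto simp: disjoint_family_on_def)
  ultimately show ?case
    using insert cabv_Un[OF assms(1), of "A i" "\<Union>j\<in>I. A j"]
    by (simp add: sets.finite_UN)
qed (simp add: cabv_empty[OF assms(1)])

lemma scalar_prod_sum_right: "scalar_prod x (\<Sum>i\<in>I. g i) = (\<Sum>i\<in>I. scalar_prod x (g i))"
  by (induction I rule: infinite_finite_induct) (auto simp: scalar_prod_add_right)

lemma simple_vintegral_partition:
  assumes "\<mu> \<in> cabv" "finite I" "\<And>i. i \<in> I \<Longrightarrow> A i \<in> sets borel" "disjoint_family_on A I"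
    and "(\<Union>i\<in>I. A i) = UNIV" and f: "\<And>i t. i \<in> I \<Longrightarrow> t \<in> A i \<Longrightarrow> f t = x i"
  shows "simple_vintegral \<mu> f = (\<Sum>i\<in>I. scalar_prod (x i) (\<mu> (A i)))"
proof -
  let ?J = "{i \<in> I. A i \<noteq> {}}"
  have rng: "range f = x ` ?J"
  proof (intro equalityI subsetI)
    fix y assume "y \<in> range f"
    then obtain t where t: "y = f t" by auto
    obtain i where "i \<in> I" "t \<in> A i" using assms(5) by blast
    then show "y \<in> x ` ?J" using f t by blast
  next
    fix y assume "y \<in> x ` ?J"
    then obtain i t where "i \<in> I" "t \<in> A i" "y = x i" by blast
    then show "y \<in> range f" using f by (metis rangeI)
  qed
  have lev: "f -` {y} = (\<Union>i\<in>{i \<in> ?J. x i = y}. A i)" for y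
  proof (intro equalityI subsetI)
    fix t assume t: "t \<in> f -` {y}"
    obtain i where i: "i \<in> I" "t \<in> A i" using assms(5) by blast
    then have "x i = y" using f[OF i] t by simp
    with i show "t \<in> (\<Union>i\<in>{i \<in> ?J. x i = y}. A i)" by auto
  next
    fix t assume "t \<in> (\<Union>i\<in>{i \<in> ?J. x i = y}. A i)"
    then obtain i where "i \<in> I" "x i = y" "t \<in> A i" by blast
    then show "t \<in> f -` {y}" using f by simp
  qed
  have mu: "\<mu> (f -` {y}) = (\<Sum>i\<in>{i \<in> ?J. x i = y}. \<mu> (A i))" for y
    unfolding lev
  proof (rule cabv_UN[OF assms(1)])
    show "disjoint_family_on A {i \<in> ?J. x i = y}"
      by (rule disjoint_family_on_mono[OF _ assms(4)]) blast
  qed (use assms(2,3) in simp_all)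
  have "simple_vintegral \<mu> f = (\<Sum>y\<in>x ` ?J. \<Sum>i\<in>{i \<in> ?J. x i = y}. scalar_prod (x i) (\<mu> (A i)))"
    unfolding simple_vintegral_def rng mu scalar_prod_sum_right by (intro sum.cong) auto
  also have "\<dots> = (\<Sum>i\<in>?J. scalar_prod (x i) (\<mu> (A i)))"
    by (rule sum.group) (use assms(2) in auto)
  also have "\<dots> = (\<Sum>i\<in>I. scalar_prod (x i) (\<mu> (A i)))"
    by (rule sum.mono_neutral_left) (use assms(1,2) in \<open>auto simp: cabv_empty\<close>)
  finally show ?thesis .
qed


section \<open>The modified Monge--Kantorovich norm and the weak* topology\<close>

text \<open>The norm is only meaningful on measures of total mass \<open>0\<close>, where the supremum is finite. Its
  value elsewhere is set to \<open>0\<close>, since \<^locale>\<open>Metric_space\<close> asks for a distance that is nonnegative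
  and symmetric on the whole type.\<close>

definition mk_norm :: "('t::metric_space set \<Rightarrow> 'k::real_or_complex ^ 'n) \<Rightarrow> real" where
  "mk_norm \<mu> = (if \<mu> \<in> cabv_mass 0
     then (SUP f\<in>{f. f \<in> Lip \<and> lip_norm f \<le> 1}. norm (vintegral \<mu> f)) else 0)"

definition mk_dist ::
    "('t::metric_space set \<Rightarrow> 'k::real_or_complex ^ 'n) \<Rightarrow> ('t set \<Rightarrow> 'k ^ 'n) \<Rightarrow> real" where
  "mk_dist \<mu> \<nu> = mk_norm (\<lambda>B. \<mu> B - \<nu> B)"

definition weak_star :: "('t::topological_space set \<Rightarrow> 'k::real_or_complex ^ 'n) topology" where
  "weak_star = topology_generated_by
     {{\<mu> \<in> cabv. vintegral \<mu> f \<in> U} | f U. continuous_on UNIV f \<and> open U}"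

end

theory Submission
  imports Defs
begin

text \<open>
  Integration against \<open>H \<mu>\<close> can be moved to the integrand: \<open>\<integral>f d(H \<mu>) = \<Sum>i. \<integral>S\<^sub>i \<circ> f
  \<circ> \<omega>\<^sub>i d\<mu>\<close>, where \<open>S\<^sub>i\<close> is the adjoint of \<open>R\<^sub>i\<close> (lemma
  \<open>vintegral_image\<close>). If \<open>f\<close> is \<open>1\<close>-Lipschitz, the \<open>i\<close>-th integrand on the right is Lipschitz with
  constant \<open>onorm R\<^sub>i * r\<^sub>i\<close>. As differences of measures with the same total mass have mass \<open>0\<close>, the
  Monge--Kantorovich distance is contracted by the factor \<open>c\<close> (\<open>mk_norm_iter_op_le\<close>). It is a metric because Lipschitz
  functions are dense enough to determine a vector measure (\<open>measure_zero_if_Lip_vintegrals_zero\<close>), and a contraction of a metric space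
  has at most one fixed point.

  Existence rests on weak* compactness. The iterates \<open>\<mu>\<^sub>k = H\<^sup>k \<mu>\<^sub>0\<close> of a point of \<open>A\<close> stay in a
  ball for the variational norm, so a subsequence converges weak* to a vector measure \<open>\<mu>\<close>
  (\<open>cabv_ball_weakly_seq_compact\<close>), which lies in \<open>A\<close> since \<open>A\<close> is weak* closed
  (\<open>weak_star_closed_limit\<close>). The operator is sequentially weak* continuous (\<open>vintegral_iter_op_tendsto\<close>), and the distance
  of \<open>\<mu>\<^sub>k\<close> and \<open>\<mu>\<^sub>k\<^sub>+\<^sub>1\<close> is at most \<open>c\<^sup>k\<close> times a constant. Hence
  \<open>H \<mu>\<close> and \<open>\<mu>\<close> have the same integrals of Lipschitz functions, and \<open>H \<mu> = \<mu>\<close>.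

  The compactness comes from positive measures. The total variation of a vector measure is a finite positive measure, which makes each real coordinate
  a difference of two positive measures of controlled mass (\<open>jordan_rep_exists\<close>). For positive measures one refines the space into binary
  cells of diameter tending to \<open>0\<close> and passes to a subsequence along which the masses of all cells converge. The limit masses are the
  lengths of nested subintervals of a real interval, and the image of Lebesgue measure under the map sending \<open>x\<close> to the point described
  by the cells of its subintervals is the limit measure (\<open>tree_measure_exists\<close>, \<open>finite_measures_weakly_seq_compact\<close>).

  That the ball with prescribed total mass is weak* closed amounts to computing the variation of \<open>\<mu>\<close> as the supremum of
  \<open>\<bar>\<integral>f d\<mu>\<bar>\<close> over continuous \<open>f\<close> bounded by \<open>1\<close> (\<open>norm_vintegral_le\<close>,
  \<open>variation_le_if_vintegral_le\<close>). This and the definiteness of the distance both come from approximating indicator functions by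
  Lipschitz functions (\<open>lipschitz_indicator_approx\<close>).
\<close>

section \<open>The scalar product\<close>

lemma rc_cnj_zero [simp]: "rc_cnj (0::'k::real_or_complex) = 0"
  using rc_cnj_add[of "0::'k" 0] by simp

lemma norm_rc_cnj [simp]: "norm (rc_cnj x) = norm (x::'k::real_or_complex)"
proof (cases "x = 0")
  case False
  have "norm x * norm (rc_cnj x) = (norm x)\<^sup>2"
    using arg_cong[OF rc_mult_cnj[of x], of norm] by (simp only: norm_mult norm_of_real abs_power2)
  then show ?thesis using False by (simp add: power2_eq_square)
qed simp

text \<open>
  The identity \<open>z * rc_cnj z = \<bar>z\<bar>\<^sup>2\<close> determines the conjugate of a nonzero scalar, and the right-hand side is
  multiplicative.
\<close>

lemma rc_cnj_mult: "rc_cnj (x * y) = rc_cnj x * rc_cnj (y::'k::real_or_complex)"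
proof (cases "x * y = 0")
  case False
  have "(x * y) * rc_cnj (x * y) = (x * rc_cnj x) * (y * rc_cnj y)"
    unfolding rc_mult_cnj by (simp add: norm_mult power_mult_distrib)
  also have "\<dots> = (x * y) * (rc_cnj x * rc_cnj y)"
    by (simp add: mult_ac)
  finally show ?thesis using False by simp
qed auto

lemma rc_cnj_of_real [simp]: "rc_cnj (of_real a) = (of_real a :: 'k::real_or_complex)"
proof (cases "a = 0")
  case False
  have "of_real a * rc_cnj (of_real a :: 'k) = of_real a * of_real a"
    unfolding rc_mult_cnj by (simp add: power2_eq_square flip: of_real_mult)
  then show ?thesis using False by simp
qed simp

lemma scaleR_eq_of_real_vmult: "a *\<^sub>R (x :: 'k::real_or_complex ^ 'n) = of_real a *s x"
  by (simp add: vec_eq_iff scaleR_conv_of_real[where 'a = 'k])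

lemma scalar_prod_add_left: "scalar_prod (x + y) z = scalar_prod x z + scalar_prod y z"
  by (simp add: scalar_prod_def algebra_simps sum.distrib)

lemma scalar_prod_vmult_right: "scalar_prod x (k *s y) = rc_cnj k * scalar_prod x y"
  by (simp add: scalar_prod_def rc_cnj_mult sum_distrib_left mult_ac)

lemma scalar_prod_self: "scalar_prod x x = of_real ((norm (x :: 'k::real_or_complex ^ 'n))\<^sup>2)"
  by (simp add: scalar_prod_def rc_mult_cnj norm_vec_def L2_set_def sum_nonneg)

lemma norm_scalar_prod_le: "norm (scalar_prod x y) \<le> norm x * norm (y :: 'k::real_or_complex ^ 'n)"
proof -
  have "norm (scalar_prod x y) \<le> (\<Sum>i\<in>UNIV. \<bar>norm (x $ i)\<bar> * \<bar>norm (y $ i)\<bar>)"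
    unfolding scalar_prod_def by (rule order_trans[OF norm_sum]) (simp add: norm_mult)
  also have "\<dots> \<le> norm x * norm y"
    unfolding norm_vec_def by (rule L2_set_mult_ineq)
  finally show ?thesis .
qed

text \<open>
  The scalar product is sesquilinear over the scalar field, hence bilinear over \<open>\<real>\<close>. Limits, sums and Bochner integrals, which are
  real notions, then commute with it.
\<close>

lemma bounded_bilinear_scalar_prod: "bounded_bilinear (scalar_prod :: 'k::real_or_complex ^ 'n \<Rightarrow> _)"
proof
  show "scalar_prod (r *\<^sub>R a) b = r *\<^sub>R scalar_prod a b" for r and a b :: "'k ^ 'n"
    by (simp add: scalar_prod_def scaleR_sum_right)
  show "scalar_prod a (r *\<^sub>R b) = r *\<^sub>R scalar_prod a b" for r and a b :: "'k ^ 'n"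
    unfolding scaleR_eq_of_real_vmult scalar_prod_vmult_right by (simp add: scaleR_conv_of_real)
  show "\<exists>K. \<forall>a b :: 'k ^ 'n. norm (scalar_prod a b) \<le> norm a * norm b * K"
    by (intro exI[of _ 1]) (simp add: norm_scalar_prod_le)
qed (simp_all add: scalar_prod_add_left scalar_prod_add_right)

interpretation scalar_prod: bounded_bilinear "scalar_prod :: 'k::real_or_complex ^ 'n \<Rightarrow> _"
  by (rule bounded_bilinear_scalar_prod)

lemma scalar_prod_sgn: "scalar_prod (sgn y) y = of_real (norm (y :: 'k::real_or_complex ^ 'n))"
proof -
  have "scalar_prod (sgn y) y = inverse (norm y) *\<^sub>R scalar_prod y y"
    by (simp only: sgn_div_norm scalar_prod.scaleR_left divideR_right flip: divide_inverse)
  also have "\<dots> = of_real (inverse (norm y) * (norm y)\<^sup>2)"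
    by (simp only: scalar_prod_self scaleR_conv_of_real of_real_mult)
  also have "inverse (norm y) * (norm y)\<^sup>2 = norm y" by (cases "y = 0") (simp_all add: power2_eq_square)
  finally show ?thesis .
qed

lemma continuous_linear_ops_bounded_linear:
  fixes R :: "'k::real_or_complex ^ 'n \<Rightarrow> 'k ^ 'n"
  assumes "R \<in> continuous_linear_ops"
  shows "bounded_linear R"
proof -
  interpret R: Vector_Spaces.linear "(*s)" "(*s)" R
    using assms by (simp add: continuous_linear_ops_def)
  have "linear R"
    by (rule linearI) (simp_all add: R.add R.scale scaleR_eq_of_real_vmult)
  then show ?thesis by (simp add: linear_conv_bounded_linear)
qed

text \<open>
  The norm bound on the adjoint comes from testing with \<open>S x\<close> itself: \<open>\<bar>S x\<bar>\<^sup>2 = \<langle>x, R (S x)\<rangle> \<le>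
  \<bar>x\<bar> * onorm R * \<bar>S x\<bar>\<close>.
\<close>

lemma adjoint_exists:
  fixes R :: "'k::real_or_complex ^ 'n \<Rightarrow> 'k ^ 'n"
  assumes R: "R \<in> continuous_linear_ops"
  obtains S where "bounded_linear S" "\<And>x y. scalar_prod x (R y) = scalar_prod (S x) y"
    "\<And>x. norm (S x) \<le> onorm R * norm x"
proof -
  interpret R: Vector_Spaces.linear "(*s)" "(*s)" R
    using R by (simp add: continuous_linear_ops_def)
  define S :: "'k ^ 'n \<Rightarrow> 'k ^ 'n" where "S x = (\<chi> j. scalar_prod x (R (axis j 1)))" for x
  have adj: "scalar_prod x (R y) = scalar_prod (S x) y" for x y
  proof -
    have "R y = R (\<Sum>j\<in>UNIV. y $ j *s axis j 1)"
      by (simp add: basis_expansion)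
    also have "\<dots> = (\<Sum>j\<in>UNIV. y $ j *s R (axis j 1))"
      by (simp add: R.sum R.scale)
    finally have "scalar_prod x (R y) = (\<Sum>j\<in>UNIV. rc_cnj (y $ j) * scalar_prod x (R (axis j 1)))"
      by (simp add: scalar_prod_sum_right scalar_prod_vmult_right)
    also have "\<dots> = (\<Sum>j\<in>UNIV. S x $ j * rc_cnj (y $ j))"
      by (simp add: S_def mult.commute)
    finally show ?thesis by (simp only: scalar_prod_def)
  qed
  have le: "norm (S x) \<le> onorm R * norm x" for x
  proof (cases "norm (S x) = 0")
    case False
    have "norm (S x) * norm (S x) = norm (scalar_prod (S x) (S x))"
      by (simp add: scalar_prod_self power2_eq_square flip: of_real_mult)
    also have "\<dots> \<le> norm x * norm (R (S x))"
      using norm_scalar_prod_le by (simp flip: adj)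
    also have "\<dots> \<le> norm x * (onorm R * norm (S x))"
      by (intro mult_left_mono onorm[OF continuous_linear_ops_bounded_linear[OF R]]) simp
    finally show ?thesis using False by (simp add: mult.assoc mult.left_commute mult.commute)
  qed (use onorm_pos_le[OF continuous_linear_ops_bounded_linear[OF R]] in auto)
  have "bounded_linear S"
    by (rule bounded_linear_intro[where K = "onorm R"])
      (use le in \<open>auto simp: S_def vec_eq_iff scalar_prod.add_left scalar_prod.scaleR_left mult.commute\<close>)
  with adj le that show ?thesis by blast
qed

section \<open>Lipschitz maps\<close>

lemma lip_norm_le_iff:
  assumes "0 \<le> L"
  shows "lip_norm f \<le> ennreal L \<longleftrightarrow> (\<forall>x y. dist (f x) (f y) \<le> L * dist x y)"
proof
  assume *: "lip_norm f \<le> ennreal L"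
  show "\<forall>x y. dist (f x) (f y) \<le> L * dist x y"
  proof (intro allI)
    fix x y
    show "dist (f x) (f y) \<le> L * dist x y"
    proof (cases "x = y")
      case False
      then have "ennreal (dist (f x) (f y) / dist x y) \<le> lip_norm f"
        unfolding lip_norm_on_def by (intro SUP_upper2[of "(x, y)"]) auto
      also note *
      finally show ?thesis using assms False by (simp add: divide_le_eq)
    qed simp
  qed
next
  assume "\<forall>x y. dist (f x) (f y) \<le> L * dist x y"
  then show "lip_norm f \<le> ennreal L"
    unfolding lip_norm_on_def
    by (intro SUP_least) (auto intro!: ennreal_leI simp: divide_le_eq)
qed

lemma Lip_iff: "f \<in> Lip \<longleftrightarrow> (\<exists>L\<ge>0. \<forall>x y. dist (f x) (f y) \<le> L * dist x y)"
proof
  assume "f \<in> Lip"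
  then have "lip_norm f = ennreal (enn2real (lip_norm f))"
    by (simp add: Lip_def)
  then show "\<exists>L\<ge>0. \<forall>x y. dist (f x) (f y) \<le> L * dist x y"
    using lip_norm_le_iff[of "enn2real (lip_norm f)" f] by (auto intro!: exI[of _ "enn2real (lip_norm f)"])
next
  assume "\<exists>L\<ge>0. \<forall>x y. dist (f x) (f y) \<le> L * dist x y"
  then obtain L where "0 \<le> L" "\<forall>x y. dist (f x) (f y) \<le> L * dist x y" by blast
  then have "lip_norm f \<le> ennreal L" by (simp add: lip_norm_le_iff)
  then show "f \<in> Lip" by (auto simp: Lip_def intro: le_less_trans)
qed

lemma Lip_dist_le:
  assumes "f \<in> Lip"
  shows "dist (f x) (f y) \<le> enn2real (lip_norm f) * dist x y"
proof -
  have "lip_norm f = ennreal (enn2real (lip_norm f))"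
    using assms by (simp add: Lip_def)
  then show ?thesis using lip_norm_le_iff[of "enn2real (lip_norm f)" f] by simp
qed

lemma Lip_continuous:
  assumes "f \<in> Lip"
  shows "continuous_on UNIV f"
proof -
  obtain L where "L \<ge> 0" "\<forall>x y. dist (f x) (f y) \<le> L * dist x y"
    using assms Lip_iff by blast
  then have "L-lipschitz_on UNIV f" by (simp add: lipschitz_on_def)
  then show ?thesis by (rule lipschitz_on_continuous_on)
qed

section \<open>Total variation and decomposition into positive measures\<close>

lemma cabv_sums:
  fixes A :: "nat \<Rightarrow> 't::topological_space set"
  assumes "\<mu> \<in> cabv" "range A \<subseteq> sets borel" "disjoint_family A"
  shows "(\<lambda>i. \<mu> (A i)) sums \<mu> (\<Union>i. A i)"
  using assms by (auto simp: cabv_def)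

text \<open>
  The value of the total variation measure \<open>\<bar>\<mu>\<bar>\<close> at \<open>S\<close>. Finite disjoint families inside \<open>S\<close> take
  the place of partitions of \<open>S\<close>: they may be enlarged and merged freely, and leaving out a piece only lowers the sum.
\<close>

definition variation_on ::
    "('t::topological_space set \<Rightarrow> 'x::real_normed_vector) \<Rightarrow> 't set \<Rightarrow> ennreal" where
  "variation_on \<mu> S = (SUP P\<in>{P. finite P \<and> P \<subseteq> sets borel \<and> disjoint P \<and> \<Union>P \<subseteq> S}.
     \<Sum>A\<in>P. ennreal (norm (\<mu> A)))"

lemma sum_le_variation_on:
  assumes "\<mu> {} = 0" "finite I" "\<And>i. i \<in> I \<Longrightarrow> A i \<in> sets borel" "disjoint_family_on A I"
    and "\<And>i. i \<in> I \<Longrightarrow> A i \<subseteq> S"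
  shows "(\<Sum>i\<in>I. ennreal (norm (\<mu> (A i)))) \<le> variation_on \<mu> S"
proof -
  let ?J = "{i \<in> I. A i \<noteq> {}}"
  have inj: "inj_on A ?J"
    using assms(4) by (fastforce simp: inj_on_def disjoint_family_on_def)
  have "(\<Sum>i\<in>I. ennreal (norm (\<mu> (A i)))) = (\<Sum>i\<in>?J. ennreal (norm (\<mu> (A i))))"
    by (rule sum.mono_neutral_right) (use assms(1,2) in auto)
  also have "\<dots> = (\<Sum>B\<in>A ` ?J. ennreal (norm (\<mu> B)))"
    by (simp add: sum.reindex[OF inj])
  also have "\<dots> \<le> variation_on \<mu> S"
    unfolding variation_on_def
  proof (rule SUP_upper, safe)
    show "disjoint (A ` ?J)"
      using assms(4) by (fastforce simp: disjoint_def disjoint_family_on_def)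
  qed (use assms(2,3,5) in auto)
  finally show ?thesis .
qed

text \<open>
  A disjoint family becomes a partition when the complement of its union is added and the empty set is removed.
\<close>

lemma variation_eq_variation_on:
  fixes \<mu> :: "'t::topological_space set \<Rightarrow> 'x::real_normed_vector"
  assumes "\<mu> {} = 0"
  shows "variation \<mu> = variation_on \<mu> UNIV"
proof (rule antisym)
  show "variation \<mu> \<le> variation_on \<mu> UNIV"
    unfolding variation_def variation_on_def
    by (rule SUP_subset_mono) (auto simp: partition_on_def)
  show "variation_on \<mu> UNIV \<le> variation \<mu>"
    unfolding variation_on_def
  proof (rule SUP_least, safe)
    fix P :: "'t set set"
    assume P: "finite P" "P \<subseteq> sets borel" "disjoint P"
    let ?P = "insert (- \<Union>P) P - {{}}"
    have "\<Union>P \<in> sets borel"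
      using P by (intro sets.finite_Union) auto
    then have meas: "?P \<subseteq> sets borel"
      using P(2) borel_comp[of "\<Union>P"] by blast
    have dis: "p \<inter> q = {}" if "p \<in> P" "q \<in> P" "p \<noteq> q" for p q
      using P(3) that by (simp add: disjoint_def)
    have "partition_on UNIV ?P"
    proof (rule partition_onI)
      show "disjnt p q" if "p \<in> ?P" "q \<in> ?P" "p \<noteq> q" for p q
        using that dis by (fastforce simp: disjnt_def)
    qed auto
    with meas have "(\<Sum>A\<in>?P. ennreal (norm (\<mu> A))) \<le> variation \<mu>"
      unfolding variation_def using P(1) by (intro SUP_upper[where f = "sum _"]) simp
    moreover have "(\<Sum>A\<in>P. ennreal (norm (\<mu> A))) = (\<Sum>A\<in>P - {{}}. ennreal (norm (\<mu> A)))"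
      by (rule sum.mono_neutral_right) (use P(1) assms in auto)
    moreover have "\<dots> \<le> (\<Sum>A\<in>?P. ennreal (norm (\<mu> A)))"
      by (rule sum_mono2) (use P(1) in auto)
    ultimately show "(\<Sum>A\<in>P. ennreal (norm (\<mu> A))) \<le> variation \<mu>"
      by (metis order_trans)
  qed
qed

lemma sum_norm_le_variation:
  assumes "\<mu> \<in> cabv" "finite I" "\<And>i. i \<in> I \<Longrightarrow> A i \<in> sets borel" "disjoint_family_on A I"
  shows "(\<Sum>i\<in>I. norm (\<mu> (A i))) \<le> enn2real (variation \<mu>)"
proof -
  note 0 = cabv_empty[OF assms(1)]
  have "ennreal (\<Sum>i\<in>I. norm (\<mu> (A i))) = (\<Sum>i\<in>I. ennreal (norm (\<mu> (A i))))"
    by (rule sum_ennreal[symmetric]) simp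
  also have "\<dots> \<le> variation \<mu>"
    unfolding variation_eq_variation_on[of \<mu>, OF 0]
    by (rule sum_le_variation_on) (use assms 0 in auto)
  also have "\<dots> = ennreal (enn2real (variation \<mu>))"
    using assms(1) by (simp add: cabv_def)
  finally show ?thesis by simp
qed

lemma variation_on_mono: "S \<subseteq> S' \<Longrightarrow> variation_on \<mu> S \<le> variation_on \<mu> S'"
  unfolding variation_on_def by (rule SUP_subset_mono) auto

lemma variation_on_empty: "\<mu> {} = 0 \<Longrightarrow> variation_on \<mu> {} = 0"
  unfolding variation_on_def
  by (rule antisym[OF SUP_least]) (auto simp del: sum_ennreal intro!: sum.neutral)

lemma variation_on_superadditive:
  fixes \<mu> :: "'t::topological_space set \<Rightarrow> 'x::real_normed_vector"
  assumes "\<mu> {} = 0" "S \<inter> S' = {}"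
  shows "variation_on \<mu> S + variation_on \<mu> S' \<le> variation_on \<mu> (S \<union> S')"
proof -
  let ?F = "\<lambda>S. {P. finite P \<and> P \<subseteq> sets borel \<and> disjoint P \<and> \<Union>P \<subseteq> (S :: 't set)}"
  let ?s = "\<lambda>P. \<Sum>A\<in>P. ennreal (norm (\<mu> A))"
  have ne: "?F S \<noteq> {}" for S :: "'t set"
    by (auto intro!: exI[of _ "{}"])
  have "variation_on \<mu> S + variation_on \<mu> S' = (SUP P\<in>?F S. SUP Q\<in>?F S'. ?s P + ?s Q)"
    unfolding variation_on_def ennreal_SUP_add_right[OF ne, symmetric]
    by (rule ennreal_SUP_add_left[OF ne, symmetric])
  also have "\<dots> \<le> variation_on \<mu> (S \<union> S')"
  proof (intro SUP_least)
    fix P Q assume P: "P \<in> ?F S" and Q: "Q \<in> ?F S'"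
    have "P \<inter> Q \<subseteq> {{}}" using P Q assms(2) by blast
    then have "?s (P \<inter> Q) = 0" using assms(1) by (intro sum.neutral) auto
    then have "?s P + ?s Q = ?s (P \<union> Q)"
      using P Q sum.union_inter[of P Q "\<lambda>A. ennreal (norm (\<mu> A))"] by simp
    also have "\<dots> \<le> variation_on \<mu> (S \<union> S')"
      unfolding variation_on_def
    proof (rule SUP_upper, safe)
      have "\<Union>P \<inter> \<Union>Q = {}" using P Q assms(2) by blast
      then show "disjoint (P \<union> Q)"
        using P Q by (intro disjoint_union) auto
    qed (use P Q in auto)
    finally show "?s P + ?s Q \<le> variation_on \<mu> (S \<union> S')" .
  qed
  finally show ?thesis .
qed

text \<open>
  Superadditivity comes from putting families of disjoint sets together. For the other inequality each member \<open>B\<close> of a family inside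
  \<open>\<Union>i. A i\<close> is cut into the pieces \<open>B \<inter> A i\<close>, and countable additivity of \<open>\<mu>\<close> gives
  \<open>\<bar>\<mu> B\<bar> \<le> (\<Sum>i. \<bar>\<mu> (B \<inter> A i)\<bar>)\<close>.
\<close>

lemma countably_additive_variation_on:
  fixes \<mu> :: "'t::topological_space set \<Rightarrow> 'x::real_normed_vector"
  assumes \<mu>: "\<mu> \<in> cabv"
  shows "countably_additive (sets borel) (variation_on \<mu>)"
proof (rule countably_additiveI)
  fix A :: "nat \<Rightarrow> 't set"
  assume A: "range A \<subseteq> sets borel" "disjoint_family A"
  note 0 = cabv_empty[OF \<mu>]
  show "(\<Sum>i. variation_on \<mu> (A i)) = variation_on \<mu> (\<Union>i. A i)"
  proof (rule antisym)
    have "(\<Sum>i<n. variation_on \<mu> (A i)) \<le> variation_on \<mu> (\<Union>i<n. A i)" for n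
    proof (induction n)
      case (Suc n)
      have "A i \<inter> A n = {}" if "i < n" for i
        using disjoint_family_onD[OF A(2), of i n] that by simp
      then have "(\<Union>i<n. A i) \<inter> A n = {}" by auto
      then have "variation_on \<mu> (\<Union>i<n. A i) + variation_on \<mu> (A n)
          \<le> variation_on \<mu> ((\<Union>i<n. A i) \<union> A n)"
        by (rule variation_on_superadditive[of \<mu>, OF 0])
      moreover have "(\<Union>i<n. A i) \<union> A n = (\<Union>i<Suc n. A i)"
        by (simp add: lessThan_Suc Un_commute)
      ultimately show ?case
        using order_trans[OF add_right_mono[OF Suc]] by simp
    qed (simp add: variation_on_empty 0)
    then show "(\<Sum>i. variation_on \<mu> (A i)) \<le> variation_on \<mu> (\<Union>i. A i)"
      by (intro suminf_le_const) (auto intro: order_trans[OF _ variation_on_mono])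
    show "variation_on \<mu> (\<Union>i. A i) \<le> (\<Sum>i. variation_on \<mu> (A i))"
      unfolding variation_on_def[of \<mu> "\<Union>i. A i"]
    proof (rule SUP_least, safe)
      fix P :: "'t set set"
      assume P: "finite P" "P \<subseteq> sets borel" "disjoint P" "\<Union>P \<subseteq> (\<Union>i. A i)"
      have "(\<Sum>B\<in>P. ennreal (norm (\<mu> B))) \<le> (\<Sum>B\<in>P. \<Sum>i. ennreal (norm (\<mu> (B \<inter> A i))))"
      proof (rule sum_mono)
        fix B assume B: "B \<in> P"
        have "(\<lambda>i. \<mu> (B \<inter> A i)) sums \<mu> (\<Union>i. B \<inter> A i)"
        proof -
          have "range (\<lambda>i. B \<inter> A i) \<subseteq> sets borel" "disjoint_family (\<lambda>i. B \<inter> A i)"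
            using A B P(2) by (auto simp: disjoint_family_on_def)
          then show ?thesis by (rule cabv_sums[OF \<mu>])
        qed
        moreover have "(\<Union>i. B \<inter> A i) = B" using B P(4) by blast
        ultimately have lim: "(\<lambda>n. norm (\<Sum>i<n. \<mu> (B \<inter> A i))) \<longlonglongrightarrow> norm (\<mu> B)"
          by (simp add: sums_def tendsto_norm)
        have "ennreal (norm (\<Sum>i<n. \<mu> (B \<inter> A i))) \<le> (\<Sum>i. ennreal (norm (\<mu> (B \<inter> A i))))" for n
        proof -
          have "ennreal (norm (\<Sum>i<n. \<mu> (B \<inter> A i))) \<le> ennreal (\<Sum>i<n. norm (\<mu> (B \<inter> A i)))"
            by (rule ennreal_leI) (rule norm_sum)
          also have "\<dots> = (\<Sum>i<n. ennreal (norm (\<mu> (B \<inter> A i))))"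
            by (rule sum_ennreal[symmetric]) simp
          also have "\<dots> \<le> (\<Sum>i. ennreal (norm (\<mu> (B \<inter> A i))))"
            by (rule sum_le_suminf) auto
          finally show ?thesis .
        qed
        then show "ennreal (norm (\<mu> B)) \<le> (\<Sum>i. ennreal (norm (\<mu> (B \<inter> A i))))"
          by (intro LIMSEQ_le_const2[OF tendsto_ennrealI[OF lim]]) auto
      qed
      also have "\<dots> = (\<Sum>i. \<Sum>B\<in>P. ennreal (norm (\<mu> (B \<inter> A i))))"
        by (rule suminf_sum[symmetric]) auto
      also have "\<dots> \<le> (\<Sum>i. variation_on \<mu> (A i))"
      proof (rule suminf_le)
        fix i
        show "(\<Sum>B\<in>P. ennreal (norm (\<mu> (B \<inter> A i)))) \<le> variation_on \<mu> (A i)"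
          by (rule sum_le_variation_on)
            (use P A 0 in \<open>auto simp: disjoint_family_on_def disjoint_def\<close>)
      qed auto
      finally show "(\<Sum>B\<in>P. ennreal (norm (\<mu> B))) \<le> (\<Sum>i. variation_on \<mu> (A i))" .
    qed
  qed
qed

lemma finite_measure_from_real:
  fixes m :: "'t::topological_space set \<Rightarrow> real"
  assumes nonneg: "\<And>B. B \<in> sets borel \<Longrightarrow> 0 \<le> m B"
    and sums: "\<And>A. range A \<subseteq> sets borel \<Longrightarrow> disjoint_family A \<Longrightarrow>
      (\<lambda>i::nat. m (A i)) sums m (\<Union>i. A i)"
  obtains N where "finite_measure N" "sets N = sets borel" "\<And>B. B \<in> sets borel \<Longrightarrow> measure N B = m B"
proof
  define N where "N = measure_of UNIV (sets borel) (\<lambda>B. ennreal (m B))"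
  show sets: "sets N = sets borel"
    unfolding N_def by (metis sets.sigma_sets_eq sets_measure_of space_borel top_greatest Pow_UNIV)
  have "m {} = 0"
    using sums[of "\<lambda>_. {}"] sums_summable summable_const_iff
    by (auto simp: disjoint_family_on_def) 
  have "countably_additive (sets N) (\<lambda>B. ennreal (m B))"
  proof (rule countably_additiveI)
    fix A :: "nat \<Rightarrow> 't set"
    assume A: "range A \<subseteq> sets N" "disjoint_family A" "(\<Union>i. A i) \<in> sets N"
    have "(\<lambda>i. ennreal (m (A i))) sums ennreal (m (\<Union>i. A i))"
      by (subst sums_ennreal) (use A sets nonneg sums in \<open>auto simp: range_subsetD\<close>)
    then show "(\<Sum>i. ennreal (m (A i))) = ennreal (m (\<Union>i. A i))"
      by (simp add: sums_iff)
  qed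
  moreover have "positive (sets N) (\<lambda>B. ennreal (m B))"
    using \<open>m {} = 0\<close> by (simp add: positive_def)
  ultimately have em: "emeasure N B = ennreal (m B)" if "B \<in> sets borel" for B
    using that sets by (intro emeasure_measure_of[OF N_def]) (auto simp: sets.sets_into_space)
  then show "measure N B = m B" if "B \<in> sets borel" for B
    using that nonneg by (simp add: measure_def)
  have "space N = UNIV" using sets_eq_imp_space_eq[OF sets] by simp
  then show "finite_measure N"
    by (intro finite_measureI) (simp add: em)
qed

text \<open>
  Each real coordinate of \<open>\<mu>\<close>, taken along the real basis of the value space, is the difference of two finite positive measures. The
  pair need not be the minimal one of the Jordan decomposition. It reduces integrals against \<open>\<mu>\<close> to Lebesgue integrals.
\<close>

definition jordan_rep ::
    "('t::topological_space set \<Rightarrow> 'x::euclidean_space) \<Rightarrow> ('x \<Rightarrow> 't measure) \<Rightarrow> ('x \<Rightarrow> 't measure) \<Rightarrow> bool"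
  where
  "jordan_rep \<mu> P Q \<longleftrightarrow>
     (\<forall>b\<in>Basis. finite_measure (P b) \<and> sets (P b) = sets borel \<and>
                finite_measure (Q b) \<and> sets (Q b) = sets borel) \<and>
     (\<forall>B\<in>sets borel. \<mu> B = (\<Sum>b\<in>Basis. (measure (P b) B - measure (Q b) B) *\<^sub>R b))"

text \<open>
  With \<open>V = \<bar>\<mu>\<bar>\<close> every coordinate satisfies \<open>\<bar>\<mu> B \<bullet> b\<bar> \<le> V B\<close>, so that \<open>V +
  \<mu> \<bullet> b\<close> and \<open>V\<close> are positive measures with difference \<open>\<mu> \<bullet> b\<close>. The bound on their total
  masses is uniform on variation balls, which is what compactness needs.
\<close>

lemma jordan_rep_exists:
  fixes \<mu> :: "'t::topological_space set \<Rightarrow> 'x::euclidean_space"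
  assumes \<mu>: "\<mu> \<in> cabv"
  obtains P Q where "jordan_rep \<mu> P Q"
    "\<And>b. b \<in> Basis \<Longrightarrow> measure (P b) UNIV \<le> 2 * enn2real (variation \<mu>)"
    "\<And>b. b \<in> Basis \<Longrightarrow> measure (Q b) UNIV \<le> 2 * enn2real (variation \<mu>)"
proof -
  note 0 = cabv_empty[OF \<mu>]
  have fin: "variation_on \<mu> UNIV < \<infinity>"
    using \<mu> variation_eq_variation_on[of \<mu>, OF 0] by (simp add: cabv_def)
  define V where "V = measure_of UNIV (sets borel) (variation_on \<mu>)"
  have sV: "sets V = sets borel"
    unfolding V_def by (metis sets.sigma_sets_eq sets_measure_of space_borel top_greatest Pow_UNIV)
  have eV: "emeasure V B = variation_on \<mu> B" if "B \<in> sets borel" for B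
    using that sV countably_additive_variation_on[OF \<mu>] variation_on_empty[of \<mu>, OF 0]
    by (intro emeasure_measure_of[OF V_def]) (auto simp: positive_def)
  have spV: "space V = UNIV" using sets_eq_imp_space_eq[OF sV] by simp
  interpret V: finite_measure V
    by (rule finite_measureI) (use fin in \<open>simp add: spV eV\<close>)
  have V_ge: "norm (\<mu> B) \<le> measure V B" if "B \<in> sets borel" for B
  proof -
    have "ennreal (norm (\<mu> B)) \<le> emeasure V B"
      using sum_le_variation_on[of \<mu> "{B}" id B] that 0 by (simp add: eV disjoint_family_on_def)
    then show ?thesis by (simp add: V.emeasure_eq_measure)
  qed
  have ex: "\<exists>N. finite_measure N \<and> sets N = sets borel \<and>
      (\<forall>B\<in>sets borel. measure N B = measure V B + \<mu> B \<bullet> b)" if b: "b \<in> Basis" for b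
  proof -
    have "0 \<le> measure V B + \<mu> B \<bullet> b" if "B \<in> sets borel" for B
      using V_ge[OF that] Basis_le_norm[OF b, of "\<mu> B"] by linarith
    moreover have "(\<lambda>i. measure V (A i) + \<mu> (A i) \<bullet> b) sums (measure V (\<Union>i. A i) + \<mu> (\<Union>i. A i) \<bullet> b)"
      if A: "range A \<subseteq> sets borel" "disjoint_family A" for A :: "nat \<Rightarrow> 't set"
    proof (intro sums_add bounded_linear.sums[OF bounded_linear_inner_left])
      show "(\<lambda>i. measure V (A i)) sums measure V (\<Union>i. A i)"
        using A sV by (intro V.finite_measure_UNION) auto
      show "(\<lambda>i. \<mu> (A i)) sums \<mu> (\<Union>i. A i)"
        by (rule cabv_sums[OF \<mu> A])
    qed
    ultimately show ?thesis
      by (rule finite_measure_from_real[of "\<lambda>B. measure V B + \<mu> B \<bullet> b"]) blast+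
  qed
  define P where "P b = (SOME N. finite_measure N \<and> sets N = sets borel \<and>
      (\<forall>B\<in>sets borel. measure N B = measure V B + \<mu> B \<bullet> b))" for b
  have P: "finite_measure (P b)" "sets (P b) = sets borel"
      "\<And>B. B \<in> sets borel \<Longrightarrow> measure (P b) B = measure V B + \<mu> B \<bullet> b" if "b \<in> Basis" for b
    using someI_ex[OF ex[OF that]] by (auto simp: P_def)
  have V1: "measure V UNIV = enn2real (variation \<mu>)"
    by (simp add: measure_def eV variation_eq_variation_on[of \<mu>, OF 0])
  show ?thesis
  proof (rule that[of P "\<lambda>_. V"])
    show "jordan_rep \<mu> P (\<lambda>_. V)"
      unfolding jordan_rep_def
    proof (intro conjI ballI)
      fix B :: "'t set" assume B: "B \<in> sets borel"
      have "(\<Sum>b\<in>Basis. (measure (P b) B - measure V B) *\<^sub>R b) = (\<Sum>b\<in>Basis. (\<mu> B \<bullet> b) *\<^sub>R b)"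
        using P(3) B by (intro sum.cong) auto
      then show "\<mu> B = (\<Sum>b\<in>Basis. (measure (P b) B - measure V B) *\<^sub>R b)"
        by (simp add: euclidean_representation)
    qed (use P sV V.finite_measure_axioms in auto)
    show "measure (P b) UNIV \<le> 2 * enn2real (variation \<mu>)" if b: "b \<in> Basis" for b
      using P(3)[OF b, of UNIV] V_ge[of UNIV] Basis_le_norm[OF b, of "\<mu> UNIV"] by (simp add: V1)
  qed (simp add: V1)
qed

lemma jordan_rep_cabv:
  fixes \<mu> :: "'t::topological_space set \<Rightarrow> 'x::euclidean_space"
  assumes rep: "jordan_rep \<mu> P Q" and off: "\<And>A. A \<notin> sets borel \<Longrightarrow> \<mu> A = 0"
  shows "\<mu> \<in> cabv"
proof -
  have P: "finite_measure (P b)" "sets (P b) = sets borel"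
      "finite_measure (Q b)" "sets (Q b) = sets borel" if "b \<in> Basis" for b
    using rep that by (auto simp: jordan_rep_def)
  have sp: "space (P b) = UNIV" "space (Q b) = UNIV" if "b \<in> Basis" for b
    using sets_eq_imp_space_eq[OF P(2)[OF that]] sets_eq_imp_space_eq[OF P(4)[OF that]] by simp_all
  have eq: "\<mu> B = (\<Sum>b\<in>Basis. (measure (P b) B - measure (Q b) B) *\<^sub>R b)" if "B \<in> sets borel" for B
    using rep that by (simp add: jordan_rep_def)
  have add: "(\<lambda>i. \<mu> (A i)) sums \<mu> (\<Union>i. A i)"
    if A: "range A \<subseteq> sets borel" "disjoint_family A" for A :: "nat \<Rightarrow> 't set"
  proof -
    have "(\<lambda>i. \<Sum>b\<in>Basis. (measure (P b) (A i) - measure (Q b) (A i)) *\<^sub>R b) sums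
        (\<Sum>b\<in>Basis. (measure (P b) (\<Union>i. A i) - measure (Q b) (\<Union>i. A i)) *\<^sub>R b)"
      using A P
      by (intro sums_sum bounded_linear.sums[OF bounded_linear_scaleR_left] sums_diff
          finite_measure.finite_measure_UNION) auto
    moreover have "A i \<in> sets borel" for i using A by auto
    ultimately show ?thesis using A by (simp add: eq)
  qed
  define C where "C = (\<Sum>b\<in>(Basis :: 'x set). measure (P b) UNIV + measure (Q b) UNIV)"
  have "variation \<mu> \<le> ennreal C"
    unfolding variation_def
  proof (rule SUP_least, safe)
    fix D :: "'t set set"
    assume D: "finite D" "D \<subseteq> sets borel" "partition_on UNIV D"
    have part: "(\<Sum>B\<in>D. measure N B) \<le> measure N UNIV" 
      if "finite_measure N" "sets N = sets borel" for N :: "'t measure"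
    proof -
      interpret finite_measure N by fact
      have "measure N (\<Union>B\<in>D. B) = (\<Sum>B\<in>D. measure N B)"
        by (rule finite_measure_finite_Union)
          (use D that in \<open>auto simp: partition_on_def disjoint_family_on_def disjoint_def\<close>)
      then show ?thesis using D(3) by (simp add: partition_on_def)
    qed
    have "(\<Sum>B\<in>D. norm (\<mu> B)) \<le> (\<Sum>B\<in>D. \<Sum>b\<in>Basis. measure (P b) B + measure (Q b) B)"
    proof (rule sum_mono)
      fix B assume "B \<in> D"
      then have "B \<in> sets borel" using D by auto
      then have "norm (\<mu> B) \<le> (\<Sum>b\<in>Basis. norm ((measure (P b) B - measure (Q b) B) *\<^sub>R b))"
        by (simp only: eq norm_sum)
      also have "\<dots> \<le> (\<Sum>b\<in>Basis. measure (P b) B + measure (Q b) B)"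
        by (intro sum_mono) (auto simp: abs_le_iff add_increasing add_increasing2)
      finally show "norm (\<mu> B) \<le> (\<Sum>b\<in>Basis. measure (P b) B + measure (Q b) B)" .
    qed
    also have "\<dots> = (\<Sum>b\<in>Basis. (\<Sum>B\<in>D. measure (P b) B) + (\<Sum>B\<in>D. measure (Q b) B))"
      by (subst sum.swap) (simp add: sum.distrib)
    also have "\<dots> \<le> C"
      unfolding C_def using P by (intro sum_mono add_mono part) auto
    finally show "(\<Sum>B\<in>D. ennreal (norm (\<mu> B))) \<le> ennreal C"
      by (simp add: sum_ennreal ennreal_leI)
  qed
  then have "variation \<mu> < \<infinity>" by (auto intro: le_less_trans)
  with add off show ?thesis by (auto simp: cabv_def)
qed

section \<open>Binary cells of a compact metric space\<close>

text \<open>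
  The sequence \<open>B\<close> of sets cuts the space into cells: after \<open>m\<close> steps the address of \<open>t\<close> records which of
  \<open>B 0, \<dots>, B (m - 1)\<close> contain \<open>t\<close>. The latest digit is the head of the list, so that passing to a subcell is
  \<open>Cons\<close>.
\<close>

fun word :: "(nat \<Rightarrow> 't set) \<Rightarrow> nat \<Rightarrow> 't \<Rightarrow> bool list" where
  "word B 0 t = []"
| "word B (Suc m) t = (t \<in> B m) # word B m t"

definition cell :: "(nat \<Rightarrow> 't set) \<Rightarrow> bool list \<Rightarrow> 't set" where
  "cell B w = {t. word B (length w) t = w}"

definition cell_point :: "(nat \<Rightarrow> 't set) \<Rightarrow> bool list \<Rightarrow> 't" where
  "cell_point B w = (SOME t. t \<in> cell B w)"

text \<open>
  The diameters of the cells tend to \<open>0\<close>, uniformly over all cells of the same level.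
\<close>

definition fine_seq :: "(nat \<Rightarrow> 't::metric_space set) \<Rightarrow> bool" where
  "fine_seq B \<longleftrightarrow> range B \<subseteq> sets borel \<and>
     (\<forall>e>0. \<exists>k. \<forall>m\<ge>k. \<forall>s t. word B m s = word B m t \<longrightarrow> dist s t < e)"

lemma length_word [simp]: "length (word B m t) = m"
  by (induction m) auto

lemma word_eqD: "word B m s = word B m t \<Longrightarrow> i < m \<Longrightarrow> s \<in> B i \<longleftrightarrow> t \<in> B i"
  by (induction m) (auto simp: less_Suc_eq)

lemma cell_Cons: "cell B (b # w) = {t \<in> cell B w. (t \<in> B (length w)) = b}"
  by (auto simp: cell_def)

lemma cell_point_in: "t \<in> cell B w \<Longrightarrow> cell_point B w \<in> cell B w"
  unfolding cell_point_def by (rule someI)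

lemma word_cell_point [simp]: "word B m (cell_point B (word B m t)) = word B m t"
proof -
  have "t \<in> cell B (word B m t)" by (simp add: cell_def)
  from cell_point_in[OF this] show ?thesis by (simp add: cell_def)
qed

lemma cell_borel:
  fixes B :: "nat \<Rightarrow> 't::topological_space set"
  shows "range B \<subseteq> sets borel \<Longrightarrow> cell B w \<in> sets borel"
proof (induction w)
  case (Cons b w)
  then have "cell B w \<in> sets borel" "B (length w) \<in> sets borel" by auto
  moreover have "cell B (b # w) = (if b then cell B w \<inter> B (length w) else cell B w - B (length w))"
    by (auto simp: cell_Cons)
  ultimately show ?case by auto
qed (simp add: cell_def)

lemma finite_words: "finite {w :: bool list. length w = m}"
  using finite_lists_length_eq[of "UNIV :: bool set" m] by simp

text \<open>
  Enumerate, for all \<open>n\<close>, a finite cover by balls of radius \<open>1 / (n + 1)\<close>. As soon as all balls of the \<open>n\<close>-th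
  cover have been used, two points with the same address lie in a common one of them.
\<close>

lemma fine_seq_exists:
  assumes "compact (UNIV :: 't::metric_space set)"
  shows "\<exists>B :: nat \<Rightarrow> 't set. fine_seq B"
proof -
  have "\<exists>F. finite F \<and> (UNIV :: 't set) \<subseteq> (\<Union>x\<in>F. ball x (inverse (real (Suc n))))" for n
    using assms unfolding compact_eq_totally_bounded by simp
  then obtain F :: "nat \<Rightarrow> 't set" where F: "\<And>n. finite (F n)"
      "\<And>n. UNIV \<subseteq> (\<Union>x\<in>F n. ball x (inverse (real (Suc n))))"
    by metis
  define \<B> where "\<B> = (\<Union>n. (\<lambda>x. ball x (inverse (real (Suc n)))) ` F n)"
  have "countable \<B>"
    unfolding \<B>_def using F(1) by (intro countable_UN) (auto intro: countable_finite)
  have "F 0 \<noteq> {}" using F(2)[of 0] by auto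
  then have "\<B> \<noteq> {}" unfolding \<B>_def by blast
  define B where "B = from_nat_into \<B>"
  have B_in: "B i \<in> \<B>" for i unfolding B_def by (rule from_nat_into[OF \<open>\<B> \<noteq> {}\<close>])
  have "fine_seq B"
    unfolding fine_seq_def
  proof (intro conjI allI impI)
    have "\<B> \<subseteq> sets borel" by (auto simp: \<B>_def)
    then show "range B \<subseteq> sets borel" using B_in by blast
    fix e :: real assume "0 < e"
    then obtain n where n: "inverse (real (Suc n)) < e / 2"
      using reals_Archimedean[of "e / 2"] by auto
    let ?r = "inverse (real (Suc n))"
    define k where "k = Suc (Max ((\<lambda>x. to_nat_on \<B> (ball x ?r)) ` F n))"
    have "dist s t < e" if m: "m \<ge> k" and eq: "word B m s = word B m t" for m s t
    proof -
      obtain x where x: "x \<in> F n" "s \<in> ball x ?r" using F(2)[of n] by blast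
      define i where "i = to_nat_on \<B> (ball x ?r)"
      have "ball x ?r \<in> \<B>" using x(1) by (auto simp: \<B>_def)
      then have Bi: "B i = ball x ?r"
        unfolding B_def i_def by (rule from_nat_into_to_nat_on[OF \<open>countable \<B>\<close>])
      have "i \<le> Max ((\<lambda>x. to_nat_on \<B> (ball x ?r)) ` F n)"
        unfolding i_def using x(1) F(1) by (intro Max_ge) auto
      then have "i < m" using m by (simp add: k_def)
      then have "t \<in> ball x ?r" using word_eqD[OF eq] x(2) Bi by blast
      then show ?thesis using x(2) n dist_triangle2[of s t x] by (simp add: dist_commute)
    qed
    then show "\<exists>k. \<forall>m\<ge>k. \<forall>s t. word B m s = word B m t \<longrightarrow> dist s t < e" by blast
  qed
  then show ?thesis by (intro exI[of _ B])
qed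

text \<open>
  Evaluating \<open>f\<close> at a fixed representative of each cell gives step functions, and they converge uniformly because \<open>f\<close> is
  uniformly continuous and the cells shrink.
\<close>

lemma uniform_limit_cell_point:
  fixes f :: "'t::metric_space \<Rightarrow> 'b::metric_space"
  assumes "compact (UNIV :: 't set)" "fine_seq B" "continuous_on UNIV f"
  shows "uniform_limit UNIV (\<lambda>m t. f (cell_point B (word B m t))) f sequentially"
proof (rule uniform_limitI)
  fix e :: real assume "0 < e"
  have "uniformly_continuous_on UNIV f"
    using assms by (intro compact_uniformly_continuous)
  then obtain d where d: "0 < d" "\<And>s t. dist s t < d \<Longrightarrow> dist (f s) (f t) < e"
    using \<open>0 < e\<close> unfolding uniformly_continuous_on_def by (metis UNIV_I)
  obtain k where "\<And>m s t. m \<ge> k \<Longrightarrow> word B m s = word B m t \<Longrightarrow> dist s t < d"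
    using assms(2) d(1) unfolding fine_seq_def by metis
  then show "\<forall>\<^sub>F m in sequentially. \<forall>t\<in>UNIV. dist (f (cell_point B (word B m t))) (f t) < e"
    using d(2) by (auto simp: eventually_sequentially intro!: exI[of _ k])
qed

lemma simple_function_word:
  fixes B :: "nat \<Rightarrow> 't::topological_space set"
  assumes "range B \<subseteq> sets borel"
  shows "simple_function borel (\<lambda>t. g (word B m t))"
  unfolding simple_function_def
proof (intro conjI ballI)
  have "range (\<lambda>t. g (word B m t)) \<subseteq> g ` {w. length w = m}" by auto
  then show "finite ((\<lambda>t. g (word B m t)) ` space borel)"
    using finite_words[of m] by (simp add: finite_subset)
  fix x
  have "(\<lambda>t. g (word B m t)) -` {x} = (\<Union>w\<in>{w. length w = m \<and> g w = x}. cell B w)"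
    by (auto simp: cell_def)
  also have "\<dots> \<in> sets borel"
    by (intro sets.finite_UN cell_borel assms finite_subset[OF _ finite_words[of m]]) auto
  finally show "(\<lambda>t. g (word B m t)) -` {x} \<inter> space borel \<in> sets borel" by simp
qed

section \<open>The integral against a vector measure\<close>

lemma simple_function_borelD:
  assumes "simple_function borel s"
  shows "finite (range s)" "s -` {x} \<in> sets borel" "s \<in> borel_measurable borel"
proof -
  show "finite (range s)" using assms by (simp add: simple_function_def)
  show "s \<in> borel_measurable borel" using assms by (rule borel_measurable_simple_function)
  show "s -` {x} \<in> sets borel"
    using simple_functionD(2)[OF assms, of "{x}"] by simp
qed

text \<open>
  The integral of \<open>f\<close> against \<open>\<Sum>b. (P b - Q b) b\<close>, written with Lebesgue integrals. The scalar product is real-linear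
  in its second argument, so the coordinates of the measure may be taken out.
\<close>

definition rep_integral ::
    "('k::real_or_complex ^ 'n \<Rightarrow> 't measure) \<Rightarrow> ('k ^ 'n \<Rightarrow> 't measure) \<Rightarrow> ('t \<Rightarrow> 'k ^ 'n) \<Rightarrow> 'k" where
  "rep_integral P Q f = (\<Sum>b\<in>Basis. (\<integral>t. scalar_prod (f t) b \<partial>P b) - (\<integral>t. scalar_prod (f t) b \<partial>Q b))"

lemma integral_simple_scalar_prod:
  fixes s :: "'t::topological_space \<Rightarrow> 'k::real_or_complex ^ 'n"
  assumes "finite_measure N" and N: "sets N = sets borel" and s: "simple_function borel s"
  shows "(\<integral>t. scalar_prod (s t) b \<partial>N) = (\<Sum>x\<in>range s. measure N (s -` {x}) *\<^sub>R scalar_prod x b)"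
proof -
  interpret finite_measure N by fact
  note s' = simple_function_borelD[OF s]
  have eq: "scalar_prod (s t) b = (\<Sum>x\<in>range s. indicator (s -` {x}) t *\<^sub>R scalar_prod x b)" for t
  proof -
    have "(\<Sum>x\<in>range s. indicator (s -` {x}) t *\<^sub>R scalar_prod x b)
        = (\<Sum>x\<in>range s. if s t = x then scalar_prod x b else 0)"
      by (intro sum.cong) auto
    then show ?thesis using s'(1) by simp
  qed
  have "s -` {x} \<in> sets N" for x using s'(2) N by simp
  then have "has_bochner_integral N (\<lambda>t. \<Sum>x\<in>range s. indicator (s -` {x}) t *\<^sub>R scalar_prod x b)
      (\<Sum>x\<in>range s. measure N (s -` {x}) *\<^sub>R scalar_prod x b)"
    by (intro has_bochner_integral_sum has_bochner_integral_scaleR_left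
        has_bochner_integral_real_indicator) (auto simp: less_top[symmetric])
  then show ?thesis unfolding eq by (rule has_bochner_integral_integral_eq)
qed

lemma simple_vintegral_rep:
  fixes s :: "'t::topological_space \<Rightarrow> 'k::real_or_complex ^ 'n"
  assumes rep: "jordan_rep \<mu> P Q" and s: "simple_function borel s"
  shows "simple_vintegral \<mu> s = rep_integral P Q s"
proof -
  have "simple_vintegral \<mu> s = (\<Sum>x\<in>range s. \<Sum>b\<in>Basis.
      (measure (P b) (s -` {x}) - measure (Q b) (s -` {x})) *\<^sub>R scalar_prod x b)"
    unfolding simple_vintegral_def
    using rep simple_function_borelD(2)[OF s]
    by (intro sum.cong refl) (simp add: jordan_rep_def scalar_prod_sum_right scalar_prod.scaleR_right)
  also have "\<dots> = (\<Sum>b\<in>Basis. (\<Sum>x\<in>range s. measure (P b) (s -` {x}) *\<^sub>R scalar_prod x b)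
       - (\<Sum>x\<in>range s. measure (Q b) (s -` {x}) *\<^sub>R scalar_prod x b))"
    by (subst sum.swap) (simp add: scaleR_diff_left sum_subtractf)
  also have "\<dots> = rep_integral P Q s"
    unfolding rep_integral_def using rep s
    by (intro sum.cong refl) (simp add: jordan_rep_def integral_simple_scalar_prod)
  finally show ?thesis .
qed

lemma finite_measure_integral_uniform_limit:
  fixes s :: "nat \<Rightarrow> 't::topological_space \<Rightarrow> 'x::real_normed_vector"
    and g :: "'x \<Rightarrow> 'k::{banach, second_countable_topology}"
  assumes "finite_measure N" and N: "sets N = sets borel"
    and s: "\<And>m. s m \<in> borel_measurable borel" and bdd: "\<And>m. bounded (range (s m))"
    and lim: "uniform_limit UNIV s f sequentially"
    and g: "bounded_linear g"
  shows "(\<lambda>m. \<integral>t. g (s m t) \<partial>N) \<longlonglongrightarrow> (\<integral>t. g (f t) \<partial>N)"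
proof -
  interpret finite_measure N by fact
  have gm: "g \<in> borel_measurable borel"
    by (intro borel_measurable_continuous_onI linear_continuous_on g)
  obtain n where n: "\<And>m t. m \<ge> n \<Longrightarrow> dist (s m t) (f t) < 1"
    using uniform_limitD[OF lim, of 1] by (auto simp: eventually_sequentially)
  obtain C where C: "\<And>t. norm (s n t) \<le> C"
    using bdd[of n] by (auto simp: bounded_iff)
  have bound: "norm (s m t) \<le> C + 2" if "m \<ge> n" for m t
  proof -
    have "dist (s m t) (s n t) < 2"
      using n[OF that, of t] n[of n t] dist_triangle2[of "s m t" "s n t" "f t"] by simp
    then show ?thesis
      using C[of t] norm_triangle_sub[of "s m t" "s n t"] by (simp add: dist_norm)
  qed
  obtain K where K: "K \<ge> 0" "\<And>x. norm (g x) \<le> norm x * K"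
    using bounded_linear.nonneg_bounded[OF g] by blast
  have pt: "(\<lambda>m. s m t) \<longlonglongrightarrow> f t" for t
    using tendsto_uniform_limitI[OF lim] by simp
  have "(\<lambda>m. \<integral>t. g (s (m + n) t) \<partial>N) \<longlonglongrightarrow> (\<integral>t. g (f t) \<partial>N)"
  proof (rule integral_dominated_convergence[where w = "\<lambda>_. (C + 2) * K"])
    have gs: "(\<lambda>t. g (s m t)) \<in> borel_measurable N" for m
      using measurable_compose[OF s gm] by (simp add: measurable_cong_sets[OF N refl])
    then show "(\<lambda>t. g (s (m + n) t)) \<in> borel_measurable N" for m .
    have glim: "(\<lambda>m. g (s m t)) \<longlonglongrightarrow> g (f t)" for t
      by (rule bounded_linear.tendsto[OF g pt])
    show "(\<lambda>t. g (f t)) \<in> borel_measurable N"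
      by (rule borel_measurable_LIMSEQ_metric[OF gs]) (rule glim)
    show "AE t in N. (\<lambda>m. g (s (m + n) t)) \<longlonglongrightarrow> g (f t)"
      using LIMSEQ_ignore_initial_segment[OF glim] by simp
    show "AE t in N. norm (g (s (m + n) t)) \<le> (C + 2) * K" for m
      using K bound by (intro always_eventually allI order_trans[OF K(2)] mult_right_mono) auto
  qed simp
  then show ?thesis by (rule LIMSEQ_offset)
qed

lemma rep_integral_uniform_limit:
  fixes s :: "nat \<Rightarrow> 't::topological_space \<Rightarrow> 'k::real_or_complex ^ 'n"
  assumes rep: "jordan_rep \<mu> P Q" and s: "\<And>m. simple_function borel (s m)"
    and lim: "uniform_limit UNIV s f sequentially"
  shows "(\<lambda>m. simple_vintegral \<mu> (s m)) \<longlonglongrightarrow> rep_integral P Q f"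
  unfolding simple_vintegral_rep[OF rep s] rep_integral_def
proof (intro tendsto_sum tendsto_diff)
  fix b :: "'k ^ 'n" assume "b \<in> Basis"
  then have PQ: "finite_measure (P b)" "sets (P b) = sets borel"
      "finite_measure (Q b)" "sets (Q b) = sets borel"
    using rep by (simp_all add: jordan_rep_def)
  note bl = scalar_prod.bounded_linear_left[of b]
  have "bounded (range (s m))" for m
    by (rule finite_imp_bounded[OF simple_function_borelD(1)[OF s]])
  note conv = finite_measure_integral_uniform_limit[OF _ _ simple_function_borelD(3)[OF s] this lim bl]
  show "(\<lambda>m. \<integral>t. scalar_prod (s m t) b \<partial>P b) \<longlonglongrightarrow> (\<integral>t. scalar_prod (f t) b \<partial>P b)"
    by (rule conv[OF PQ(1,2)])
  show "(\<lambda>m. \<integral>t. scalar_prod (s m t) b \<partial>Q b) \<longlonglongrightarrow> (\<integral>t. scalar_prod (f t) b \<partial>Q b)"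
    by (rule conv[OF PQ(3,4)])
qed

text \<open>
  Both the existence of the limit that defines the integral and its independence of the approximating simple functions come from this formula: the
  Lebesgue integrals on the right converge along every uniformly convergent sequence of simple functions.
\<close>

lemma vintegral_rep:
  fixes f :: "'t::metric_space \<Rightarrow> 'k::real_or_complex ^ 'n"
  assumes rep: "jordan_rep \<mu> P Q" and T: "compact (UNIV :: 't set)" and f: "continuous_on UNIV f"
  shows "vintegral \<mu> f = rep_integral P Q f"
  unfolding vintegral_def
proof (rule the_equality)
  obtain B :: "nat \<Rightarrow> 't set" where B: "fine_seq B" using fine_seq_exists[OF T] by blast
  let ?s = "\<lambda>m t. f (cell_point B (word B m t))"
  have simple: "simple_function borel (?s m)" for m
    using simple_function_word[of B "\<lambda>w. f (cell_point B w)"] B by (simp add: fine_seq_def)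
  note lim = uniform_limit_cell_point[OF T B f]
  show "has_vintegral \<mu> f (rep_integral P Q f)"
    unfolding has_vintegral_def
    using simple lim rep_integral_uniform_limit[OF rep simple lim] by (intro exI[of _ ?s]) simp
next
  fix L assume "has_vintegral \<mu> f L"
  then show "L = rep_integral P Q f"
    unfolding has_vintegral_def by (elim exE conjE) (rule LIMSEQ_unique, assumption, rule rep_integral_uniform_limit[OF rep], auto)
qed

lemma vintegral_limit:
  fixes f :: "'t::metric_space \<Rightarrow> 'k::real_or_complex ^ 'n"
  assumes \<mu>: "\<mu> \<in> cabv" and T: "compact (UNIV :: 't set)" and f: "continuous_on UNIV f"
    and s: "\<And>m. simple_function borel (s m)" and lim: "uniform_limit UNIV s f sequentially"
  shows "(\<lambda>m. simple_vintegral \<mu> (s m)) \<longlonglongrightarrow> vintegral \<mu> f"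
proof -
  obtain P Q where rep: "jordan_rep \<mu> P Q" by (rule jordan_rep_exists[OF \<mu>]) (rule that)
  show ?thesis
    unfolding vintegral_rep[OF rep T f] by (rule rep_integral_uniform_limit[OF rep s lim])
qed

lemma continuous_simple_approx:
  fixes f :: "'t::metric_space \<Rightarrow> 'x::metric_space"
  assumes T: "compact (UNIV :: 't set)" and f: "continuous_on UNIV f"
  obtains s where "\<And>m. simple_function borel (s m)" "uniform_limit UNIV s f sequentially"
    "\<And>m. range (s m) \<subseteq> range f"
proof -
  obtain B :: "nat \<Rightarrow> 't set" where B: "fine_seq B" using fine_seq_exists[OF T] by blast
  show ?thesis
    using simple_function_word[of B "\<lambda>w. f (cell_point B w)"] B uniform_limit_cell_point[OF T B f]
    by (intro that[of "\<lambda>m t. f (cell_point B (word B m t))"]) (auto simp: fine_seq_def)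
qed

lemma simple_vintegral_compose:
  fixes s :: "'t::topological_space \<Rightarrow> 'x" and g :: "'x \<Rightarrow> 'k::real_or_complex ^ 'n"
  assumes \<mu>: "\<mu> \<in> cabv" and s: "simple_function borel s"
  shows "simple_vintegral \<mu> (\<lambda>t. g (s t)) = (\<Sum>x\<in>range s. scalar_prod (g x) (\<mu> (s -` {x})))"
proof (rule simple_vintegral_partition[OF \<mu>])
  show "finite (range s)" using s by (simp add: simple_function_def)
  show "s -` {x} \<in> sets borel" for x using simple_functionD(2)[OF s, of "{x}"] by simp
qed (auto simp: disjoint_family_on_def)

lemma norm_vintegral_le:
  fixes f :: "'t::metric_space \<Rightarrow> 'k::real_or_complex ^ 'n"
  assumes \<mu>: "\<mu> \<in> cabv" and T: "compact (UNIV :: 't set)" and f: "continuous_on UNIV f"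
    and C: "\<And>t. norm (f t) \<le> C"
  shows "norm (vintegral \<mu> f) \<le> C * enn2real (variation \<mu>)"
proof -
  obtain s where s: "\<And>m. simple_function borel (s m)" "uniform_limit UNIV s f sequentially"
    "\<And>m. range (s m) \<subseteq> range f"
    by (rule continuous_simple_approx[OF T f]) (rule that)
  have "norm (simple_vintegral \<mu> (s m)) \<le> C * enn2real (variation \<mu>)" for m
  proof -
    have "0 \<le> C" using order_trans[OF norm_ge_zero C] .
    have "norm (simple_vintegral \<mu> (s m)) \<le> (\<Sum>x\<in>range (s m). C * norm (\<mu> (s m -` {x})))"
      unfolding simple_vintegral_def
    proof (rule order_trans[OF norm_sum], rule sum_mono)
      fix x assume "x \<in> range (s m)"
      then have "norm x \<le> C" using s(3)[of m] C by auto
      then show "norm (scalar_prod x (\<mu> (s m -` {x}))) \<le> C * norm (\<mu> (s m -` {x}))"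
        by (intro order_trans[OF norm_scalar_prod_le] mult_right_mono) auto
    qed
    also have "\<dots> \<le> C * enn2real (variation \<mu>)"
      unfolding sum_distrib_left[symmetric] using \<open>0 \<le> C\<close> simple_function_borelD[OF s(1)]
      by (intro mult_left_mono sum_norm_le_variation[OF \<mu>]) (auto simp: disjoint_family_on_def)
    finally show ?thesis .
  qed
  then show ?thesis
    using tendsto_norm[OF vintegral_limit[OF \<mu> T f s(1,2)]] by (intro LIMSEQ_le_const2) auto
qed

lemma vintegral_diff_measure:
  fixes f :: "'t::metric_space \<Rightarrow> 'k::real_or_complex ^ 'n"
  assumes \<mu>: "\<mu> \<in> cabv" and \<nu>: "\<nu> \<in> cabv" and d: "(\<lambda>B. \<mu> B - \<nu> B) \<in> cabv"
    and T: "compact (UNIV :: 't set)" and f: "continuous_on UNIV f"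
  shows "vintegral (\<lambda>B. \<mu> B - \<nu> B) f = vintegral \<mu> f - vintegral \<nu> f"
proof -
  obtain s where s: "\<And>m. simple_function borel (s m)" "uniform_limit UNIV s f sequentially"
    by (rule continuous_simple_approx[OF T f]) (rule that)
  have "simple_vintegral (\<lambda>B. \<mu> B - \<nu> B) (s m) = simple_vintegral \<mu> (s m) - simple_vintegral \<nu> (s m)" for m
    by (simp add: simple_vintegral_def scalar_prod.diff_right sum_subtractf)
  then show ?thesis
    using vintegral_limit[OF d T f s] tendsto_diff[OF vintegral_limit[OF \<mu> T f s] vintegral_limit[OF \<nu> T f s]]
    by (simp only: LIMSEQ_unique)
qed

lemma vintegral_const:
  fixes x :: "'k::real_or_complex ^ 'n" and \<mu> :: "'t::metric_space set \<Rightarrow> 'k ^ 'n"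
  assumes \<mu>: "\<mu> \<in> cabv" and T: "compact (UNIV :: 't set)"
  shows "vintegral \<mu> (\<lambda>_. x) = scalar_prod x (\<mu> UNIV)"
proof -
  have "(\<lambda>m::nat. simple_vintegral \<mu> (\<lambda>_. x)) \<longlonglongrightarrow> vintegral \<mu> (\<lambda>_. x)"
    by (rule vintegral_limit[OF \<mu> T, where s = "\<lambda>_ _. x"])
      (simp_all add: uniform_limit_iff)
  then have "simple_vintegral \<mu> (\<lambda>_. x) = vintegral \<mu> (\<lambda>_. x)"
    by (simp add: LIMSEQ_const_iff)
  then show ?thesis by (simp add: simple_vintegral_def)
qed

lemma vintegral_scaleR:
  fixes f :: "'t::metric_space \<Rightarrow> 'k::real_or_complex ^ 'n"
  assumes \<mu>: "\<mu> \<in> cabv" and T: "compact (UNIV :: 't set)" and f: "continuous_on UNIV f"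
  shows "vintegral \<mu> (\<lambda>t. a *\<^sub>R f t) = a *\<^sub>R vintegral \<mu> f"
proof -
  obtain P Q where rep: "jordan_rep \<mu> P Q" by (rule jordan_rep_exists[OF \<mu>]) (rule that)
  have "continuous_on UNIV (\<lambda>t. a *\<^sub>R f t)" by (intro continuous_intros f)
  then show ?thesis
    by (simp add: vintegral_rep[OF rep T] f rep_integral_def scalar_prod.scaleR_left
        scaleR_diff_right scaleR_sum_right)
qed

text \<open>
  A measure of total mass \<open>0\<close> does not see constants, so a Lipschitz integrand may be normalised to vanish at a chosen point. This is why
  the Monge--Kantorovich norm is finite on such measures.
\<close>

lemma vintegral_diff_const:
  fixes f :: "'t::metric_space \<Rightarrow> 'k::real_or_complex ^ 'n"
  assumes \<mu>: "\<mu> \<in> cabv_mass 0" and T: "compact (UNIV :: 't set)" and f: "continuous_on UNIV f"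
  shows "vintegral \<mu> (\<lambda>t. f t - x) = vintegral \<mu> f"
proof -
  have c: "\<mu> \<in> cabv" "\<mu> UNIV = 0" using \<mu> by (auto simp: cabv_mass_def)
  obtain s where s: "\<And>m. simple_function borel (s m)" "uniform_limit UNIV s f sequentially"
    by (rule continuous_simple_approx[OF T f]) (rule that)
  have eq: "simple_vintegral \<mu> (\<lambda>t. s m t - x) = simple_vintegral \<mu> (s m)" for m
  proof -
    note sm = simple_function_borelD[OF s(1), of m]
    have "(\<Sum>y\<in>range (s m). \<mu> (s m -` {y})) = \<mu> (\<Union>y\<in>range (s m). s m -` {y})"
      using sm by (intro cabv_UN[symmetric] c) (auto simp: disjoint_family_on_def)
    also have "(\<Union>y\<in>range (s m). s m -` {y}) = UNIV" by auto
    finally have "(\<Sum>y\<in>range (s m). scalar_prod x (\<mu> (s m -` {y}))) = 0"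
      using c(2) by (simp flip: scalar_prod_sum_right)
    then show ?thesis
      unfolding simple_vintegral_compose[OF c(1) s(1)[of m], of "\<lambda>y. y - x"]
      by (simp add: simple_vintegral_def scalar_prod.diff_left sum_subtractf)
  qed
  have "(\<lambda>m. simple_vintegral \<mu> (\<lambda>t. s m t - x)) \<longlonglongrightarrow> vintegral \<mu> (\<lambda>t. f t - x)"
  proof (rule vintegral_limit[OF c(1) T])
    show "continuous_on UNIV (\<lambda>t. f t - x)" by (intro continuous_intros f)
    show "simple_function borel (\<lambda>t. s m t - x)" for m
      by (rule simple_function_compose1[OF s(1)])
    show "uniform_limit UNIV (\<lambda>m t. s m t - x) (\<lambda>t. f t - x) sequentially"
      using s(2) by (simp add: uniform_limit_iff dist_norm)
  qed
  then show ?thesis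
    unfolding eq using vintegral_limit[OF c(1) T f s] by (rule LIMSEQ_unique)
qed

section \<open>Approximation by Lipschitz functions and duality\<close>

lemma lipschitz_max:
  fixes f g :: "'t::metric_space \<Rightarrow> real"
  assumes "L-lipschitz_on UNIV f" "K-lipschitz_on UNIV g"
  shows "(L + K)-lipschitz_on UNIV (\<lambda>t. max (f t) (g t))"
proof (rule lipschitz_onI)
  fix s t
  have "dist (max (f s) (g s)) (max (f t) (g t)) \<le> dist (f s) (f t) + dist (g s) (g t)"
    by (auto simp: dist_real_def max_def)
  also have "\<dots> \<le> L * dist s t + K * dist s t"
    using assms by (intro add_mono lipschitz_onD) auto
  finally show "dist (max (f s) (g s)) (max (f t) (g t)) \<le> (L + K) * dist s t"
    by (simp add: distrib_right)
qed (use assms[THEN lipschitz_on_nonneg] in auto)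

text \<open>
  Regularity of finite measures, in the form of \<open>L\<^sup>1\<close>-approximation of indicator functions. The sets that can be approximated
  contain the closed sets, through the functions \<open>max 0 (1 - n * infdist t C)\<close>, and they are stable under complements (\<open>1 -
  f\<close>), finite unions (\<open>max\<close>) and increasing limits. One function has to serve finitely many measures at once, namely all the parts
  of a decomposition of a vector measure.
\<close>

lemma lipschitz_indicator_approx:
  fixes N :: "'i \<Rightarrow> 't::metric_space measure"
  assumes I: "finite I" and N: "\<And>i. i \<in> I \<Longrightarrow> finite_measure (N i)" "\<And>i. i \<in> I \<Longrightarrow> sets (N i) = sets borel"
    and B: "B \<in> sets borel" and e: "0 < e"
  shows "\<exists>f :: 't \<Rightarrow> real. (\<exists>L. L-lipschitz_on UNIV f) \<and> (\<forall>t. 0 \<le> f t \<and> f t \<le> 1) \<and>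
     (\<forall>i\<in>I. (\<integral>t. \<bar>f t - indicator B t\<bar> \<partial>N i) < e)"
proof -
  define good :: "('t \<Rightarrow> real) \<Rightarrow> bool"
    where "good f \<longleftrightarrow> (\<exists>L. L-lipschitz_on UNIV f) \<and> (\<forall>t. 0 \<le> f t \<and> f t \<le> 1)" for f
  define approx where "approx B \<longleftrightarrow> (\<forall>e>0. \<exists>f. good f \<and>
     (\<forall>i\<in>I. (\<integral>t. \<bar>f t - indicator B t\<bar> \<partial>N i) < e))" for B
  have good_meas: "f \<in> borel_measurable borel" if "good f" for f
    using that lipschitz_on_continuous_on by (auto simp: good_def intro: borel_measurable_continuous_onI)
  have meas: "borel_measurable (N i) = (borel_measurable borel :: ('t \<Rightarrow> real) set)" if "i \<in> I" for i
    using N(2)[OF that] by (rule measurable_cong_sets) simp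
  have int: "integrable (N i) h" if "i \<in> I" "h \<in> borel_measurable borel" "\<And>t. \<bar>h t\<bar> \<le> 1"
    for i and h :: "'t \<Rightarrow> real"
  proof (rule finite_measure.integrable_const_bound[OF N(1)[OF that(1)], of _ 1])
    show "h \<in> borel_measurable (N i)" using that(1,2) meas by simp
  qed (use that(3) in simp)
  have int_good: "integrable (N i) (\<lambda>t. \<bar>f t - indicator A t\<bar>)"
    if "i \<in> I" "good f" "A \<in> sets borel" for i f A
  proof (rule int[OF that(1)])
    show "(\<lambda>t. \<bar>f t - indicator A t\<bar>) \<in> borel_measurable borel"
      using good_meas[OF that(2)] that(3) by measurable
    fix t have "0 \<le> f t" "f t \<le> 1" using that(2) by (auto simp: good_def)
    then show "\<bar>\<bar>f t - indicator A t\<bar>\<bar> \<le> 1" by (simp add: indicator_def)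
  qed
  have closed: "approx C" if C: "closed C" for C
    unfolding approx_def
  proof (intro allI impI)
    fix e :: real assume e: "0 < e"
    define f where "f n t = max 0 (1 - real n * infdist t C)" for n t
    show "\<exists>f. good f \<and> (\<forall>i\<in>I. (\<integral>t. \<bar>f t - indicator C t\<bar> \<partial>N i) < e)"
    proof (cases "C = {}")
      case True
      have "good (\<lambda>_. 0)" by (auto simp: good_def intro!: exI[of _ 0] lipschitz_on_constant)
      then show ?thesis using e True by (intro exI[of _ "\<lambda>_. 0"]) simp
    next
      case False
      have lip: "good (f n)" for n
      proof -
        have "(0 + real n)-lipschitz_on UNIV (f n)"
          unfolding f_def
        proof (rule lipschitz_max[OF lipschitz_on_constant])
          show "(real n)-lipschitz_on UNIV (\<lambda>t. 1 - real n * infdist t C)"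
          proof (rule lipschitz_onI)
            fix s t :: 't
            have "\<bar>infdist s C - infdist t C\<bar> \<le> dist s t" by (rule infdist_triangle_abs)
            then have "real n * \<bar>infdist s C - infdist t C\<bar> \<le> real n * dist s t"
              by (intro mult_left_mono) auto
            then show "dist (1 - real n * infdist s C) (1 - real n * infdist t C) \<le> real n * dist s t"
              by (simp add: dist_real_def abs_minus_commute abs_mult flip: right_diff_distrib)
          qed simp
        qed
        then show ?thesis by (auto simp: good_def f_def infdist_nonneg)
      qed
      have pt: "(\<lambda>n. \<bar>f n t - indicator C t\<bar>) \<longlonglongrightarrow> 0" for t
      proof (cases "t \<in> C")
        case False
        then have pos: "0 < infdist t C"
          using C \<open>C \<noteq> {}\<close> in_closed_iff_infdist_zero infdist_nonneg by (metis less_eq_real_def)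
        obtain n0 where "1 / infdist t C < real n0" using reals_Archimedean2 by blast
        then have "f n t = 0" if "n \<ge> n0" for n
        proof -
          have "1 / infdist t C < real n" using \<open>1 / infdist t C < real n0\<close> that by linarith
          then have "1 < real n * infdist t C" using pos by (simp add: divide_less_eq)
          then show ?thesis by (simp add: f_def)
        qed
        then have "\<forall>\<^sub>F n in sequentially. 0 = \<bar>f n t - indicator C t\<bar>"
          using False by (auto simp: eventually_sequentially intro!: exI[of _ n0])
        then show ?thesis by (rule Lim_transform_eventually[OF tendsto_const])
      qed (simp add: f_def)
      have "(\<lambda>n. \<integral>t. \<bar>f n t - indicator C t\<bar> \<partial>N i) \<longlonglongrightarrow> (\<integral>t. 0 \<partial>N i)" if i: "i \<in> I" for i
      proof (rule integral_dominated_convergence[where w = "\<lambda>_. 1"])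
        show "(\<lambda>t. \<bar>f n t - indicator C t\<bar>) \<in> borel_measurable (N i)" for n
          by (rule borel_measurable_integrable[OF int_good[OF i lip]]) (use C in simp)
        show "integrable (N i) (\<lambda>_. 1 :: real)" by (rule int[OF i]) auto
        show "AE t in N i. norm \<bar>f n t - indicator C t\<bar> \<le> 1" for n
          by (auto simp: f_def indicator_def infdist_nonneg max_def)
      qed (use pt in auto)
      then have "\<forall>\<^sub>F n in sequentially. (\<integral>t. \<bar>f n t - indicator C t\<bar> \<partial>N i) < e" if "i \<in> I" for i
        using e that by (intro order_tendstoD(2)[of _ "\<integral>t. 0 \<partial>N i"]) auto
      then have "\<forall>\<^sub>F n in sequentially. \<forall>i\<in>I. (\<integral>t. \<bar>f n t - indicator C t\<bar> \<partial>N i) < e"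
        by (intro eventually_ball_finite I) auto
      then obtain n where "\<forall>i\<in>I. (\<integral>t. \<bar>f n t - indicator C t\<bar> \<partial>N i) < e"
        by (auto simp: eventually_sequentially)
      then show ?thesis using lip by (intro exI[of _ "f n"] conjI)
    qed
  qed
  have approx_Un: "approx (A \<union> A')" if A: "approx A" "approx A'" and AB: "A \<in> sets borel" "A' \<in> sets borel" for A A'
    unfolding approx_def
  proof (intro allI impI)
    fix e :: real assume e: "0 < e"
    obtain f where f: "good f" "\<forall>i\<in>I. (\<integral>t. \<bar>f t - indicator A t\<bar> \<partial>N i) < e / 2"
      using A(1) half_gt_zero[OF e] unfolding approx_def by blast
    obtain g where g: "good g" "\<forall>i\<in>I. (\<integral>t. \<bar>g t - indicator A' t\<bar> \<partial>N i) < e / 2"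
      using A(2) half_gt_zero[OF e] unfolding approx_def by blast
    let ?h = "\<lambda>t. max (f t) (g t)"
    have h: "good ?h"
      using f(1) g(1) lipschitz_max by (fastforce simp: good_def max_def)
    have "(\<integral>t. \<bar>?h t - indicator (A \<union> A') t\<bar> \<partial>N i) < e" if i: "i \<in> I" for i
    proof -
      have "(\<integral>t. \<bar>?h t - indicator (A \<union> A') t\<bar> \<partial>N i)
          \<le> (\<integral>t. \<bar>f t - indicator A t\<bar> + \<bar>g t - indicator A' t\<bar> \<partial>N i)"
      proof (intro integral_mono Bochner_Integration.integrable_add int_good i h f(1) g(1) AB)
        fix t
        have "0 \<le> f t" "f t \<le> 1" "0 \<le> g t" "g t \<le> 1" using f(1) g(1) by (auto simp: good_def)
        then show "\<bar>?h t - indicator (A \<union> A') t\<bar> \<le> \<bar>f t - indicator A t\<bar> + \<bar>g t - indicator A' t\<bar>"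
          by (cases "t \<in> A"; cases "t \<in> A'") (auto simp: max_def)
      qed (use AB in auto)
      also have "\<dots> < e / 2 + e / 2"
        unfolding Bochner_Integration.integral_add[OF int_good[OF i f(1) AB(1)] int_good[OF i g(1) AB(2)]]
        using i f(2) g(2) by (intro add_strict_mono) auto
      finally show ?thesis by simp
    qed
    with h show "\<exists>f. good f \<and> (\<forall>i\<in>I. (\<integral>t. \<bar>f t - indicator (A \<union> A') t\<bar> \<partial>N i) < e)" by blast
  qed
  have "approx B"
  proof -
    have Int: "Int_stable (Collect (closed :: 't set \<Rightarrow> bool))"
      by (auto simp: Int_stable_def)
    have sub: "Collect (closed :: 't set \<Rightarrow> bool) \<subseteq> Pow UNIV" by simp
    have "B \<in> sigma_sets UNIV (Collect closed)"
      using B unfolding borel_eq_closed by simp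
    with Int sub show ?thesis
    proof (induction rule: sigma_sets_induct_disjoint)
      case (compl A)
      have "A \<in> sets borel" using compl(1) unfolding borel_eq_closed by simp
      show ?case unfolding approx_def
      proof (intro allI impI)
        fix e :: real assume "0 < e"
        then obtain f where f: "good f" "\<forall>i\<in>I. (\<integral>t. \<bar>f t - indicator A t\<bar> \<partial>N i) < e"
          using compl(2) unfolding approx_def by blast
        obtain L where "L-lipschitz_on UNIV f" using f(1) by (auto simp: good_def)
        then have "L-lipschitz_on UNIV (\<lambda>t. 1 - f t)"
          by (auto simp: lipschitz_on_def dist_real_def abs_minus_commute)
        then have "good (\<lambda>t. 1 - f t)" using f(1) by (auto simp: good_def)
        moreover have "\<bar>1 - f t - indicator (UNIV - A) t\<bar> = \<bar>f t - indicator A t\<bar>" for t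
          by (simp add: indicator_def abs_minus_commute)
        ultimately show "\<exists>f. good f \<and> (\<forall>i\<in>I. (\<integral>t. \<bar>f t - indicator (UNIV - A) t\<bar> \<partial>N i) < e)"
          using f(2) by (intro exI[of _ "\<lambda>t. 1 - f t"]) simp
      qed
    next
      case (union A)
      have A: "A n \<in> sets borel" for n
        using union(2) unfolding borel_eq_closed by auto
      let ?U = "\<Union>n. A n"
      let ?u = "\<lambda>n. \<Union>k<n. A k"
      have U: "?U \<in> sets borel" "?u n \<in> sets borel" for n using A by auto
      have fin: "approx (?u n)" for n
      proof (induction n)
        case (Suc n)
        then have "approx (?u n \<union> A n)" using union(3) A U by (intro approx_Un) auto
        moreover have "?u n \<union> A n = ?u (Suc n)" by (simp add: lessThan_Suc Un_commute)
        ultimately show ?case by simp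
      qed (use closed[of "{}"] in simp)
      have tail: "(\<lambda>n. measure (N i) (?U - ?u n)) \<longlonglongrightarrow> 0" if i: "i \<in> I" for i
      proof -
        interpret Ni: finite_measure "N i" by (rule N(1)[OF i])
        have "(\<lambda>n. measure (N i) (?U - ?u n)) \<longlonglongrightarrow> measure (N i) (\<Inter>n. ?U - ?u n)"
        proof (rule Ni.finite_Lim_measure_decseq)
          show "range (\<lambda>n. ?U - ?u n) \<subseteq> sets (N i)" using U N(2)[OF i] by auto
          show "decseq (\<lambda>n. ?U - ?u n)" by (force simp: decseq_def)
        qed
        moreover have "(\<Inter>n. ?U - ?u n) = {}" by auto
        ultimately show ?thesis by (simp only: measure_empty)
      qed
      show ?case unfolding approx_def
      proof (intro allI impI)
        fix e :: real assume e: "0 < e"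
        have "\<forall>\<^sub>F n in sequentially. \<forall>i\<in>I. measure (N i) (?U - ?u n) < e / 2"
          using tail e by (intro eventually_ball_finite I ballI order_tendstoD(2)[of _ 0]) auto
        then obtain n where n: "\<forall>i\<in>I. measure (N i) (?U - ?u n) < e / 2"
          by (auto simp: eventually_sequentially)
        obtain f where f: "good f" "\<forall>i\<in>I. (\<integral>t. \<bar>f t - indicator (?u n) t\<bar> \<partial>N i) < e / 2"
          using fin[of n] half_gt_zero[OF e] unfolding approx_def by blast
        have "(\<integral>t. \<bar>f t - indicator ?U t\<bar> \<partial>N i) < e" if i: "i \<in> I" for i
        proof -
          interpret Ni: finite_measure "N i" by (rule N(1)[OF i])
          have D: "?U - ?u n \<in> sets (N i)" using U N(2)[OF i] by auto
          have iD: "integrable (N i) (indicator (?U - ?u n) :: 't \<Rightarrow> real)"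
            using D by (simp add: less_top[symmetric])
          have "(\<integral>t. \<bar>f t - indicator ?U t\<bar> \<partial>N i)
              \<le> (\<integral>t. \<bar>f t - indicator (?u n) t\<bar> + indicator (?U - ?u n) t \<partial>N i)"
          proof (intro integral_mono Bochner_Integration.integrable_add int_good i f(1) U iD)
            fix t
            have sub: "t \<in> ?u n \<Longrightarrow> t \<in> ?U" by blast
            show "\<bar>f t - indicator ?U t\<bar> \<le> \<bar>f t - indicator (?u n) t\<bar> + indicator (?U - ?u n) t"
            proof (cases "t \<in> ?U")
              case True
              then show ?thesis by (cases "t \<in> ?u n") (simp_all add: indicator_eq_1_iff)
            next
              case False
              moreover have "t \<notin> ?u n" using False by blast
              ultimately show ?thesis by simp
            qed
          qed
          also have "\<dots> = (\<integral>t. \<bar>f t - indicator (?u n) t\<bar> \<partial>N i) + measure (N i) (?U - ?u n)"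
            using i f(1) U iD D
            by (subst Bochner_Integration.integral_add) (auto intro!: int_good)
          also have "\<dots> < e / 2 + e / 2" using i n f(2) by (intro add_strict_mono) auto
          finally show ?thesis by simp
        qed
        with f(1) show "\<exists>f. good f \<and> (\<forall>i\<in>I. (\<integral>t. \<bar>f t - indicator ?U t\<bar> \<partial>N i) < e)" by blast
      qed
    qed (use closed in auto)
  qed
  then show ?thesis using e unfolding approx_def good_def by blast
qed

text \<open>
  The integral of a continuous \<open>f\<close> is close to the integral of the step function \<open>\<Sum>B\<in>D. indicator B * u B\<close> whenever
  \<open>f\<close> deviates from it at every point by no more than \<open>\<Sum>B\<in>D. \<bar>\<phi> B - indicator B\<bar>\<close>, because that
  bound has small integral against every part of a decomposition of \<open>\<mu>\<close>. The functions \<open>\<phi>\<close> are chosen before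
  \<open>f\<close> and \<open>u\<close>, which lets the two applications below build \<open>f\<close> from \<open>\<phi>\<close>.
\<close>

lemma vintegral_close_to_step_sum:
  fixes \<mu> :: "'t::metric_space set \<Rightarrow> 'k::real_or_complex ^ 'n"
  assumes \<mu>: "\<mu> \<in> cabv" and T: "compact (UNIV :: 't set)"
    and D: "finite D" "D \<subseteq> sets borel" and e: "0 < e"
  shows "\<exists>\<phi> :: 't set \<Rightarrow> 't \<Rightarrow> real.
    (\<forall>B\<in>D. (\<exists>L. L-lipschitz_on UNIV (\<phi> B)) \<and> (\<forall>t. 0 \<le> \<phi> B t \<and> \<phi> B t \<le> 1)) \<and>
    (\<forall>f u. continuous_on UNIV f \<longrightarrow>
      (\<forall>t. norm (f t - (\<Sum>B\<in>D. indicator B t *\<^sub>R u B)) \<le> (\<Sum>B\<in>D. \<bar>\<phi> B t - indicator B t\<bar>)) \<longrightarrow>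
      norm (vintegral \<mu> f - (\<Sum>B\<in>D. scalar_prod (u B) (\<mu> B))) \<le> e)"
proof -
  obtain P Q where rep: "jordan_rep \<mu> P Q" by (rule jordan_rep_exists[OF \<mu>]) (rule that)
  \<comment> \<open>The flag distinguishes the positive part \<open>P b\<close> from the negative part \<open>Q b\<close>.\<close>
  define I where "I = (Basis :: ('k ^ 'n) set) \<times> (UNIV :: bool set)"
  define N where "N i = (if snd i then P (fst i) else Q (fst i))" for i
  have N: "finite_measure (N i)" "sets (N i) = sets borel" if "i \<in> I" for i
    using rep that by (auto simp: N_def I_def jordan_rep_def)
  have "finite I" by (simp add: I_def)
  \<comment> \<open>The total error is at most \<open>card I * card D * \<delta>\<close>; the summand \<open>1\<close> keeps the denominator positive
  when \<open>D\<close> is empty.\<close>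
  define \<delta> where "\<delta> = e / (1 + real (card I) * real (card D))"
  have "0 < \<delta>" unfolding \<delta>_def using e by (intro divide_pos_pos add_pos_nonneg) auto
  have "\<forall>B\<in>D. \<exists>f :: 't \<Rightarrow> real. (\<exists>L. L-lipschitz_on UNIV f) \<and> (\<forall>t. 0 \<le> f t \<and> f t \<le> 1) \<and>
     (\<forall>i\<in>I. (\<integral>t. \<bar>f t - indicator B t\<bar> \<partial>N i) < \<delta>)"
    using D(2) \<open>0 < \<delta>\<close> by (intro ballI lipschitz_indicator_approx \<open>finite I\<close> N) auto
  then obtain \<phi> where \<phi>: "\<And>B. B \<in> D \<Longrightarrow> \<exists>L. L-lipschitz_on UNIV (\<phi> B)"
    "\<And>B t. B \<in> D \<Longrightarrow> 0 \<le> \<phi> B t \<and> \<phi> B t \<le> 1"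
    "\<And>B i. B \<in> D \<Longrightarrow> i \<in> I \<Longrightarrow> (\<integral>t. \<bar>\<phi> B t - indicator B t\<bar> \<partial>N i) < \<delta>"
    unfolding bchoice_iff by blast
  have bound: "norm (vintegral \<mu> f - (\<Sum>B\<in>D. scalar_prod (u B) (\<mu> B))) \<le> e"
    if f: "continuous_on UNIV f"
      and close: "\<And>t. norm (f t - (\<Sum>B\<in>D. indicator B t *\<^sub>R u B)) \<le> (\<Sum>B\<in>D. \<bar>\<phi> B t - indicator B t\<bar>)"
    for f and u :: "'t set \<Rightarrow> 'k ^ 'n"
  proof -
    let ?I = "\<lambda>b i. (\<integral>t. scalar_prod (f t) b \<partial>N i)"
    let ?S = "\<lambda>b i. (\<Sum>B\<in>D. measure (N i) B *\<^sub>R scalar_prod (u B) b)"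
    have est: "norm (?I b i - ?S b i) \<le> real (card D) * \<delta>" if b: "b \<in> Basis" and i: "i \<in> I" for b i
    proof -
      interpret Ni: finite_measure "N i" by (rule N(1)[OF i])
      have DN: "B \<in> sets (N i)" if "B \<in> D" for B using D(2) N(2)[OF i] that by auto
      have meas: "h \<in> borel_measurable (N i)" if "continuous_on UNIV h"
        for h :: "'t \<Rightarrow> 'z::topological_space"
        using borel_measurable_continuous_onI[OF that] measurable_cong_sets[OF N(2)[OF i] refl] by blast
      have "bounded (range f)"
        by (rule compact_imp_bounded[OF compact_continuous_image[OF f T]])
      then obtain C where C: "\<And>t. norm (f t) \<le> C" by (auto simp: bounded_iff)
      have int_f: "integrable (N i) (\<lambda>t. scalar_prod (f t) b)"
      proof (rule Ni.integrable_const_bound[of _ "C * norm b"])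
        show "AE t in N i. norm (scalar_prod (f t) b) \<le> C * norm b"
          using C by (intro always_eventually allI order_trans[OF norm_scalar_prod_le] mult_right_mono) auto
        show "(\<lambda>t. scalar_prod (f t) b) \<in> borel_measurable (N i)"
          by (intro meas scalar_prod.continuous_on f continuous_on_const)
      qed
      have S: "has_bochner_integral (N i) (\<lambda>t. \<Sum>B\<in>D. indicator B t *\<^sub>R scalar_prod (u B) b) (?S b i)"
        using DN by (intro has_bochner_integral_sum has_bochner_integral_scaleR_left
            has_bochner_integral_real_indicator) (auto simp: less_top[symmetric])
      have int_\<phi>: "integrable (N i) (\<lambda>t. \<bar>\<phi> B t - indicator B t\<bar>)" if B: "B \<in> D" for B
      proof (rule Ni.integrable_const_bound[of _ 1])
        have "\<bar>\<phi> B t - indicator B t\<bar> \<le> 1" for t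
          using \<phi>(2)[OF B, of t] by (simp add: indicator_def)
        then show "AE t in N i. norm \<bar>\<phi> B t - indicator B t\<bar> \<le> 1" by simp
        have "\<phi> B \<in> borel_measurable (N i)"
          using \<phi>(1)[OF B] by (auto intro: meas lipschitz_on_continuous_on)
        then show "(\<lambda>t. \<bar>\<phi> B t - indicator B t\<bar>) \<in> borel_measurable (N i)"
          using DN[OF B] by measurable
      qed
      have "norm (?I b i - ?S b i)
          = norm (\<integral>t. scalar_prod (f t) b - (\<Sum>B\<in>D. indicator B t *\<^sub>R scalar_prod (u B) b) \<partial>N i)"
        using int_f S by (simp add: Bochner_Integration.integral_diff has_bochner_integral_iff)
      also have "\<dots> \<le> (\<integral>t. (\<Sum>B\<in>D. \<bar>\<phi> B t - indicator B t\<bar>) \<partial>N i)"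
      proof (rule order_trans[OF integral_norm_bound integral_mono])
        show "integrable (N i) (\<lambda>t. norm (scalar_prod (f t) b - (\<Sum>B\<in>D. indicator B t *\<^sub>R scalar_prod (u B) b)))"
          using int_f S by (intro integrable_norm Bochner_Integration.integrable_diff) (auto simp: has_bochner_integral_iff)
        show "integrable (N i) (\<lambda>t. \<Sum>B\<in>D. \<bar>\<phi> B t - indicator B t\<bar>)"
          by (intro Bochner_Integration.integrable_sum int_\<phi>)
        fix t
        have "scalar_prod (f t) b - (\<Sum>B\<in>D. indicator B t *\<^sub>R scalar_prod (u B) b)
            = scalar_prod (f t - (\<Sum>B\<in>D. indicator B t *\<^sub>R u B)) b"
          by (simp add: scalar_prod.diff_left scalar_prod.sum_left scalar_prod.scaleR_left)
        also have "norm \<dots> \<le> norm (f t - (\<Sum>B\<in>D. indicator B t *\<^sub>R u B)) * norm b"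
          by (rule norm_scalar_prod_le)
        also have "\<dots> \<le> (\<Sum>B\<in>D. \<bar>\<phi> B t - indicator B t\<bar>)"
          using close[of t] b by simp
        finally show "norm (scalar_prod (f t) b - (\<Sum>B\<in>D. indicator B t *\<^sub>R scalar_prod (u B) b))
            \<le> (\<Sum>B\<in>D. \<bar>\<phi> B t - indicator B t\<bar>)" .
      qed
      also have "\<dots> = (\<Sum>B\<in>D. (\<integral>t. \<bar>\<phi> B t - indicator B t\<bar> \<partial>N i))"
        by (rule Bochner_Integration.integral_sum) (rule int_\<phi>)
      also have "\<dots> \<le> (\<Sum>B\<in>D. \<delta>)"
        using \<phi>(3) i by (intro sum_mono less_imp_le)
      finally show ?thesis by simp
    qed
    have eq1: "vintegral \<mu> f = (\<Sum>b\<in>Basis. ?I b (b, True) - ?I b (b, False))"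
      unfolding vintegral_rep[OF rep T f] rep_integral_def by (simp add: N_def)
    have eq2: "(\<Sum>B\<in>D. scalar_prod (u B) (\<mu> B)) = (\<Sum>b\<in>Basis. ?S b (b, True) - ?S b (b, False))"
    proof -
      have "(\<Sum>B\<in>D. scalar_prod (u B) (\<mu> B)) =
          (\<Sum>B\<in>D. \<Sum>b\<in>Basis. (measure (P b) B - measure (Q b) B) *\<^sub>R scalar_prod (u B) b)"
      proof (rule sum.cong)
        fix B assume "B \<in> D"
        then have "\<mu> B = (\<Sum>b\<in>Basis. (measure (P b) B - measure (Q b) B) *\<^sub>R b)"
          using rep D(2) unfolding jordan_rep_def by blast
        then show "scalar_prod (u B) (\<mu> B) =
            (\<Sum>b\<in>Basis. (measure (P b) B - measure (Q b) B) *\<^sub>R scalar_prod (u B) b)"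
          by (simp only: scalar_prod_sum_right scalar_prod.scaleR_right)
      qed simp
      also have "\<dots> = (\<Sum>b\<in>Basis. ?S b (b, True) - ?S b (b, False))"
        by (subst sum.swap) (simp add: N_def scaleR_diff_left sum_subtractf)
      finally show ?thesis .
    qed
    have "vintegral \<mu> f - (\<Sum>B\<in>D. scalar_prod (u B) (\<mu> B))
        = (\<Sum>b\<in>Basis. (?I b (b, True) - ?S b (b, True)) - (?I b (b, False) - ?S b (b, False)))"
      unfolding eq1 eq2 by (simp only: sum_subtractf) (simp add: algebra_simps)
    also have "norm \<dots> \<le> (\<Sum>b\<in>(Basis :: ('k ^ 'n) set). real (card D) * \<delta> + real (card D) * \<delta>)"
      by (intro sum_norm_le order_trans[OF norm_triangle_ineq4] add_mono est) (auto simp: I_def)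
    also have "\<dots> = real (card I) * real (card D) * \<delta>"
      by (simp add: I_def card_cartesian_product)
    also have "\<dots> \<le> e"
    proof -
      have "real (card I) * real (card D) * \<delta> \<le> (1 + real (card I) * real (card D)) * \<delta>"
        using \<open>0 < \<delta>\<close> by (intro mult_right_mono) auto
      also have "\<dots> = e"
      proof -
        have "0 < 1 + real (card I) * real (card D)" by (intro add_pos_nonneg) auto
        then show ?thesis unfolding \<delta>_def by simp
      qed
      finally show ?thesis .
    qed
    finally show ?thesis .
  qed
  show ?thesis by (intro exI[of _ \<phi>] conjI ballI allI impI) (simp_all add: \<phi>(1,2) bound)
qed

text \<open>
  The nontrivial half of the duality between measures and continuous functions. A partition sum \<open>\<Sum>B\<in>D. \<bar>\<mu> B\<bar>\<close> is
  the integral of the step function with values \<open>sgn (\<mu> B)\<close>. Replacing the indicators by continuous functions can push the norm above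
  \<open>1\<close>; the nearest-point projection onto the closed unit ball repairs this, and it does not increase the distance to the step function
  since it fixes the values of that function and is nonexpansive.
\<close>

lemma variation_le_if_vintegral_le:
  fixes \<mu> :: "'t::metric_space set \<Rightarrow> 'k::real_or_complex ^ 'n"
  assumes \<mu>: "\<mu> \<in> cabv" and T: "compact (UNIV :: 't set)"
    and C: "\<And>f. continuous_on UNIV f \<Longrightarrow> (\<And>t. norm (f t) \<le> 1) \<Longrightarrow> norm (vintegral \<mu> f) \<le> C"
  shows "variation \<mu> \<le> ennreal C"
  unfolding variation_def
proof (rule SUP_least, safe)
  fix D :: "'t set set"
  assume D: "finite D" "D \<subseteq> sets borel" "partition_on UNIV D"
  define u where "u B = sgn (\<mu> B)" for B
  have "(\<Sum>B\<in>D. norm (\<mu> B)) \<le> C + e" if e: "0 < e" for e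
  proof -
    obtain \<phi> where \<phi>: "\<forall>B\<in>D. (\<exists>L. L-lipschitz_on UNIV (\<phi> B)) \<and> (\<forall>t. 0 \<le> \<phi> B t \<and> \<phi> B t \<le> 1)"
      "\<forall>f u. continuous_on UNIV f \<longrightarrow>
        (\<forall>t. norm (f t - (\<Sum>B\<in>D. indicator B t *\<^sub>R u B)) \<le> (\<Sum>B\<in>D. \<bar>\<phi> B t - indicator B t\<bar>)) \<longrightarrow>
        norm (vintegral \<mu> f - (\<Sum>B\<in>D. scalar_prod (u B) (\<mu> B))) \<le> e"
      using vintegral_close_to_step_sum[OF \<mu> T D(1,2) e] by (elim exE conjE) (rule that)
    let ?g = "\<lambda>t. \<Sum>B\<in>D. indicator B t *\<^sub>R u B"
    let ?h = "\<lambda>t. \<Sum>B\<in>D. \<phi> B t *\<^sub>R u B"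
    \<comment> \<open>\<open>?h\<close> approximates the step function \<open>?g\<close>, and \<open>f\<close> is its projection to the unit
    ball.\<close>
    let ?b = "cball (0 :: 'k ^ 'n) 1"
    define f where "f t = closest_point ?b (?h t)" for t
    have b: "closed ?b" "?b \<noteq> {}" "convex ?b" by auto
    have "continuous_on UNIV ?h"
      using \<phi>(1) lipschitz_on_continuous_on
      by (intro continuous_on_sum continuous_on_scaleR continuous_on_const) blast
    then have f: "continuous_on UNIV f"
      unfolding f_def using b by (intro continuous_on_compose2[OF continuous_on_closest_point]) auto
    have f1: "norm (f t) \<le> 1" for t
      using closest_point_in_set[OF b(1,2), of "?h t"] by (simp add: f_def)
    have u1: "norm (u B) \<le> 1" for B by (simp add: u_def norm_sgn)
    have g1: "norm (?g t) \<le> 1" for t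
    proof -
      have "t \<in> \<Union>D" using D(3) by (simp add: partition_on_def)
      then obtain A where A: "A \<in> D" "t \<in> A" by blast
      have "t \<notin> B" if "B \<in> D - {A}" for B
        using D(3) A that by (auto simp: partition_on_def disjoint_def)
      then have "(\<Sum>B\<in>D - {A}. indicator B t *\<^sub>R u B) = 0"
        by (intro sum.neutral) simp
      then have "?g t = u A"
        using A by (simp add: sum.remove[OF D(1) A(1)])
      then show ?thesis using u1 by simp
    qed
    have "norm (f t - ?g t) \<le> (\<Sum>B\<in>D. \<bar>\<phi> B t - indicator B t\<bar>)" for t
    proof -
      have "?g t = closest_point ?b (?g t)"
        using g1[of t] by (intro closest_point_self[symmetric]) simp
      then have "norm (f t - ?g t) = dist (closest_point ?b (?h t)) (closest_point ?b (?g t))"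
        unfolding dist_norm f_def by simp
      also have "\<dots> \<le> dist (?h t) (?g t)"
        using b by (intro closest_point_lipschitz) auto
      also have "\<dots> = norm (\<Sum>B\<in>D. (\<phi> B t - indicator B t) *\<^sub>R u B)"
        by (simp add: dist_norm scaleR_diff_left sum_subtractf)
      also have "\<dots> \<le> (\<Sum>B\<in>D. \<bar>\<phi> B t - indicator B t\<bar>)"
        using u1 by (intro sum_norm_le) (simp add: mult_left_le)
      finally show ?thesis .
    qed
    then have "norm (vintegral \<mu> f - (\<Sum>B\<in>D. scalar_prod (u B) (\<mu> B))) \<le> e"
      using \<phi>(2) f by simp
    moreover have "scalar_prod (u B) (\<mu> B) = of_real (norm (\<mu> B))" for B
      by (simp only: u_def scalar_prod_sgn)
    then have "norm (\<Sum>B\<in>D. scalar_prod (u B) (\<mu> B)) = (\<Sum>B\<in>D. norm (\<mu> B))"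
      by (simp add: sum_nonneg flip: of_real_sum)
    ultimately show ?thesis
      using C[OF f f1] norm_triangle_ineq3[of "\<Sum>B\<in>D. scalar_prod (u B) (\<mu> B)" "vintegral \<mu> f"]
      by (simp add: norm_minus_commute)
  qed
  then have "(\<Sum>B\<in>D. norm (\<mu> B)) \<le> C" by (rule field_le_epsilon)
  then show "(\<Sum>B\<in>D. ennreal (norm (\<mu> B))) \<le> ennreal C"
    by (simp add: sum_ennreal ennreal_leI)
qed

text \<open>
  Indicators are limits of Lipschitz functions, so the integrals of Lipschitz functions already determine a vector measure. This makes the
  Monge--Kantorovich norm definite.
\<close>

lemma measure_zero_if_Lip_vintegrals_zero:
  fixes \<mu> :: "'t::metric_space set \<Rightarrow> 'k::real_or_complex ^ 'n"
  assumes \<mu>: "\<mu> \<in> cabv" and T: "compact (UNIV :: 't set)"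
    and zero: "\<And>f. f \<in> Lip \<Longrightarrow> vintegral \<mu> f = 0"
  shows "\<mu> B = 0"
proof (cases "B \<in> sets borel")
  case True
  define x where "x = sgn (\<mu> B)"
  have x: "norm x \<le> 1" by (simp add: x_def norm_sgn)
  have "norm (scalar_prod x (\<mu> B)) \<le> 0 + e" if e: "0 < e" for e
  proof -
    have B: "finite {B}" "{B} \<subseteq> sets borel" using True by auto
    obtain \<phi> where \<phi>: "\<forall>A\<in>{B}. (\<exists>L. L-lipschitz_on UNIV (\<phi> A)) \<and> (\<forall>t. 0 \<le> \<phi> A t \<and> \<phi> A t \<le> 1)"
      "\<forall>f u. continuous_on UNIV f \<longrightarrow>
        (\<forall>t. norm (f t - (\<Sum>A\<in>{B}. indicator A t *\<^sub>R u A)) \<le> (\<Sum>A\<in>{B}. \<bar>\<phi> A t - indicator A t\<bar>)) \<longrightarrow>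
        norm (vintegral \<mu> f - (\<Sum>A\<in>{B}. scalar_prod (u A) (\<mu> A))) \<le> e"
      using vintegral_close_to_step_sum[OF \<mu> T B e] by (elim exE conjE) (rule that)
    define f where "f t = \<phi> B t *\<^sub>R x" for t
    obtain L where L: "L-lipschitz_on UNIV (\<phi> B)" using \<phi>(1) by auto
    have "dist (f s) (f t) \<le> L * dist s t" for s t
    proof -
      have "dist (f s) (f t) = dist (\<phi> B s) (\<phi> B t) * norm x"
        by (simp add: f_def dist_norm flip: scaleR_diff_left)
      also have "\<dots> \<le> dist (\<phi> B s) (\<phi> B t)"
        using x by (intro mult_left_le) auto
      also have "\<dots> \<le> L * dist s t" using L by (intro lipschitz_onD) auto
      finally show ?thesis .
    qed
    then have f: "f \<in> Lip" using lipschitz_on_nonneg[OF L] by (auto simp: Lip_iff)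
    have "norm (f t - indicator B t *\<^sub>R x) \<le> \<bar>\<phi> B t - indicator B t\<bar>" for t
      using x unfolding f_def scaleR_diff_left[symmetric] by (simp add: mult_left_le)
    then have "norm (f t - (\<Sum>A\<in>{B}. indicator A t *\<^sub>R x)) \<le> (\<Sum>A\<in>{B}. \<bar>\<phi> A t - indicator A t\<bar>)" for t
      by (simp only: sum.insert finite.emptyI empty_iff not_False_eq_True sum.empty add_0_right)
    then have "norm (vintegral \<mu> f - (\<Sum>A\<in>{B}. scalar_prod x (\<mu> A))) \<le> e"
      by (rule \<phi>(2)[rule_format, of f "\<lambda>_. x", OF Lip_continuous[OF f]])
    then show ?thesis using zero[OF f] by simp
  qed
  then have "norm (scalar_prod x (\<mu> B)) \<le> 0" by (rule field_le_epsilon)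
  then show ?thesis
    by (simp add: x_def scalar_prod_sgn)
qed (use \<mu> in \<open>simp add: cabv_def\<close>)

section \<open>Weak sequential compactness\<close>

text \<open>
  Given a nonnegative additive function \<open>\<rho>\<close> on the binary tree, the interval \<open>[0, \<rho> [])\<close> is cut into nested
  subintervals, one for each word \<open>w\<close>, of length \<open>\<rho> w\<close>; \<open>offset \<rho> w\<close> is the left end point of the
  interval of \<open>w\<close>.
\<close>

primrec offset :: "(bool list \<Rightarrow> real) \<Rightarrow> bool list \<Rightarrow> real" where
  "offset \<rho> [] = 0"
| "offset \<rho> (b # w) = offset \<rho> w + (if b then 0 else \<rho> (True # w))"

text \<open>
  The word of length \<open>m\<close> whose interval contains \<open>x\<close>.
\<close>

primrec path_word :: "(bool list \<Rightarrow> real) \<Rightarrow> nat \<Rightarrow> real \<Rightarrow> bool list" where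
  "path_word \<rho> 0 x = []"
| "path_word \<rho> (Suc m) x =
    (x < offset \<rho> (path_word \<rho> m x) + \<rho> (True # path_word \<rho> m x)) # path_word \<rho> m x"

lemma length_path_word [simp]: "length (path_word \<rho> m x) = m"
  by (induction m) auto

lemma path_word_interval:
  assumes nonneg: "\<And>w. 0 \<le> \<rho> w" and split: "\<And>w. \<rho> w = \<rho> (True # w) + \<rho> (False # w)"
  shows "0 \<le> x \<and> x < \<rho> [] \<and> path_word \<rho> (length w) x = w \<longleftrightarrow>
    offset \<rho> w \<le> x \<and> x < offset \<rho> w + \<rho> w"
proof (induction w)
  case (Cons b w)
  have "0 \<le> x \<and> x < \<rho> [] \<and> path_word \<rho> (length (b # w)) x = b # w \<longleftrightarrow>
      (offset \<rho> w \<le> x \<and> x < offset \<rho> w + \<rho> w) \<and> (x < offset \<rho> w + \<rho> (True # w)) = b"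
    unfolding Cons.IH[symmetric] by auto
  also have "\<dots> \<longleftrightarrow> offset \<rho> (b # w) \<le> x \<and> x < offset \<rho> (b # w) + \<rho> (b # w)"
    using nonneg[of "True # w"] nonneg[of "False # w"] split[of w] by (cases b) auto
  finally show ?case .
qed simp

lemma word_prefix_eq:
  assumes "k \<le> m" "word B m p = path_word \<rho> m x"
  shows "word B k p = path_word \<rho> k x"
  using assms by (induction m) (auto simp: le_Suc_eq)

text \<open>
  A mass distribution on the cells need not come from a measure on the space with exactly these masses, since in the limit mass may leave a cell
  through its boundary; but it always determines a measure by its integrals. The measure is the image of Lebesgue measure on \<open>[0, \<rho>
  [])\<close> under the map that sends \<open>x\<close> to the limit of the shrinking cells addressed by the words of \<open>x\<close>. Countable
  additivity comes for free from Lebesgue measure.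
\<close>

lemma tree_measure_exists:
  fixes \<rho> :: "bool list \<Rightarrow> real" and B :: "nat \<Rightarrow> 't::metric_space set"
  assumes T: "compact (UNIV :: 't set)" and B: "fine_seq B"
    and nonneg: "\<And>w. 0 \<le> \<rho> w" and split: "\<And>w. \<rho> w = \<rho> (True # w) + \<rho> (False # w)"
    and empty: "\<And>w. cell B w = {} \<Longrightarrow> \<rho> w = 0"
  shows "\<exists>N. finite_measure N \<and> sets N = sets borel \<and>
    (\<forall>f :: 't \<Rightarrow> 'k::{banach, second_countable_topology}. continuous_on UNIV f \<longrightarrow>
      (\<lambda>m. \<Sum>w | length w = m. \<rho> w *\<^sub>R f (cell_point B w)) \<longlonglongrightarrow> (\<integral>t. f t \<partial>N))"
proof -
  define I where "I = {0..<\<rho> []}"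
  define J where "J w = {offset \<rho> w..<offset \<rho> w + \<rho> w}" for w
  define M where "M = restrict_space lborel I"
  have J: "x \<in> J w \<longleftrightarrow> x \<in> I \<and> path_word \<rho> (length w) x = w" for x w
    using path_word_interval[OF nonneg split, of x w] by (auto simp: I_def J_def)
  have spM: "space M = I" by (simp add: M_def space_restrict_space)
  have sub: "J w \<subseteq> I" for w using J by blast
  have meas: "I \<in> sets borel" "J w \<in> sets borel" for w by (simp_all add: I_def J_def)
  have setsM: "J w \<in> sets M" for w
    unfolding M_def by (subst sets_restrict_space_iff) (simp_all add: sub meas)
  have emJ: "emeasure M (J w) = ennreal (\<rho> w)" for w
  proof -
    have "emeasure M (J w) = emeasure lborel (J w)"
      unfolding M_def by (rule emeasure_restrict_space) (simp_all add: sub meas)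
    then show ?thesis using nonneg by (simp add: J_def)
  qed
  have "I = J []" by (auto simp: I_def J_def)
  then interpret M: finite_measure M
    by (intro finite_measureI) (simp add: spM emJ)
  \<comment> \<open>The approximations of the map from the interval to the space: a representative of the cell addressed by \<open>x\<close>.\<close>
  define g where "g m x = cell_point B (path_word \<rho> m x)" for m x
  \<comment> \<open>A word with a nonempty interval has positive mass, so its cell is nonempty and the representative really lies in it. Hence
  \<open>g m x\<close> and \<open>g n x\<close> share the first \<open>k\<close> digits for \<open>m, n \<ge> k\<close>.\<close>
  have g_word: "word B k (g m x) = path_word \<rho> k x" if "x \<in> I" "k \<le> m" for k m x
  proof -
    have "x \<in> J (path_word \<rho> m x)" using that(1) by (simp add: J)
    then have "\<rho> (path_word \<rho> m x) \<noteq> 0" by (auto simp: J_def)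
    then obtain t where "t \<in> cell B (path_word \<rho> m x)" using empty by blast
    then have "g m x \<in> cell B (path_word \<rho> m x)"
      unfolding g_def by (rule cell_point_in)
    then have "word B m (g m x) = path_word \<rho> m x" by (simp add: cell_def)
    then show ?thesis by (rule word_prefix_eq[OF that(2)])
  qed
  have "convergent (\<lambda>m. g m x)" if x: "x \<in> I" for x
  proof -
    have "Cauchy (\<lambda>m. g m x)"
    proof (rule metric_CauchyI)
      fix e :: real assume "0 < e"
      then obtain k where k: "\<forall>m\<ge>k. \<forall>s t. word B m s = word B m t \<longrightarrow> dist s t < e"
        using B unfolding fine_seq_def by blast
      have "dist (g m x) (g n x) < e" if "m \<ge> k" "n \<ge> k" for m n
        using k[rule_format, of k "g m x" "g n x"] g_word[OF x that(1)] g_word[OF x that(2)] by simp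
      then show "\<exists>k. \<forall>m\<ge>k. \<forall>n\<ge>k. dist (g m x) (g n x) < e" by blast
    qed
    then show ?thesis
      using compact_imp_complete[OF T] unfolding complete_def convergent_def by blast
  qed
  then have g_lim: "(\<lambda>m. g m x) \<longlonglongrightarrow> lim (\<lambda>m. g m x)" if "x \<in> I" for x
    using that convergent_LIMSEQ_iff by blast
  define \<pi> where "\<pi> x = lim (\<lambda>m. g m x)" for x
  have g_meas: "g m \<in> borel_measurable M" for m
  proof (rule borel_measurable_simple_function)
    have "g m ` I \<subseteq> cell_point B ` {w. length w = m}" by (auto simp: g_def)
    then have "finite (g m ` I)" using finite_words[of m] by (rule finite_surj[rotated])
    moreover have "g m -` {t} \<inter> I \<in> sets M" for t
    proof -
      have "g m -` {t} \<inter> I = (\<Union>w\<in>{w. length w = m \<and> cell_point B w = t}. J w)"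
        by (auto simp: g_def J)
      also have "\<dots> \<in> sets M"
        by (intro sets.finite_UN setsM finite_subset[OF _ finite_words[of m]]) auto
      finally show ?thesis .
    qed
    ultimately show "simple_function M (g m)" by (simp add: simple_function_def spM)
  qed
  have \<pi>_meas: "\<pi> \<in> borel_measurable M"
    by (rule borel_measurable_LIMSEQ_metric[where f = g, OF g_meas]) (simp add: spM \<pi>_def g_lim)
  define N where "N = distr M borel \<pi>"
  have conv: "(\<lambda>m. \<Sum>w | length w = m. \<rho> w *\<^sub>R f (cell_point B w)) \<longlonglongrightarrow> (\<integral>t. f t \<partial>N)"
    if f: "continuous_on UNIV f" for f :: "'t \<Rightarrow> 'k"
  proof -
    have fm: "f \<in> borel_measurable borel" by (rule borel_measurable_continuous_onI[OF f])
    have "bounded (range f)"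
      by (rule compact_imp_bounded[OF compact_continuous_image[OF f T]])
    then obtain C where C: "\<And>t. norm (f t) \<le> C" by (auto simp: bounded_iff)
    have sum_eq: "(\<integral>x. f (g m x) \<partial>M) = (\<Sum>w | length w = m. \<rho> w *\<^sub>R f (cell_point B w))" for m
    proof -
      have "has_bochner_integral M (\<lambda>x. \<Sum>w | length w = m. indicator (J w) x *\<^sub>R f (cell_point B w))
          (\<Sum>w | length w = m. measure M (J w) *\<^sub>R f (cell_point B w))"
        using setsM by (intro has_bochner_integral_sum has_bochner_integral_scaleR_left
            has_bochner_integral_real_indicator) (auto simp: less_top[symmetric])
      moreover have "f (g m x) = (\<Sum>w | length w = m. indicator (J w) x *\<^sub>R f (cell_point B w))"
        if "x \<in> I" for x
      proof -
        have "(\<Sum>w | length w = m. indicator (J w) x *\<^sub>R f (cell_point B w))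
            = (\<Sum>w | length w = m. if w = path_word \<rho> m x then f (cell_point B w) else 0)"
          using that by (intro sum.cong) (auto simp: J indicator_def)
        then show ?thesis using finite_words[of m] by (simp add: g_def)
      qed
      ultimately have "has_bochner_integral M (\<lambda>x. f (g m x))
          (\<Sum>w | length w = m. measure M (J w) *\<^sub>R f (cell_point B w))"
        by (subst has_bochner_integral_cong[OF refl _ refl]) (auto simp: spM)
      then show ?thesis
        using nonneg by (simp add: has_bochner_integral_integral_eq measure_def emJ)
    qed
    have "(\<lambda>m. \<integral>x. f (g m x) \<partial>M) \<longlonglongrightarrow> (\<integral>x. f (\<pi> x) \<partial>M)"
    proof (rule integral_dominated_convergence[where w = "\<lambda>_. C"])
      show "(\<lambda>x. f (\<pi> x)) \<in> borel_measurable M" by (rule measurable_compose[OF \<pi>_meas fm])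
      show "(\<lambda>x. f (g m x)) \<in> borel_measurable M" for m by (rule measurable_compose[OF g_meas fm])
      have "(\<lambda>m. f (g m x)) \<longlonglongrightarrow> f (\<pi> x)" if "x \<in> I" for x
        unfolding \<pi>_def by (rule continuous_on_tendsto_compose[OF f g_lim[OF that]]) auto
      then show "AE x in M. (\<lambda>m. f (g m x)) \<longlonglongrightarrow> f (\<pi> x)" by (intro AE_I2) (simp add: spM)
      show "AE x in M. norm (f (g m x)) \<le> C" for m using C by simp
    qed simp
    moreover have "(\<integral>t. f t \<partial>N) = (\<integral>x. f (\<pi> x) \<partial>M)"
      unfolding N_def by (rule integral_distr[OF \<pi>_meas fm])
    ultimately show ?thesis by (simp add: sum_eq)
  qed
  have "finite_measure N" unfolding N_def by (rule M.finite_measure_distr[OF \<pi>_meas])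
  moreover have "sets N = sets borel" by (simp add: N_def)
  ultimately show ?thesis using conv by blast
qed

text \<open>
  By compactness of a product of intervals the masses of all cells converge along a common subsequence. The limit masses are additive on the tree and
  define a measure; integrals of continuous functions converge to its integrals because each of them is approximated by sums over cells uniformly
  along the sequence. The index \<open>i\<close> allows a single subsequence to serve all the parts of a decomposition of vector measures.
\<close>

lemma finite_measures_weakly_seq_compact:
  fixes N :: "nat \<Rightarrow> 'i::countable \<Rightarrow> 't::metric_space measure"
  assumes T: "compact (UNIV :: 't set)"
    and N: "\<And>k i. finite_measure (N k i)" "\<And>k i. sets (N k i) = sets borel"
    and C: "\<And>k i. measure (N k i) UNIV \<le> C"
  shows "\<exists>r L. strict_mono (r :: nat \<Rightarrow> nat) \<and> (\<forall>i :: 'i. finite_measure (L i) \<and> sets (L i) = sets borel \<and>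
    (\<forall>f :: 't \<Rightarrow> 'k::{banach, second_countable_topology}. continuous_on UNIV f \<longrightarrow>
      (\<lambda>j. \<integral>t. f t \<partial>N (r j) i) \<longlonglongrightarrow> (\<integral>t. f t \<partial>L i)))"
proof -
  obtain B :: "nat \<Rightarrow> 't set" where B: "fine_seq B" using fine_seq_exists[OF T] by blast
  then have Bb: "range B \<subseteq> sets borel" by (simp add: fine_seq_def)
  have cellN: "cell B w \<in> sets (N k i)" for w k i using cell_borel[OF Bb] N(2) by simp
  have spN: "space (N k i) = UNIV" for k i using sets_eq_imp_space_eq[OF N(2)] by simp
  define x where "x k = (\<lambda>(i, w). measure (N k i) (cell B w))" for k
  have "compact (PiE UNIV (\<lambda>_. {0..C}) :: ('i \<times> bool list \<Rightarrow> real) set)"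
  proof -
    have "compactin (product_topology (\<lambda>_. euclidean) UNIV) (PiE UNIV (\<lambda>_. {0..C}) :: ('i \<times> bool list \<Rightarrow> real) set)"
      unfolding compactin_PiE by auto
    then show ?thesis by (simp add: euclidean_product_topology)
  qed
  moreover have "x k \<in> PiE UNIV (\<lambda>_. {0..C})" for k
  proof -
    have "measure (N k i) (cell B w) \<le> C" for i w
      using finite_measure.bounded_measure[OF N(1), of k i "cell B w"] C[of k i] spN by simp
    then show ?thesis by (auto simp: x_def)
  qed
  ultimately obtain l r where r: "strict_mono (r :: nat \<Rightarrow> nat)" and l: "(x \<circ> r) \<longlonglongrightarrow> l"
    unfolding compact_eq_seq_compact_metric by (metis seq_compactE)
  define \<rho> where "\<rho> i w = l (i, w)" for i w
  have \<rho>: "(\<lambda>j. measure (N (r j) i) (cell B w)) \<longlonglongrightarrow> \<rho> i w" for i w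
  proof -
    have "(\<lambda>j. (x \<circ> r) j (i, w)) \<longlonglongrightarrow> l (i, w)"
      by (rule continuous_on_tendsto_compose[OF continuous_on_product_coordinates l]) auto
    then show ?thesis by (simp add: x_def \<rho>_def)
  qed
  have "\<exists>L. finite_measure L \<and> sets L = sets borel \<and>
    (\<forall>f :: 't \<Rightarrow> 'k. continuous_on UNIV f \<longrightarrow>
      (\<lambda>m. \<Sum>w | length w = m. \<rho> i w *\<^sub>R f (cell_point B w)) \<longlonglongrightarrow> (\<integral>t. f t \<partial>L))" for i
  proof (rule tree_measure_exists[OF T B])
    show "0 \<le> \<rho> i w" for w by (rule LIMSEQ_le_const[OF \<rho>]) auto
    show "\<rho> i w = 0" if "cell B w = {}" for w
      using \<rho>[of i w] that by (simp add: LIMSEQ_const_iff)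
    show "\<rho> i w = \<rho> i (True # w) + \<rho> i (False # w)" for w
    proof (rule LIMSEQ_unique[OF \<rho>])
      have "measure (N k i) (cell B w) = measure (N k i) (cell B (True # w)) + measure (N k i) (cell B (False # w))" for k
      proof -
        have "cell B w = cell B (True # w) \<union> cell B (False # w)"
          "cell B (True # w) \<inter> cell B (False # w) = {}" by (auto simp: cell_Cons)
        then show ?thesis
          using finite_measure.finite_measure_Union[OF N(1) cellN cellN, of "True # w" "False # w"] by simp
      qed
      then show "(\<lambda>j. measure (N (r j) i) (cell B w)) \<longlonglongrightarrow> \<rho> i (True # w) + \<rho> i (False # w)"
        by (simp only: tendsto_add[OF \<rho> \<rho>])
    qed
  qed
  then have "\<exists>L. \<forall>i. finite_measure (L i) \<and> sets (L i) = sets borel \<and>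
    (\<forall>f :: 't \<Rightarrow> 'k. continuous_on UNIV f \<longrightarrow>
      (\<lambda>m. \<Sum>w | length w = m. \<rho> i w *\<^sub>R f (cell_point B w)) \<longlonglongrightarrow> (\<integral>t. f t \<partial>L i))"
    by (intro choice allI)
  then obtain L where L_all: "\<forall>i. finite_measure (L i) \<and> sets (L i) = sets borel \<and>
    (\<forall>f :: 't \<Rightarrow> 'k. continuous_on UNIV f \<longrightarrow>
      (\<lambda>m. \<Sum>w | length w = m. \<rho> i w *\<^sub>R f (cell_point B w)) \<longlonglongrightarrow> (\<integral>t. f t \<partial>L i))"
    by (elim exE) (rule that)
  have L: "\<And>i. finite_measure (L i)" "\<And>i. sets (L i) = sets borel"
    "\<And>i (f :: 't \<Rightarrow> 'k). continuous_on UNIV f \<Longrightarrow>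
      (\<lambda>m. \<Sum>w | length w = m. \<rho> i w *\<^sub>R f (cell_point B w)) \<longlonglongrightarrow> (\<integral>t. f t \<partial>L i)"
    using L_all by simp_all
  have conv: "(\<lambda>j. \<integral>t. f t \<partial>N (r j) i) \<longlonglongrightarrow> (\<integral>t. f t \<partial>L i)"
    if f: "continuous_on UNIV f" for f :: "'t \<Rightarrow> 'k" and i
  proof (rule metric_LIMSEQ_I)
    fix e :: real assume e: "0 < e"
    have "0 \<le> C" using C[of 0 i] measure_nonneg[of "N 0 i" UNIV] by linarith
    \<comment> \<open>Three errors below \<open>e / 3\<close>: step function against \<open>f\<close> (at most \<open>C * \<delta>\<close> for all
    measures of the sequence), convergence of the finitely many cell masses, and the defining limit of \<open>L i\<close>.\<close>
    define \<delta> where "\<delta> = e / (3 * (C + 1))"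
    have \<delta>: "0 < \<delta>" "C * \<delta> < e / 3"
      using e \<open>0 \<le> C\<close> by (simp_all add: \<delta>_def field_simps)
    let ?S = "\<lambda>m \<rho>. \<Sum>w | length w = m. \<rho> w *\<^sub>R f (cell_point B w)"
    have "\<forall>\<^sub>F m in sequentially. \<forall>t\<in>UNIV. dist (f (cell_point B (word B m t))) (f t) < \<delta>"
      by (rule uniform_limitD[OF uniform_limit_cell_point[OF T B f] \<delta>(1)])
    moreover have "\<forall>\<^sub>F m in sequentially. dist (?S m (\<rho> i)) (\<integral>t. f t \<partial>L i) < e / 3"
      using e by (intro tendstoD[OF L(3)[OF f]]) simp
    ultimately have "\<forall>\<^sub>F m in sequentially. (\<forall>t. dist (f (cell_point B (word B m t))) (f t) < \<delta>) \<and>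
        dist (?S m (\<rho> i)) (\<integral>t. f t \<partial>L i) < e / 3"
      by eventually_elim auto
    then obtain m where m: "\<And>t. dist (f (cell_point B (word B m t))) (f t) < \<delta>"
        "dist (?S m (\<rho> i)) (\<integral>t. f t \<partial>L i) < e / 3"
      by (auto simp: eventually_sequentially)
    have "(\<lambda>j. ?S m (\<lambda>w. measure (N (r j) i) (cell B w))) \<longlonglongrightarrow> ?S m (\<rho> i)"
      by (intro tendsto_intros \<rho>)
    then have "\<forall>\<^sub>F j in sequentially. dist (?S m (\<lambda>w. measure (N (r j) i) (cell B w))) (?S m (\<rho> i)) < e / 3"
      using e by (intro tendstoD) auto
    then obtain j0 where j0: "\<And>j. j \<ge> j0 \<Longrightarrow>
        dist (?S m (\<lambda>w. measure (N (r j) i) (cell B w))) (?S m (\<rho> i)) < e / 3"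
      by (auto simp: eventually_sequentially)
    have near: "dist (\<integral>t. f t \<partial>N k i) (?S m (\<lambda>w. measure (N k i) (cell B w))) < e / 3" for k
    proof -
      interpret N: finite_measure "N k i" by (rule N(1))
      have fm: "f \<in> borel_measurable (N k i)"
        using borel_measurable_continuous_onI[OF f] measurable_cong_sets[OF N(2) refl] by blast
      have "bounded (range f)"
        by (rule compact_imp_bounded[OF compact_continuous_image[OF f T]])
      then obtain D where D: "\<And>t. norm (f t) \<le> D" by (auto simp: bounded_iff)
      have int_f: "integrable (N k i) f"
        using D fm by (intro N.integrable_const_bound[of _ D]) auto
      have "has_bochner_integral (N k i) (\<lambda>t. \<Sum>w | length w = m. indicator (cell B w) t *\<^sub>R f (cell_point B w))
          (?S m (\<lambda>w. measure (N k i) (cell B w)))"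
        using cellN by (intro has_bochner_integral_sum has_bochner_integral_scaleR_left
            has_bochner_integral_real_indicator) (auto simp: less_top[symmetric])
      moreover have "(\<Sum>w | length w = m. indicator (cell B w) t *\<^sub>R f (cell_point B w))
          = f (cell_point B (word B m t))" for t
      proof -
        have "(\<Sum>w | length w = m. indicator (cell B w) t *\<^sub>R f (cell_point B w))
            = (\<Sum>w | length w = m. if w = word B m t then f (cell_point B w) else 0)"
          by (intro sum.cong) (auto simp: cell_def indicator_def)
        then show ?thesis using finite_words[of m] by simp
      qed
      ultimately have S: "has_bochner_integral (N k i) (\<lambda>t. f (cell_point B (word B m t)))
          (?S m (\<lambda>w. measure (N k i) (cell B w)))" by simp
      have "dist (\<integral>t. f t \<partial>N k i) (?S m (\<lambda>w. measure (N k i) (cell B w)))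
          = norm (\<integral>t. f t - f (cell_point B (word B m t)) \<partial>N k i)"
        using int_f S by (simp add: dist_norm Bochner_Integration.integral_diff has_bochner_integral_iff)
      also have "\<dots> \<le> (\<integral>t. \<delta> \<partial>N k i)"
      proof (rule order_trans[OF integral_norm_bound integral_mono])
        show "integrable (N k i) (\<lambda>t. norm (f t - f (cell_point B (word B m t))))"
          using int_f S by (intro integrable_norm Bochner_Integration.integrable_diff) (auto simp: has_bochner_integral_iff)
        show "norm (f t - f (cell_point B (word B m t))) \<le> \<delta>" for t
          using m(1)[of t] by (simp add: dist_norm norm_minus_commute less_imp_le)
      qed simp
      also have "\<dots> = measure (N k i) UNIV * \<delta>" by (simp add: spN)
      also have "\<dots> \<le> C * \<delta>" using C[of k i] \<delta>(1) by (intro mult_right_mono) auto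
      finally show ?thesis using \<delta>(2) by simp
    qed
    have "dist (\<integral>t. f t \<partial>N (r j) i) (\<integral>t. f t \<partial>L i) < e" if "j \<ge> j0" for j
      using near[of "r j"] j0[OF that] m(2)
        dist_triangle_third[of "\<integral>t. f t \<partial>N (r j) i" "?S m (\<lambda>w. measure (N (r j) i) (cell B w))" e
          "?S m (\<rho> i)" "\<integral>t. f t \<partial>L i"] by simp
    then show "\<exists>j0. \<forall>j\<ge>j0. dist (\<integral>t. f t \<partial>N (r j) i) (\<integral>t. f t \<partial>L i) < e" by blast
  qed
  show ?thesis
    by (intro exI[of _ r] exI[of _ L] conjI allI impI) (simp_all add: r L conv)
qed

text \<open>
  Bounded sequences of vector measures have weak* convergent subsequences: decompose into positive measures of bounded mass and apply the previous
  lemma to all of them simultaneously.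
\<close>

lemma cabv_ball_weakly_seq_compact:
  fixes \<mu> :: "nat \<Rightarrow> 't::metric_space set \<Rightarrow> 'k::real_or_complex ^ 'n"
  assumes T: "compact (UNIV :: 't set)" and \<mu>: "\<And>k. \<mu> k \<in> cabv_ball a"
  shows "\<exists>r \<nu>. strict_mono (r :: nat \<Rightarrow> nat) \<and> \<nu> \<in> cabv \<and>
    (\<forall>f. continuous_on UNIV f \<longrightarrow> (\<lambda>j. vintegral (\<mu> (r j)) f) \<longlonglongrightarrow> vintegral \<nu> f)"
proof -
  let ?Basis = "Basis :: ('k ^ 'n) set"
  have "\<exists>PQ. jordan_rep (\<mu> k) (fst PQ) (snd PQ) \<and>
      (\<forall>b\<in>Basis. measure (fst PQ b) UNIV \<le> 2 * max a 0 \<and> measure (snd PQ b) UNIV \<le> 2 * max a 0)" for k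
  proof -
    have "variation (\<mu> k) \<le> ennreal (max a 0)" and c: "\<mu> k \<in> cabv"
      using \<mu>[of k] by (auto simp: cabv_ball_def max_def ennreal_neg)
    then have v: "enn2real (variation (\<mu> k)) \<le> max a 0" by (intro enn2real_leI) auto
    show ?thesis
    proof (rule jordan_rep_exists[OF c])
      fix P Q assume *: "jordan_rep (\<mu> k) P Q"
        "\<And>b. b \<in> Basis \<Longrightarrow> measure (P b) UNIV \<le> 2 * enn2real (variation (\<mu> k))"
        "\<And>b. b \<in> Basis \<Longrightarrow> measure (Q b) UNIV \<le> 2 * enn2real (variation (\<mu> k))"
      show ?thesis
        using * v by (intro exI[of _ "(P, Q)"]) force
    qed
  qed
  then have "\<exists>PQ. \<forall>k. jordan_rep (\<mu> k) (fst (PQ k)) (snd (PQ k)) \<and>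
      (\<forall>b\<in>Basis. measure (fst (PQ k) b) UNIV \<le> 2 * max a 0 \<and> measure (snd (PQ k) b) UNIV \<le> 2 * max a 0)"
    by (intro choice allI)
  then obtain PQ where PQ: "\<And>k. jordan_rep (\<mu> k) (fst (PQ k)) (snd (PQ k))"
      "\<And>k b. b \<in> Basis \<Longrightarrow> measure (fst (PQ k) b) UNIV \<le> 2 * max a 0"
      "\<And>k b. b \<in> Basis \<Longrightarrow> measure (snd (PQ k) b) UNIV \<le> 2 * max a 0"
    by blast
  let ?e = "from_nat_into ?Basis" and ?n = "to_nat_on ?Basis"
  have eB: "?e n \<in> Basis" for n by (rule from_nat_into) simp
  have en: "?e (?n b) = b" if "b \<in> Basis" for b
    using that by (intro from_nat_into_to_nat_on countable_finite) auto
  \<comment> \<open>All positive and negative parts, indexed by a countable type.\<close>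
  define N where "N k = (\<lambda>(s, n). if s then fst (PQ k) (?e n) else snd (PQ k) (?e n))" for k
  have N: "finite_measure (N k i)" "sets (N k i) = sets borel" "measure (N k i) UNIV \<le> 2 * max a 0" for k i
    using PQ(1)[of k] PQ(2,3)[OF eB, of k] eB by (cases i, simp add: N_def jordan_rep_def)+
  obtain r L where r: "strict_mono (r :: nat \<Rightarrow> nat)" and L: "\<forall>i. finite_measure (L i) \<and> sets (L i) = sets borel \<and>
      (\<forall>f :: 't \<Rightarrow> 'k. continuous_on UNIV f \<longrightarrow> (\<lambda>j. \<integral>t. f t \<partial>N (r j) i) \<longlonglongrightarrow> (\<integral>t. f t \<partial>L i))"
    using finite_measures_weakly_seq_compact[where N = N, OF T N] by (elim exE conjE) (rule that)
  define P Q where "P b = L (True, ?n b)" and "Q b = L (False, ?n b)" for b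
  define \<nu> where "\<nu> B = (if B \<in> sets borel
      then \<Sum>b\<in>Basis. (measure (P b) B - measure (Q b) B) *\<^sub>R b else 0)" for B
  have rep: "jordan_rep \<nu> P Q"
    using L by (simp add: jordan_rep_def P_def Q_def \<nu>_def)
  then have \<nu>: "\<nu> \<in> cabv" by (rule jordan_rep_cabv) (simp add: \<nu>_def)
  have conv: "(\<lambda>j. vintegral (\<mu> (r j)) f) \<longlonglongrightarrow> vintegral \<nu> f" if f: "continuous_on UNIV f" for f
    unfolding vintegral_rep[OF rep T f] vintegral_rep[OF PQ(1) T f] rep_integral_def
  proof (intro tendsto_sum tendsto_diff)
    fix b assume b: "b \<in> ?Basis"
    have "continuous_on UNIV (\<lambda>t. scalar_prod (f t) b)"
      by (intro scalar_prod.continuous_on f continuous_on_const)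
    then have lim: "(\<lambda>j. \<integral>t. scalar_prod (f t) b \<partial>N (r j) i) \<longlonglongrightarrow> (\<integral>t. scalar_prod (f t) b \<partial>L i)" for i
      using spec[OF L, of i] by blast
    show "(\<lambda>j. \<integral>t. scalar_prod (f t) b \<partial>fst (PQ (r j)) b) \<longlonglongrightarrow> (\<integral>t. scalar_prod (f t) b \<partial>P b)"
      using lim[of "(True, ?n b)"] by (simp add: N_def P_def en[OF b])
    show "(\<lambda>j. \<integral>t. scalar_prod (f t) b \<partial>snd (PQ (r j)) b) \<longlonglongrightarrow> (\<integral>t. scalar_prod (f t) b \<partial>Q b)"
      using lim[of "(False, ?n b)"] by (simp add: N_def Q_def en[OF b])
  qed
  show ?thesis
    by (intro exI[of _ r] exI[of _ \<nu>] conjI allI impI r \<nu> conv)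
qed

section \<open>The operator on vector measures\<close>

text \<open>
  Covers composition with an operator and taking the image under a map at once: \<open>g\<close> is the preimage map on sets, which carries partitions
  to disjoint families.
\<close>

lemma variation_le_scaled:
  fixes \<mu> :: "'t::topological_space set \<Rightarrow> 'x::real_normed_vector" and \<nu> :: "'t set \<Rightarrow> 'y::real_normed_vector"
  assumes \<mu>: "\<mu> \<in> cabv" and K: "0 \<le> K"
    and g: "\<And>B. B \<in> sets borel \<Longrightarrow> g B \<in> sets borel"
    and disj: "\<And>A B. A \<inter> B = {} \<Longrightarrow> g A \<inter> g B = {}"
    and le: "\<And>B. B \<in> sets borel \<Longrightarrow> norm (\<nu> B) \<le> K * norm (\<mu> (g B))"
  shows "variation \<nu> \<le> ennreal K * variation \<mu>"
  unfolding variation_def[of \<nu>]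
proof (rule SUP_least, safe)
  fix D :: "'t set set"
  assume D: "finite D" "D \<subseteq> sets borel" "partition_on UNIV D"
  have "(\<Sum>B\<in>D. norm (\<nu> B)) \<le> K * (\<Sum>B\<in>D. norm (\<mu> (g B)))"
    unfolding sum_distrib_left using D(2) by (intro sum_mono le) auto
  also have "\<dots> \<le> K * enn2real (variation \<mu>)"
  proof (intro mult_left_mono sum_norm_le_variation[OF \<mu>] D(1) K)
    show "g B \<in> sets borel" if "B \<in> D" for B using g D(2) that by auto
    show "disjoint_family_on g D"
      using D(3) disj by (auto simp: partition_on_def disjoint_def disjoint_family_on_def)
  qed
  finally have "(\<Sum>B\<in>D. ennreal (norm (\<nu> B))) \<le> ennreal (K * enn2real (variation \<mu>))"
    by (simp add: ennreal_leI)
  also have "\<dots> = ennreal K * variation \<mu>"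
    using \<mu> K by (simp add: ennreal_mult cabv_def)
  finally show "(\<Sum>B\<in>D. ennreal (norm (\<nu> B))) \<le> ennreal K * variation \<mu>" .
qed

lemma variation_sum_le:
  fixes \<mu> :: "'i \<Rightarrow> 't::topological_space set \<Rightarrow> 'x::real_normed_vector"
  assumes I: "finite I" 
  shows "variation (\<lambda>B. \<Sum>i\<in>I. \<mu> i B) \<le> (\<Sum>i\<in>I. variation (\<mu> i))"
  unfolding variation_def[of "\<lambda>B. \<Sum>i\<in>I. \<mu> i B"]
proof (rule SUP_least)
  fix D :: "'t set set"
  assume D: "D \<in> {P. finite P \<and> P \<subseteq> sets borel \<and> partition_on UNIV P}"
  have "(\<Sum>B\<in>D. ennreal (norm (\<Sum>i\<in>I. \<mu> i B))) \<le> (\<Sum>B\<in>D. \<Sum>i\<in>I. ennreal (norm (\<mu> i B)))"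
    by (intro sum_mono) (simp add: ennreal_leI norm_sum)
  also have "\<dots> = (\<Sum>i\<in>I. \<Sum>B\<in>D. ennreal (norm (\<mu> i B)))" by (rule sum.swap)
  also have "\<dots> \<le> (\<Sum>i\<in>I. variation (\<mu> i))"
    unfolding variation_def by (intro sum_mono SUP_upper[OF D])
  finally show "(\<Sum>B\<in>D. ennreal (norm (\<Sum>i\<in>I. \<mu> i B))) \<le> (\<Sum>i\<in>I. variation (\<mu> i))" .
qed

lemma cabv_sum:
  fixes \<mu> :: "'i \<Rightarrow> 't::topological_space set \<Rightarrow> 'x::real_normed_vector"
  assumes I: "finite I" and \<mu>: "\<And>i. i \<in> I \<Longrightarrow> \<mu> i \<in> cabv"
  shows "(\<lambda>B. \<Sum>i\<in>I. \<mu> i B) \<in> cabv"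
proof -
  have "variation (\<lambda>B. \<Sum>i\<in>I. \<mu> i B) < \<infinity>"
  proof (rule le_less_trans[OF variation_sum_le[OF I]])
    show "(\<Sum>i\<in>I. variation (\<mu> i)) < \<infinity>"
      using I \<mu> by (auto simp: cabv_def)
  qed
  moreover have "(\<lambda>k. \<Sum>i\<in>I. \<mu> i (A k)) sums (\<Sum>i\<in>I. \<mu> i (\<Union>k. A k))"
    if "range A \<subseteq> sets borel" "disjoint_family A" for A :: "nat \<Rightarrow> 't set"
    using \<mu> that by (intro sums_sum cabv_sums) auto
  moreover have "(\<Sum>i\<in>I. \<mu> i A) = 0" if "A \<notin> sets borel" for A
    using \<mu> that by (intro sum.neutral) (auto simp: cabv_def)
  ultimately show ?thesis by (simp add: cabv_def)
qed

lemma variation_image_le: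
  fixes \<mu> :: "'t::topological_space set \<Rightarrow> 'x::real_normed_vector" and R :: "'x \<Rightarrow> 'y::real_normed_vector"
  assumes \<mu>: "\<mu> \<in> cabv" and h: "h \<in> borel_measurable borel" and R: "bounded_linear R"
  shows "variation (\<lambda>B. R (image_measure h \<mu> B)) \<le> ennreal (onorm R) * variation \<mu>"
proof (rule variation_le_scaled[OF \<mu>, where g = "\<lambda>B. h -` B"])
  show "0 \<le> onorm R" by (rule onorm_pos_le[OF R])
  show "h -` B \<in> sets borel" if "B \<in> sets borel" for B
    using measurable_sets[OF h that] by simp
  show "norm (R (image_measure h \<mu> B)) \<le> onorm R * norm (\<mu> (h -` B))" if "B \<in> sets borel" for B
    using that onorm[OF R] by (simp add: image_measure_def)
qed auto

lemma cabv_image: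
  fixes \<mu> :: "'t::topological_space set \<Rightarrow> 'x::real_normed_vector" and R :: "'x \<Rightarrow> 'y::real_normed_vector"
  assumes \<mu>: "\<mu> \<in> cabv" and h: "h \<in> borel_measurable borel" and R: "bounded_linear R"
  shows "(\<lambda>B. R (image_measure h \<mu> B)) \<in> cabv"
proof -
  have meas: "h -` B \<in> sets borel" if "B \<in> sets borel" for B
    using measurable_sets[OF h that] by simp
  have "variation \<mu> < \<infinity>" using \<mu> by (simp add: cabv_def)
  then have "ennreal (onorm R) * variation \<mu> < \<infinity>"
    by (simp add: ennreal_mult_less_top)
  then have "variation (\<lambda>B. R (image_measure h \<mu> B)) < \<infinity>"
    by (rule le_less_trans[OF variation_image_le[OF assms]])
  moreover have "(\<lambda>k. R (image_measure h \<mu> (A k))) sums R (image_measure h \<mu> (\<Union>k. A k))"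
    if A: "range A \<subseteq> sets borel" "disjoint_family A" for A :: "nat \<Rightarrow> 't set"
  proof -
    have "(\<lambda>k. \<mu> (h -` A k)) sums \<mu> (\<Union>k. h -` A k)"
      using A meas by (intro cabv_sums[OF \<mu>]) (auto simp: disjoint_family_on_def)
    then have "(\<lambda>k. R (\<mu> (h -` A k))) sums R (\<mu> (\<Union>k. h -` A k))"
      by (rule bounded_linear.sums[OF R])
    moreover have "A k \<in> sets borel" for k using A(1) by auto
    ultimately show ?thesis by (simp add: image_measure_def vimage_Union)
  qed
  moreover have "R (image_measure h \<mu> A) = 0" if "A \<notin> sets borel" for A
    using that linear_0[OF bounded_linear.linear[OF R]] by (simp add: image_measure_def)
  ultimately show ?thesis by (simp add: cabv_def)
qed

lemma cabv_diff:
  fixes \<mu> \<nu> :: "'t::topological_space set \<Rightarrow> 'x::real_normed_vector"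
  assumes \<mu>: "\<mu> \<in> cabv" and \<nu>: "\<nu> \<in> cabv"
  shows "(\<lambda>B. \<mu> B - \<nu> B) \<in> cabv"
proof -
  have "image_measure (\<lambda>t. t) \<nu> = \<nu>"
    using \<nu> by (auto simp: image_measure_def cabv_def)
  then have neg: "(\<lambda>B. - \<nu> B) \<in> cabv"
    using cabv_image[OF \<nu> measurable_ident bounded_linear_minus[OF bounded_linear_ident]]
    by (simp add: id_def)
  have "(\<lambda>B. \<Sum>i\<in>(UNIV :: bool set). (if i then \<mu> else (\<lambda>B. - \<nu> B)) B) \<in> cabv"
    by (rule cabv_sum) (use \<mu> neg in auto)
  then show ?thesis by (simp add: UNIV_bool)
qed

lemma cabv_mass_diff: "\<mu> \<in> cabv_mass v \<Longrightarrow> \<nu> \<in> cabv_mass v \<Longrightarrow> (\<lambda>B. \<mu> B - \<nu> B) \<in> cabv_mass 0"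
  by (simp add: cabv_mass_def cabv_diff)

lemma iter_op_cabv:
  fixes \<mu> :: "'t::topological_space set \<Rightarrow> 'x::real_normed_vector"
  assumes "\<mu> \<in> cabv" "\<And>i. i \<in> {1..M} \<Longrightarrow> \<omega> i \<in> borel_measurable borel"
    "\<And>i. i \<in> {1..M} \<Longrightarrow> bounded_linear (R i)"
  shows "iter_op M R \<omega> \<mu> \<in> cabv"
  unfolding iter_op_def using assms by (intro cabv_sum cabv_image) auto

lemma variation_iter_op_le:
  fixes \<mu> :: "'t::topological_space set \<Rightarrow> 'x::real_normed_vector"
  assumes "\<mu> \<in> cabv" "\<And>i. i \<in> {1..M} \<Longrightarrow> \<omega> i \<in> borel_measurable borel"
    "\<And>i. i \<in> {1..M} \<Longrightarrow> bounded_linear (R i)"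
  shows "variation (iter_op M R \<omega> \<mu>) \<le> ennreal (\<Sum>i=1..M. onorm (R i)) * variation \<mu>"
proof -
  have "variation (iter_op M R \<omega> \<mu>) \<le> (\<Sum>i=1..M. variation (\<lambda>B. R i (image_measure (\<omega> i) \<mu> B)))"
    unfolding iter_op_def by (rule variation_sum_le) simp
  also have "\<dots> \<le> (\<Sum>i=1..M. ennreal (onorm (R i)) * variation \<mu>)"
    using assms by (intro sum_mono variation_image_le) auto
  also have "\<dots> = ennreal (\<Sum>i=1..M. onorm (R i)) * variation \<mu>"
    unfolding sum_distrib_right[symmetric]
    by (subst sum_ennreal) (use assms(3) onorm_pos_le in auto)
  finally show ?thesis .
qed

text \<open>
  The change of variables formula that moves the operator to the integrand: \<open>\<integral>f d(H \<mu>) = \<Sum>i. \<integral>S\<^sub>i \<circ> f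
  \<circ> \<omega>\<^sub>i d\<mu>\<close>, with \<open>S\<^sub>i\<close> the adjoint of \<open>R\<^sub>i\<close>. It is immediate for simple functions
  and passes to uniform limits.
\<close>

lemma vintegral_image:
  fixes \<mu> :: "'t::metric_space set \<Rightarrow> 'k::real_or_complex ^ 'n"
  assumes \<mu>: "\<mu> \<in> cabv" and T: "compact (UNIV :: 't set)"
    and \<omega>: "\<And>i. i \<in> {1..M} \<Longrightarrow> continuous_on UNIV (\<omega> i)"
    and R: "\<And>i. i \<in> {1..M} \<Longrightarrow> bounded_linear (R i)"
    and S: "\<And>i. i \<in> {1..M} \<Longrightarrow> bounded_linear (S i)"
    and adj: "\<And>i x y. i \<in> {1..M} \<Longrightarrow> scalar_prod x (R i y) = scalar_prod (S i x) y"
    and f: "continuous_on UNIV f"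
  shows "vintegral (iter_op M R \<omega> \<mu>) f = (\<Sum>i=1..M. vintegral \<mu> (\<lambda>t. S i (f (\<omega> i t))))"
proof -
  have \<omega>m: "\<omega> i \<in> borel_measurable borel" if "i \<in> {1..M}" for i
    using \<omega>[OF that] by (rule borel_measurable_continuous_onI)
  have H: "iter_op M R \<omega> \<mu> \<in> cabv" by (rule iter_op_cabv[OF \<mu> \<omega>m R])
  obtain s where s: "\<And>m. simple_function borel (s m)" "uniform_limit UNIV s f sequentially"
    by (rule continuous_simple_approx[OF T f]) (rule that)
  have simp_comp: "simple_function borel (\<lambda>t. s m (\<omega> i t))" if "i \<in> {1..M}" for m i
    unfolding simple_function_def
  proof (intro conjI ballI)
    note sm = simple_function_borelD[OF s(1), of m]
    show "finite ((\<lambda>t. s m (\<omega> i t)) ` space borel)"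
      by (rule finite_subset[OF _ sm(1)]) auto
    have "(\<lambda>t. s m (\<omega> i t)) -` {x} = \<omega> i -` (s m -` {x})" for x by auto
    then show "(\<lambda>t. s m (\<omega> i t)) -` {x} \<inter> space borel \<in> sets borel" for x
      using measurable_sets[OF \<omega>m[OF that] sm(2)] by simp
  qed
  have eq: "simple_vintegral (iter_op M R \<omega> \<mu>) (s m)
      = (\<Sum>i=1..M. simple_vintegral \<mu> (\<lambda>t. S i (s m (\<omega> i t))))" for m
  proof -
    note sm = simple_function_borelD[OF s(1), of m]
    have "simple_vintegral (iter_op M R \<omega> \<mu>) (s m)
        = (\<Sum>x\<in>range (s m). \<Sum>i=1..M. scalar_prod (S i x) (\<mu> (\<omega> i -` (s m -` {x}))))"
      unfolding simple_vintegral_def using sm adj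
      by (intro sum.cong refl) (simp add: iter_op_def scalar_prod_sum_right image_measure_def)
    also have "\<dots> = (\<Sum>i=1..M. \<Sum>x\<in>range (s m). scalar_prod (S i x) (\<mu> (\<omega> i -` (s m -` {x}))))"
      by (rule sum.swap)
    also have "\<dots> = (\<Sum>i=1..M. simple_vintegral \<mu> (\<lambda>t. S i (s m (\<omega> i t))))"
    proof (rule sum.cong[OF refl])
      fix i assume i: "i \<in> {1..M}"
      show "(\<Sum>x\<in>range (s m). scalar_prod (S i x) (\<mu> (\<omega> i -` (s m -` {x}))))
          = simple_vintegral \<mu> (\<lambda>t. S i (s m (\<omega> i t)))"
      proof (rule simple_vintegral_partition[OF \<mu>, symmetric])
        show "\<omega> i -` (s m -` {x}) \<in> sets borel" for x
          using measurable_sets[OF \<omega>m[OF i] sm(2)] by simp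
      qed (use sm in \<open>auto simp: disjoint_family_on_def\<close>)
    qed
    finally show ?thesis .
  qed
  have "(\<lambda>m. \<Sum>i=1..M. simple_vintegral \<mu> (\<lambda>t. S i (s m (\<omega> i t))))
      \<longlonglongrightarrow> (\<Sum>i=1..M. vintegral \<mu> (\<lambda>t. S i (f (\<omega> i t))))"
  proof (intro tendsto_sum vintegral_limit[OF \<mu> T])
    fix i assume i: "i \<in> {1..M}"
    interpret Si: bounded_linear "S i" by (rule S[OF i])
    show "continuous_on UNIV (\<lambda>t. S i (f (\<omega> i t)))"
      by (intro Si.continuous_on continuous_on_compose2[OF f \<omega>[OF i]]) auto
    show "simple_function borel (\<lambda>t. S i (s m (\<omega> i t)))" for m
      by (rule simple_function_compose1[OF simp_comp[OF i]])
    show "uniform_limit UNIV (\<lambda>m t. S i (s m (\<omega> i t))) (\<lambda>t. S i (f (\<omega> i t))) sequentially"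
    proof (rule Si.uniform_limit)
      show "uniform_limit UNIV (\<lambda>m t. s m (\<omega> i t)) (\<lambda>t. f (\<omega> i t)) sequentially"
        using s(2) unfolding uniform_limit_iff by (auto elim!: eventually_mono)
    qed
  qed
  then show ?thesis
    using vintegral_limit[OF H T f s] unfolding eq by (intro LIMSEQ_unique)
qed

section \<open>The Monge--Kantorovich metric\<close>

text \<open>
  The supremum in the Monge--Kantorovich norm is taken in the reals, so it has to be shown finite. After subtracting its value at one point a
  \<open>1\<close>-Lipschitz function is bounded by the diameter of the space.
\<close>

lemma bdd_above_Lip_vintegrals:
  fixes \<mu> :: "'t::metric_space set \<Rightarrow> 'k::real_or_complex ^ 'n"
  assumes \<mu>: "\<mu> \<in> cabv_mass 0" and T: "compact (UNIV :: 't set)"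
  shows "bdd_above ((\<lambda>f. norm (vintegral \<mu> f)) ` {f. f \<in> Lip \<and> lip_norm f \<le> 1})"
proof -
  obtain x0 D where D: "\<And>t :: 't. dist x0 t \<le> D"
    using compact_imp_bounded[OF T] by (auto simp: bounded_def)
  have c: "\<mu> \<in> cabv" using \<mu> by (simp add: cabv_mass_def)
  have "norm (vintegral \<mu> f) \<le> D * enn2real (variation \<mu>)"
    if f: "f \<in> Lip" "lip_norm f \<le> 1" for f
  proof -
    note cf = Lip_continuous[OF f(1)]
    have "norm (f t - f x0) \<le> D" for t
    proof -
      have "dist (f t) (f x0) \<le> 1 * dist t x0" using f(2) lip_norm_le_iff[of 1 f] by simp
      then show ?thesis using D[of t] by (simp add: dist_norm dist_commute)
    qed
    then have "norm (vintegral \<mu> (\<lambda>t. f t - f x0)) \<le> D * enn2real (variation \<mu>)"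
      by (intro norm_vintegral_le[OF c T] continuous_intros cf)
    then show ?thesis by (simp add: vintegral_diff_const[OF \<mu> T cf])
  qed
  then show ?thesis by (auto intro!: bdd_aboveI)
qed

lemma norm_vintegral_le_mk_norm:
  fixes \<mu> :: "'t::metric_space set \<Rightarrow> 'k::real_or_complex ^ 'n"
  assumes \<mu>: "\<mu> \<in> cabv_mass 0" and T: "compact (UNIV :: 't set)"
    and L: "0 \<le> L" "\<And>s t. dist (f s) (f t) \<le> L * dist s t"
  shows "norm (vintegral \<mu> f) \<le> L * mk_norm \<mu>"
proof -
  have c: "\<mu> \<in> cabv" "\<mu> UNIV = 0" using \<mu> by (auto simp: cabv_mass_def)
  show ?thesis
  proof (cases "L = 0")
    case True
    then have "f = (\<lambda>_. f undefined)" using L(2)[of _ undefined] by auto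
    then have "vintegral \<mu> f = 0"
      using vintegral_const[OF c(1) T, of "f undefined"] c(2) by simp
    then show ?thesis using True by simp
  next
    case False
    then have "0 < L" using L(1) by simp
    have f: "f \<in> Lip" using L by (auto simp: Lip_iff)
    define g where "g t = (1 / L) *\<^sub>R f t" for t
    have "dist (g s) (g t) \<le> 1 * dist s t" for s t
    proof -
      have "dist (g s) (g t) = dist (f s) (f t) / L"
        using \<open>0 < L\<close> by (simp add: g_def dist_norm flip: scaleR_diff_right)
      then show ?thesis using L(2)[of s t] \<open>0 < L\<close> by (simp add: divide_le_eq mult.commute)
    qed
    then have g: "g \<in> Lip" "lip_norm g \<le> 1"
      using lip_norm_le_iff[of 1 g] by (auto simp: Lip_iff intro: exI[of _ 1])
    have "norm (vintegral \<mu> g) \<le> mk_norm \<mu>"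
      unfolding mk_norm_def using \<mu> g bdd_above_Lip_vintegrals[OF \<mu> T]
      by (simp, intro cSUP_upper) auto
    moreover have "vintegral \<mu> g = (1 / L) *\<^sub>R vintegral \<mu> f"
      unfolding g_def by (rule vintegral_scaleR[OF c(1) T Lip_continuous[OF f]])
    ultimately show ?thesis using \<open>0 < L\<close> by (simp add: divide_le_eq mult.commute)
  qed
qed

lemma mk_norm_le:
  fixes \<mu> :: "'t::metric_space set \<Rightarrow> 'k::real_or_complex ^ 'n"
  assumes "0 \<le> C" and "\<And>f. (\<And>s t. dist (f s) (f t) \<le> dist s t) \<Longrightarrow> norm (vintegral \<mu> f) \<le> C"
  shows "mk_norm \<mu> \<le> C"
proof (cases "\<mu> \<in> cabv_mass 0")
  case True
  have ne: "(\<lambda>_. 0) \<in> {f :: 't \<Rightarrow> 'k ^ 'n. f \<in> Lip \<and> lip_norm f \<le> 1}"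
    using lip_norm_le_iff[of 1 "\<lambda>_ :: 't. 0 :: 'k ^ 'n"] by (auto simp: Lip_iff intro: exI[of _ 0])
  have "norm (vintegral \<mu> f) \<le> C" if "f \<in> {f. f \<in> Lip \<and> lip_norm f \<le> 1}" for f
    using that lip_norm_le_iff[of 1 f] by (intro assms(2)) auto
  then show ?thesis
    unfolding mk_norm_def using True ne by (auto intro!: cSUP_least)
qed (simp add: mk_norm_def assms(1))

lemma mk_norm_nonneg:
  fixes \<mu> :: "'t::metric_space set \<Rightarrow> 'k::real_or_complex ^ 'n"
  assumes T: "compact (UNIV :: 't set)"
  shows "0 \<le> mk_norm \<mu>"
proof (cases "\<mu> \<in> cabv_mass 0")
  case True
  have "0 \<le> norm (vintegral \<mu> (\<lambda>_. 0))" by simp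
  also have "\<dots> \<le> 1 * mk_norm \<mu>" by (rule norm_vintegral_le_mk_norm[OF True T]) auto
  finally show ?thesis by simp
qed (simp add: mk_norm_def)

lemma mk_norm_eq_zero:
  fixes \<mu> :: "'t::metric_space set \<Rightarrow> 'k::real_or_complex ^ 'n"
  assumes \<mu>: "\<mu> \<in> cabv_mass 0" and T: "compact (UNIV :: 't set)" and zero: "mk_norm \<mu> = 0"
  shows "\<mu> B = 0"
proof (rule measure_zero_if_Lip_vintegrals_zero[OF _ T])
  show "\<mu> \<in> cabv" using \<mu> by (simp add: cabv_mass_def)
  fix f :: "'t \<Rightarrow> 'k ^ 'n" assume "f \<in> Lip"
  then obtain L where "0 \<le> L" "\<And>s t. dist (f s) (f t) \<le> L * dist s t" by (auto simp: Lip_iff)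
  then have "norm (vintegral \<mu> f) \<le> L * mk_norm \<mu>" by (rule norm_vintegral_le_mk_norm[OF \<mu> T])
  then show "vintegral \<mu> f = 0" using zero by simp
qed

lemma vintegral_minus:
  fixes f :: "'t::metric_space \<Rightarrow> 'k::real_or_complex ^ 'n"
  assumes \<mu>: "\<mu> \<in> cabv" and T: "compact (UNIV :: 't set)" and f: "continuous_on UNIV f"
  shows "(\<lambda>B. - \<mu> B) \<in> cabv" "vintegral (\<lambda>B. - \<mu> B) f = - vintegral \<mu> f"
proof -
  have 0: "(\<lambda>_. 0) \<in> (cabv :: ('t set \<Rightarrow> 'k ^ 'n) set)"
    using cabv_diff[OF \<mu> \<mu>] by simp
  have "vintegral (\<lambda>_. 0) f = 0"
    using vintegral_diff_measure[OF \<mu> \<mu> cabv_diff[OF \<mu> \<mu>] T f] by simp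
  then show "(\<lambda>B. - \<mu> B) \<in> cabv" "vintegral (\<lambda>B. - \<mu> B) f = - vintegral \<mu> f"
    using cabv_diff[OF 0 \<mu>] vintegral_diff_measure[OF 0 \<mu> cabv_diff[OF 0 \<mu>] T f] by simp_all
qed

lemma continuous_if_nonexpansive:
  fixes f :: "'t::metric_space \<Rightarrow> 'x::metric_space"
  assumes "\<And>s t. dist (f s) (f t) \<le> dist s t"
  shows "continuous_on UNIV f"
  using assms by (intro Lip_continuous) (auto simp: Lip_iff intro!: exI[of _ 1])

text \<open>
  The equation is needed for all set functions, as symmetry of a metric is required on the whole type; off the measures of mass \<open>0\<close> both
  sides have the value \<open>0\<close>.
\<close>

lemma mk_norm_minus:
  fixes \<mu> :: "'t::metric_space set \<Rightarrow> 'k::real_or_complex ^ 'n"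
  assumes T: "compact (UNIV :: 't set)"
  shows "mk_norm (\<lambda>B. - \<mu> B) = mk_norm \<mu>"
proof -
  have mass: "(\<lambda>B. - \<nu> B) \<in> cabv_mass 0" if "\<nu> \<in> cabv_mass 0" for \<nu> :: "'t set \<Rightarrow> 'k ^ 'n"
    using that vintegral_minus(1)[OF _ T continuous_on_const, of \<nu>] by (simp add: cabv_mass_def)
  have le: "mk_norm (\<lambda>B. - \<nu> B) \<le> mk_norm \<nu>" for \<nu> :: "'t set \<Rightarrow> 'k ^ 'n"
  proof (cases "\<nu> \<in> cabv_mass 0")
    case True
    show ?thesis
    proof (rule mk_norm_le[OF mk_norm_nonneg[OF T]])
      fix f :: "'t \<Rightarrow> 'k ^ 'n" assume f: "\<And>s t. dist (f s) (f t) \<le> dist s t"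
      have "vintegral (\<lambda>B. - \<nu> B) f = - vintegral \<nu> f"
        using True by (intro vintegral_minus T continuous_if_nonexpansive f) (simp add: cabv_mass_def)
      then show "norm (vintegral (\<lambda>B. - \<nu> B) f) \<le> mk_norm \<nu>"
        using norm_vintegral_le_mk_norm[OF True T, of 1 f] f by simp
    qed
  next
    case False
    then have "(\<lambda>B. - \<nu> B) \<notin> cabv_mass 0" using mass[of "\<lambda>B. - \<nu> B"] by auto
    then show ?thesis using mk_norm_nonneg[OF T, of \<nu>] by (simp add: mk_norm_def)
  qed
  show ?thesis using le[of \<mu>] le[of "\<lambda>B. - \<mu> B"] by simp
qed

lemma Metric_space_mk_dist:
  fixes A :: "('t::metric_space set \<Rightarrow> 'k::real_or_complex ^ 'n) set"
  assumes T: "compact (UNIV :: 't set)" and A: "A \<subseteq> cabv_mass v"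
  shows "Metric_space A mk_dist"
proof
  fix x y z :: "'t set \<Rightarrow> 'k ^ 'n"
  show "0 \<le> mk_dist x y" by (simp add: mk_dist_def mk_norm_nonneg[OF T])
  show "mk_dist x y = mk_dist y x"
    using mk_norm_minus[OF T, of "\<lambda>B. x B - y B"] by (simp add: mk_dist_def)
  show "mk_dist x y = 0 \<longleftrightarrow> x = y" if "x \<in> A" "y \<in> A"
  proof -
    have d: "(\<lambda>B. x B - y B) \<in> cabv_mass 0" using that A by (intro cabv_mass_diff) auto
    show ?thesis
    proof
      assume "mk_dist x y = 0"
      then have "x B - y B = 0" for B
        using mk_norm_eq_zero[OF d T] by (simp add: mk_dist_def)
      then show "x = y" by auto
    next
      assume xy: "x = y"
      have "mk_norm (\<lambda>_ :: 't set. 0 :: 'k ^ 'n) \<le> 0"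
      proof (rule mk_norm_le)
        fix f :: "'t \<Rightarrow> 'k ^ 'n" assume f: "\<And>s t. dist (f s) (f t) \<le> dist s t"
        have "x \<in> cabv" using \<open>x \<in> A\<close> A by (auto simp: cabv_mass_def)
        then show "norm (vintegral (\<lambda>_ :: 't set. 0) f) \<le> 0"
          using vintegral_diff_measure[OF _ _ cabv_diff T continuous_if_nonexpansive[OF f], of x x] by simp
      qed simp
      then show "mk_dist x y = 0"
        using mk_norm_nonneg[OF T, of "\<lambda>_ :: 't set. 0 :: 'k ^ 'n"] xy by (simp add: mk_dist_def)
    qed
  qed
  assume xyz: "x \<in> A" "y \<in> A" "z \<in> A"
  then have c: "x \<in> cabv" "y \<in> cabv" "z \<in> cabv" using A by (auto simp: cabv_mass_def)
  have d: "(\<lambda>B. x B - y B) \<in> cabv_mass 0" "(\<lambda>B. y B - z B) \<in> cabv_mass 0"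
    using A xyz by (auto intro!: cabv_mass_diff)
  show "mk_dist x z \<le> mk_dist x y + mk_dist y z"
    unfolding mk_dist_def
  proof (rule mk_norm_le)
    fix f :: "'t \<Rightarrow> 'k ^ 'n" assume f: "\<And>s t. dist (f s) (f t) \<le> dist s t"
    note cf = continuous_if_nonexpansive[OF f]
    have "vintegral (\<lambda>B. x B - z B) f = vintegral (\<lambda>B. x B - y B) f + vintegral (\<lambda>B. y B - z B) f"
      using vintegral_diff_measure[OF c(1) c(3) cabv_diff[OF c(1) c(3)] T cf]
        vintegral_diff_measure[OF c(1) c(2) cabv_diff[OF c(1) c(2)] T cf]
        vintegral_diff_measure[OF c(2) c(3) cabv_diff[OF c(2) c(3)] T cf] by simp
    also have "norm \<dots> \<le> mk_norm (\<lambda>B. x B - y B) + mk_norm (\<lambda>B. y B - z B)"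
      using norm_vintegral_le_mk_norm[OF d(1) T, of 1 f] norm_vintegral_le_mk_norm[OF d(2) T, of 1 f] f
      by (intro order_trans[OF norm_triangle_ineq] add_mono) auto
    finally show "norm (vintegral (\<lambda>B. x B - z B) f) \<le> mk_norm (\<lambda>B. x B - y B) + mk_norm (\<lambda>B. y B - z B)" .
  qed (intro add_nonneg_nonneg mk_norm_nonneg[OF T])
qed

section \<open>Weak* closed sets\<close>

text \<open>
  Every subbasic open set that contains the limit eventually contains the sequence, and this property is inherited by finite intersections and
  arbitrary unions.
\<close>

lemma weak_star_closed_limit:
  fixes A :: "('t::metric_space set \<Rightarrow> 'k::real_or_complex ^ 'n) set"
  assumes A: "closedin weak_star A" and \<mu>: "\<And>k. \<mu> k \<in> A" and \<nu>: "\<nu> \<in> cabv"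
    and lim: "\<And>f. continuous_on UNIV f \<Longrightarrow> (\<lambda>k. vintegral (\<mu> k) f) \<longlonglongrightarrow> vintegral \<nu> f"
  shows "\<nu> \<in> A"
proof (rule ccontr)
  assume "\<nu> \<notin> A"
  let ?G = "{{\<mu> \<in> cabv. vintegral \<mu> f \<in> U} | f U. continuous_on UNIV f \<and> open U}
    :: ('t set \<Rightarrow> 'k ^ 'n) set set"
  have "{\<mu> :: 't set \<Rightarrow> 'k ^ 'n. \<mu> \<in> cabv \<and> vintegral \<mu> (\<lambda>_. 0) \<in> UNIV} \<in> ?G"
    by (intro CollectI exI[of _ "\<lambda>_. 0"] exI[of _ UNIV] conjI refl) auto
  then have "cabv \<subseteq> \<Union>?G" by auto
  then have top: "topspace weak_star = (cabv :: ('t set \<Rightarrow> 'k ^ 'n) set)"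
    unfolding weak_star_def topology_generated_by_topspace by auto
  have A_cabv: "A \<subseteq> cabv" and "openin weak_star (cabv - A)"
    using A by (auto simp: closedin_def top)
  then have "generate_topology_on ?G (cabv - A)"
    by (simp add: weak_star_def openin_topology_generated_by_iff)
  then have "\<nu> \<in> cabv - A \<longrightarrow> (\<forall>\<^sub>F k in sequentially. \<mu> k \<in> cabv - A)"
  proof (induction rule: generate_topology_on.induct)
    case (Int a b)
    then show ?case by (auto elim: eventually_elim2)
  next
    case (UN K)
    show ?case
    proof
      assume "\<nu> \<in> \<Union>K"
      then obtain S where "S \<in> K" "\<nu> \<in> S" by blast
      with UN.IH have "\<forall>\<^sub>F k in sequentially. \<mu> k \<in> S" by blast
      then show "\<forall>\<^sub>F k in sequentially. \<mu> k \<in> \<Union>K"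
        using \<open>S \<in> K\<close> by (auto elim: eventually_mono)
    qed
  next
    case (Basis S)
    then obtain f U where S: "S = {\<mu> \<in> cabv. vintegral \<mu> f \<in> U}" "continuous_on UNIV f" "open U"
      by blast
    show ?case
    proof
      assume "\<nu> \<in> S"
      then have "\<forall>\<^sub>F k in sequentially. vintegral (\<mu> k) f \<in> U"
        using S by (intro topological_tendstoD[OF lim]) auto
      then show "\<forall>\<^sub>F k in sequentially. \<mu> k \<in> S"
        by (rule eventually_mono) (use \<mu> A_cabv S(1) in auto)
    qed
  qed simp
  then show False using \<nu> \<open>\<nu> \<notin> A\<close> \<mu> by simp
qed

text \<open>
  Both conditions can be read off from integrals: the total mass from constant functions, and the bound on the variation from continuous functions
  bounded by \<open>1\<close>. Hence the complement is a union of subbasic open sets.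
\<close>

lemma closedin_weak_star_ball_mass:
  fixes v :: "'k::real_or_complex ^ 'n"
  assumes T: "compact (UNIV :: 't::metric_space set)" and a: "0 < a"
  shows "closedin weak_star (cabv_ball a \<inter> cabv_mass v :: ('t set \<Rightarrow> 'k ^ 'n) set)"
proof -
  let ?A = "cabv_ball a \<inter> cabv_mass v :: ('t set \<Rightarrow> 'k ^ 'n) set"
  define G :: "('t set \<Rightarrow> 'k ^ 'n) set set"
    where "G = {{\<mu> \<in> cabv. vintegral \<mu> f \<in> U} | f U. continuous_on UNIV f \<and> open U}"
  define W where "W f U = {\<mu> :: 't set \<Rightarrow> 'k ^ 'n. \<mu> \<in> cabv \<and> vintegral \<mu> f \<in> U}" for f U
  have W: "W f U \<in> G" if "continuous_on UNIV f" "open U" for f U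
    unfolding W_def G_def using that by (intro CollectI exI[of _ f] exI[of _ U] conjI refl) auto
  have "W (\<lambda>_. 0) UNIV \<in> G" by (rule W) auto
  then have "cabv \<subseteq> \<Union>G" by (auto simp: W_def)
  then have top: "topspace weak_star = (cabv :: ('t set \<Rightarrow> 'k ^ 'n) set)"
    unfolding weak_star_def topology_generated_by_topspace G_def[symmetric] by (auto simp: G_def)
  define \<K> where "\<K> = {W (\<lambda>_. x) (- {scalar_prod x v}) | x. True} \<union>
     {W f {z. a < norm z} | f. continuous_on UNIV f \<and> (\<forall>t. norm (f t) \<le> 1)}"
  have op: "open {z :: 'k. a < norm z}" by (intro open_Collect_less continuous_intros)
  have "\<K> \<subseteq> G"
  proof -
    have "W (\<lambda>_. x) (- {scalar_prod x v}) \<in> G" for x by (rule W) auto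
    moreover have "W f {z. a < norm z} \<in> G" if "continuous_on UNIV f" for f by (rule W[OF that op])
    ultimately show ?thesis unfolding \<K>_def by blast
  qed
  then have "openin weak_star (\<Union>\<K>)"
    unfolding weak_star_def G_def[symmetric] by (intro openin_Union topology_generated_by_Basis) auto
  moreover have "\<Union>\<K> = cabv - ?A"
  proof (intro equalityI subsetI)
    fix \<mu> assume "\<mu> \<in> \<Union>\<K>"
    then consider x where "\<mu> \<in> cabv" "vintegral \<mu> (\<lambda>_. x) \<noteq> scalar_prod x v"
      | f where "\<mu> \<in> cabv" "a < norm (vintegral \<mu> f)" "continuous_on UNIV f" "\<And>t. norm (f t) \<le> 1"
      by (auto simp: \<K>_def W_def)
    then show "\<mu> \<in> cabv - ?A"
    proof cases
      case 1
      then show ?thesis using vintegral_const[OF 1(1) T] by (auto simp: cabv_mass_def)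
    next
      case 2
      have "a < enn2real (variation \<mu>)"
        using norm_vintegral_le[OF 2(1) T 2(3,4)] 2(2) by simp
      moreover have "enn2real (variation \<mu>) \<le> a" if "variation \<mu> \<le> ennreal a"
        using that a by (intro enn2real_leI) auto
      ultimately show ?thesis using 2(1) by (auto simp: cabv_ball_def)
    qed
  next
    fix \<mu> assume \<mu>: "\<mu> \<in> cabv - ?A"
    then consider "\<mu> UNIV \<noteq> v" | "\<not> variation \<mu> \<le> ennreal a"
      by (auto simp: cabv_ball_def cabv_mass_def)
    then show "\<mu> \<in> \<Union>\<K>"
    proof cases
      case 1
      define x where "x = \<mu> UNIV - v"
      have "scalar_prod x (\<mu> UNIV) - scalar_prod x v = of_real ((norm x)\<^sup>2)"
        by (simp add: x_def scalar_prod_self flip: scalar_prod.diff_right)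
      moreover have "norm x \<noteq> 0" using 1 by (simp add: x_def)
      ultimately have "scalar_prod x (\<mu> UNIV) \<noteq> scalar_prod x v" by auto
      then have "\<mu> \<in> W (\<lambda>_. x) (- {scalar_prod x v})"
        using \<mu> vintegral_const[OF _ T, of \<mu> x] by (simp add: W_def)
      then show ?thesis by (auto simp: \<K>_def)
    next
      case 2
      have "\<exists>f. continuous_on UNIV f \<and> (\<forall>t. norm (f t) \<le> 1) \<and> a < norm (vintegral \<mu> f)"
      proof (rule ccontr)
        assume "\<not> ?thesis"
        then have "variation \<mu> \<le> ennreal a"
          using \<mu> by (intro variation_le_if_vintegral_le T) (auto simp: not_less)
        then show False using 2 by blast
      qed
      then show ?thesis using \<mu> by (auto simp: \<K>_def W_def)
    qed
  qed
  ultimately show ?thesis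
    unfolding closedin_def top by (auto simp: cabv_ball_def)
qed

text \<open>
  The point mass \<open>v\<close> at an arbitrary point has total mass \<open>v\<close> and variation at most \<open>\<bar>v\<bar>\<close>.
\<close>

lemma ball_mass_nonempty:
  fixes v :: "'x::real_normed_vector"
  assumes "norm v \<le> a"
  shows "(cabv_ball a \<inter> cabv_mass v :: ('t::topological_space set \<Rightarrow> 'x) set) \<noteq> {}"
proof -
  fix p :: 't
  define \<delta> where "\<delta> B = (if B \<in> sets borel \<and> p \<in> B then v else 0)" for B
  have var: "variation \<delta> \<le> ennreal (norm v)"
    unfolding variation_def
  proof (rule SUP_least, safe)
    fix D :: "'t set set"
    assume D: "finite D" "D \<subseteq> sets borel" "partition_on UNIV D"
    have "p \<in> \<Union>D" using D(3) by (simp add: partition_on_def)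
    then obtain B where B: "B \<in> D" "p \<in> B" by blast
    have "\<delta> C = 0" if "C \<in> D - {B}" for C
      using D(3) B that by (auto simp: partition_on_def disjoint_def \<delta>_def)
    then have "(\<Sum>C\<in>D - {B}. norm (\<delta> C)) = 0" by simp
    then have "(\<Sum>C\<in>D. norm (\<delta> C)) \<le> norm v"
      using sum.remove[OF D(1) B(1), of "\<lambda>C. norm (\<delta> C)"] by (simp add: \<delta>_def)
    then show "(\<Sum>C\<in>D. ennreal (norm (\<delta> C))) \<le> ennreal (norm v)" by (simp add: ennreal_leI)
  qed
  have "(\<lambda>i. \<delta> (A i)) sums \<delta> (\<Union>i. A i)"
    if A: "range A \<subseteq> sets borel" "disjoint_family A" for A :: "nat \<Rightarrow> 't set"
  proof (cases "\<exists>i. p \<in> A i")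
    case True
    then obtain i where i: "p \<in> A i" by blast
    have "\<delta> (A j) = 0" if "j \<noteq> i" for j
      using disjoint_family_onD[OF A(2), of i j] i that by (auto simp: \<delta>_def)
    then have "(\<lambda>j. \<delta> (A j)) = (\<lambda>j. if j = i then \<delta> (A i) else 0)" by auto
    moreover have "\<delta> (\<Union>i. A i) = \<delta> (A i)" using A(1) i by (auto simp: \<delta>_def)
    ultimately show ?thesis using sums_single[of i "\<lambda>j. \<delta> (A i)"] by simp
  qed (simp add: \<delta>_def)
  moreover have "\<delta> A = 0" if "A \<notin> sets borel" for A using that by (simp add: \<delta>_def)
  moreover have "variation \<delta> < \<infinity>" using var by (rule le_less_trans) simp
  ultimately have "\<delta> \<in> cabv" unfolding cabv_def by blast
  moreover have "variation \<delta> \<le> ennreal a"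
    using var ennreal_leI[OF assms] by (rule order_trans)
  ultimately have "\<delta> \<in> cabv_ball a \<inter> cabv_mass v"
    by (simp add: cabv_ball_def cabv_mass_def \<delta>_def)
  then show ?thesis by blast
qed

section \<open>Contraction and weak* continuity of the operator\<close>

lemma iter_op_mass:
  assumes "(\<lambda>x. \<Sum>i=1..M. R i x) = id"
  shows "iter_op M R \<omega> \<mu> UNIV = \<mu> UNIV"
  using fun_cong[OF assms, of "\<mu> UNIV"] by (simp add: iter_op_def image_measure_def)

lemma iter_op_diff:
  assumes "\<And>i. i \<in> {1..M} \<Longrightarrow> bounded_linear (R i)"
  shows "iter_op M R \<omega> (\<lambda>B. \<mu> B - \<nu> B) = (\<lambda>B. iter_op M R \<omega> \<mu> B - iter_op M R \<omega> \<nu> B)"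
proof
  fix B
  have "R i (image_measure (\<omega> i) (\<lambda>B. \<mu> B - \<nu> B) B)
      = R i (image_measure (\<omega> i) \<mu> B) - R i (image_measure (\<omega> i) \<nu> B)" if "i \<in> {1..M}" for i
    using bounded_linear.linear[OF assms[OF that]]
    by (simp add: image_measure_def linear_diff linear_0)
  then show "iter_op M R \<omega> (\<lambda>B. \<mu> B - \<nu> B) B = iter_op M R \<omega> \<mu> B - iter_op M R \<omega> \<nu> B"
    by (simp add: iter_op_def sum_subtractf)
qed

text \<open>
  For a \<open>1\<close>-Lipschitz \<open>f\<close> the integrand \<open>S\<^sub>i \<circ> f \<circ> \<omega>\<^sub>i\<close> produced by the change
  of variables has Lipschitz constant at most \<open>onorm R\<^sub>i * r\<^sub>i\<close>. The individual maps \<open>\<omega>\<^sub>i\<close> may be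
  expanding; only the weighted sum of the constants counts.
\<close>

lemma mk_norm_iter_op_le:
  fixes \<mu> :: "'t::metric_space set \<Rightarrow> 'k::real_or_complex ^ 'n"
  assumes \<mu>: "\<mu> \<in> cabv_mass 0" and T: "compact (UNIV :: 't set)"
    and \<omega>: "\<And>i s t. i \<in> {1..M} \<Longrightarrow> dist (\<omega> i s) (\<omega> i t) \<le> r i * dist s t"
    and r: "\<And>i. i \<in> {1..M} \<Longrightarrow> 0 \<le> r i"
    and R: "\<And>i. i \<in> {1..M} \<Longrightarrow> R i \<in> continuous_linear_ops"
  shows "mk_norm (iter_op M R \<omega> \<mu>) \<le> (\<Sum>i=1..M. onorm (R i) * r i) * mk_norm \<mu>"
proof (rule mk_norm_le)
  note bl = continuous_linear_ops_bounded_linear[OF R]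
  have onorm_nonneg: "0 \<le> onorm (R i)" if "i \<in> {1..M}" for i
    by (rule onorm_pos_le[OF bl[OF that]])
  show "0 \<le> (\<Sum>i=1..M. onorm (R i) * r i) * mk_norm \<mu>"
    by (intro mult_nonneg_nonneg sum_nonneg mk_norm_nonneg[OF T] onorm_nonneg r)
  fix f :: "'t \<Rightarrow> 'k ^ 'n" assume f: "\<And>s t. dist (f s) (f t) \<le> dist s t"
  have "\<forall>i\<in>{1..M}. \<exists>S. bounded_linear S \<and> (\<forall>x y. scalar_prod x (R i y) = scalar_prod (S x) y) \<and>
      (\<forall>x. norm (S x) \<le> onorm (R i) * norm x)"
    using adjoint_exists[OF R] by metis
  then obtain S where S: "\<And>i. i \<in> {1..M} \<Longrightarrow> bounded_linear (S i)"
      "\<And>i x y. i \<in> {1..M} \<Longrightarrow> scalar_prod x (R i y) = scalar_prod (S i x) y"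
      "\<And>i x. i \<in> {1..M} \<Longrightarrow> norm (S i x) \<le> onorm (R i) * norm x"
    unfolding bchoice_iff by blast
  have c\<omega>: "continuous_on UNIV (\<omega> i)" if "i \<in> {1..M}" for i
    using \<omega>[OF that] r[OF that] by (intro Lip_continuous) (auto simp: Lip_iff)
  have "norm (vintegral \<mu> (\<lambda>t. S i (f (\<omega> i t)))) \<le> (onorm (R i) * r i) * mk_norm \<mu>" if i: "i \<in> {1..M}" for i
  proof (rule norm_vintegral_le_mk_norm[OF \<mu> T])
    show "0 \<le> onorm (R i) * r i" using onorm_nonneg[OF i] r[OF i] by simp
    fix s t
    have "dist (S i (f (\<omega> i s))) (S i (f (\<omega> i t))) = norm (S i (f (\<omega> i s) - f (\<omega> i t)))"
      using bounded_linear.linear[OF S(1)[OF i]] by (simp add: dist_norm linear_diff)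
    also have "\<dots> \<le> onorm (R i) * dist (f (\<omega> i s)) (f (\<omega> i t))"
      using S(3)[OF i] by (simp add: dist_norm)
    also have "\<dots> \<le> onorm (R i) * (r i * dist s t)"
      using onorm_nonneg[OF i] by (intro mult_left_mono order_trans[OF f \<omega>[OF i]])
    finally show "dist (S i (f (\<omega> i s))) (S i (f (\<omega> i t))) \<le> onorm (R i) * r i * dist s t"
      by (simp add: mult.assoc)
  qed
  moreover have "vintegral (iter_op M R \<omega> \<mu>) f = (\<Sum>i=1..M. vintegral \<mu> (\<lambda>t. S i (f (\<omega> i t))))"
    using \<mu> by (intro vintegral_image T c\<omega> bl S continuous_if_nonexpansive f) (simp add: cabv_mass_def)
  ultimately show "norm (vintegral (iter_op M R \<omega> \<mu>) f) \<le> (\<Sum>i=1..M. onorm (R i) * r i) * mk_norm \<mu>"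
    unfolding sum_distrib_right by (simp only: sum_norm_le)
qed

text \<open>
  The operator is sequentially weak* continuous, since the change of variables turns a continuous integrand into finitely many continuous integrands.
\<close>

lemma vintegral_iter_op_tendsto:
  fixes \<mu> :: "nat \<Rightarrow> 't::metric_space set \<Rightarrow> 'k::real_or_complex ^ 'n"
  assumes \<mu>: "\<And>j. \<mu> j \<in> cabv" "\<nu> \<in> cabv" and T: "compact (UNIV :: 't set)"
    and \<omega>: "\<And>i. i \<in> {1..M} \<Longrightarrow> continuous_on UNIV (\<omega> i)"
    and R: "\<And>i. i \<in> {1..M} \<Longrightarrow> R i \<in> continuous_linear_ops"
    and lim: "\<And>f. continuous_on UNIV f \<Longrightarrow> (\<lambda>j. vintegral (\<mu> j) f) \<longlonglongrightarrow> vintegral \<nu> f"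
    and f: "continuous_on UNIV f"
  shows "(\<lambda>j. vintegral (iter_op M R \<omega> (\<mu> j)) f) \<longlonglongrightarrow> vintegral (iter_op M R \<omega> \<nu>) f"
proof -
  note bl = continuous_linear_ops_bounded_linear[OF R]
  have "\<forall>i\<in>{1..M}. \<exists>S. bounded_linear S \<and> (\<forall>x y. scalar_prod x (R i y) = scalar_prod (S x) y)"
    using adjoint_exists[OF R] by metis
  then obtain S where S: "\<And>i. i \<in> {1..M} \<Longrightarrow> bounded_linear (S i)"
      "\<And>i x y. i \<in> {1..M} \<Longrightarrow> scalar_prod x (R i y) = scalar_prod (S i x) y"
    unfolding bchoice_iff by blast
  have "continuous_on UNIV (\<lambda>t. S i (f (\<omega> i t)))" if "i \<in> {1..M}" for i
    by (intro bounded_linear.continuous_on[OF S(1)[OF that]] continuous_on_compose2[OF f \<omega>[OF that]]) auto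
  then have "(\<lambda>j. \<Sum>i=1..M. vintegral (\<mu> j) (\<lambda>t. S i (f (\<omega> i t))))
      \<longlonglongrightarrow> (\<Sum>i=1..M. vintegral \<nu> (\<lambda>t. S i (f (\<omega> i t))))"
    by (intro tendsto_sum lim)
  moreover have "vintegral (iter_op M R \<omega> \<tau>) f = (\<Sum>i=1..M. vintegral \<tau> (\<lambda>t. S i (f (\<omega> i t))))"
    if "\<tau> \<in> cabv" for \<tau> by (rule vintegral_image[OF that T \<omega> bl S f])
  ultimately show ?thesis using \<mu> by simp
qed

section \<open>The invariant vector measure\<close>

theorem theorem2p2p1:
  fixes \<omega> :: "nat \<Rightarrow> 't::metric_space \<Rightarrow> 't"
    and R :: "nat \<Rightarrow> 'k::real_or_complex ^ 'n \<Rightarrow> 'k ^ 'n"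
    and H :: "('t set \<Rightarrow> 'k ^ 'n) \<Rightarrow> 't set \<Rightarrow> 'k ^ 'n"
    and r :: "nat \<Rightarrow> real" and M :: nat and a c :: real and v :: "'k ^ 'n"
  assumes compact_T: "compact (UNIV :: 't set)"
    and two_points: "\<exists>x y :: 't. x \<noteq> y"
    and M: "M \<ge> 1"
    and \<omega>: "\<And>i. i \<in> {1..M} \<Longrightarrow> \<omega> i \<in> Lip"
    and r: "\<And>i. i \<in> {1..M} \<Longrightarrow> r i = enn2real (lip_norm (\<omega> i))"
    and R: "\<And>i. i \<in> {1..M} \<Longrightarrow> R i \<in> continuous_linear_ops"
    and H: "H = iter_op M R \<omega>"
    and c: "c = (\<Sum>i=1..M. onorm (R i) * r i)"
    and sum_R: "(\<lambda>x. \<Sum>i=1..M. R i x) = id"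
    and a: "0 < a"
    and v: "norm v \<le> a"
  shows "H \<in> cabv \<rightarrow> cabv \<and>
    (c < 1 \<longrightarrow>
      (\<forall>A. A \<noteq> {} \<and> A \<subseteq> cabv_ball a \<inter> cabv_mass v \<and> H ` A \<subseteq> A \<and> closedin weak_star A \<longrightarrow>
        Metric_space A mk_dist \<and>
        contraction_on A mk_dist H \<and> lip_norm_on A mk_dist mk_dist H \<le> ennreal c \<and>
        (\<exists>!\<mu>. \<mu> \<in> A \<and> H \<mu> = \<mu>))) \<and>
    ((\<forall>i\<in>{1..M}. contraction_on UNIV dist (\<omega> i)) \<and> (\<Sum>i=1..M. onorm (R i)) = 1 \<longrightarrow> c < 1) \<and>
    ((\<forall>\<mu>\<in>cabv. variation (H \<mu>) \<le> variation \<mu>) \<longrightarrow>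
      (let A = cabv_ball a \<inter> cabv_mass v in
        A \<noteq> {} \<and> H ` A \<subseteq> A \<and> closedin weak_star A)) \<and>
    ((\<Sum>i=1..M. onorm (R i)) = 1 \<longrightarrow> (\<forall>\<mu>\<in>cabv. variation (H \<mu>) \<le> variation \<mu>))"
proof -
  note bl = continuous_linear_ops_bounded_linear[OF R]
  have onorm_nonneg: "0 \<le> onorm (R i)" if "i \<in> {1..M}" for i
    by (rule onorm_pos_le[OF bl[OF that]])
  have \<omega>_dist: "dist (\<omega> i s) (\<omega> i t) \<le> r i * dist s t" if "i \<in> {1..M}" for i s t
    using Lip_dist_le[OF \<omega>[OF that]] by (simp add: r[OF that])
  have r_nonneg: "0 \<le> r i" if "i \<in> {1..M}" for i by (simp add: r[OF that])
  have \<omega>_cont: "continuous_on UNIV (\<omega> i)" if "i \<in> {1..M}" for i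
    by (rule Lip_continuous[OF \<omega>[OF that]])
  have \<omega>_meas: "\<omega> i \<in> borel_measurable borel" if "i \<in> {1..M}" for i
    by (rule borel_measurable_continuous_onI[OF \<omega>_cont[OF that]])
  have c_nonneg: "0 \<le> c"
    unfolding c by (intro sum_nonneg mult_nonneg_nonneg onorm_nonneg r_nonneg)
  have H_cabv: "H \<mu> \<in> cabv" if "\<mu> \<in> cabv" for \<mu>
    unfolding H by (rule iter_op_cabv[OF that \<omega>_meas bl])
  have H_mass: "H \<mu> UNIV = \<mu> UNIV" for \<mu>
    unfolding H by (rule iter_op_mass[OF sum_R])
  have H_dist: "mk_dist (H \<mu>) (H \<nu>) \<le> c * mk_dist \<mu> \<nu>"
    if "\<mu> \<in> cabv_mass v" "\<nu> \<in> cabv_mass v" for \<mu> \<nu>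
  proof -
    have "mk_dist (H \<mu>) (H \<nu>) = mk_norm (iter_op M R \<omega> (\<lambda>B. \<mu> B - \<nu> B))"
      unfolding mk_dist_def H by (simp only: iter_op_diff[OF bl])
    also have "\<dots> \<le> c * mk_dist \<mu> \<nu>"
      unfolding mk_dist_def c
      by (rule mk_norm_iter_op_le[OF cabv_mass_diff[OF that] compact_T \<omega>_dist r_nonneg R])
    finally show ?thesis .
  qed
  have part2: "Metric_space A mk_dist \<and>
        contraction_on A mk_dist H \<and> lip_norm_on A mk_dist mk_dist H \<le> ennreal c \<and>
        (\<exists>!\<mu>. \<mu> \<in> A \<and> H \<mu> = \<mu>)"
    if c1: "c < 1" and A: "A \<noteq> {}" "A \<subseteq> cabv_ball a \<inter> cabv_mass v" "H ` A \<subseteq> A" "closedin weak_star A" for A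
  proof -
    have A_mass: "\<mu> \<in> cabv_mass v" if "\<mu> \<in> A" for \<mu> using A(2) that by blast
    then have A_cabv: "\<mu> \<in> cabv" if "\<mu> \<in> A" for \<mu> using that by (auto simp: cabv_mass_def)
    have metric: "Metric_space A mk_dist"
      by (rule Metric_space_mk_dist[OF compact_T, of _ v]) (use A(2) in blast)
    then interpret Metric_space A mk_dist .
    have lip: "lip_norm_on A mk_dist mk_dist H \<le> ennreal c"
      unfolding lip_norm_on_def
    proof (rule SUP_least, clarify)
      fix \<mu> \<nu> assume *: "\<mu> \<in> A" "\<nu> \<in> A" "\<mu> \<noteq> \<nu>"
      then have "0 < mk_dist \<mu> \<nu>" by (simp add: order.strict_iff_order)
      then have "mk_dist (H \<mu>) (H \<nu>) / mk_dist \<mu> \<nu> \<le> c"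
        using H_dist[OF A_mass A_mass] * by (simp add: divide_le_eq)
      then show "ennreal (mk_dist (H \<mu>) (H \<nu>) / mk_dist \<mu> \<nu>) \<le> ennreal c"
        by (rule ennreal_leI)
    qed
    moreover have "ennreal c < 1" using c1 c_nonneg by simp
    ultimately have contr: "contraction_on A mk_dist H"
      using A(3) by (auto simp: contraction_on_def intro: le_less_trans)
    have uniq: "\<mu> = \<nu>" if "\<mu> \<in> A" "H \<mu> = \<mu>" "\<nu> \<in> A" "H \<nu> = \<nu>" for \<mu> \<nu>
    proof -
      have "mk_dist \<mu> \<nu> \<le> c * mk_dist \<mu> \<nu>"
        using H_dist[of \<mu> \<nu>] A_mass that by simp
      then have "(1 - c) * mk_dist \<mu> \<nu> \<le> 0" by (simp add: left_diff_distrib)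
      then have "mk_dist \<mu> \<nu> \<le> 0" using c1 by (simp add: mult_le_0_iff)
      then have "mk_dist \<mu> \<nu> = 0" by (simp add: order.antisym)
      then show ?thesis using that by simp
    qed
    obtain \<mu>\<^sub>0 where "\<mu>\<^sub>0 \<in> A" using A(1) by blast
    define m where "m k = (H ^^ k) \<mu>\<^sub>0" for k
    have m: "m k \<in> A" for k
      using \<open>\<mu>\<^sub>0 \<in> A\<close> A(3) by (induction k) (auto simp: m_def)
    have Hm: "H (m k) = m (Suc k)" for k by (simp add: m_def)
    have m_dist: "mk_dist (m (Suc k)) (m k) \<le> c ^ k * mk_dist (m 1) (m 0)" for k
    proof (induction k)
      case (Suc k)
      have "mk_dist (m (Suc (Suc k))) (m (Suc k)) \<le> c * mk_dist (m (Suc k)) (m k)"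
        using H_dist[OF A_mass[OF m] A_mass[OF m], of "Suc k" k] by (simp only: Hm)
      also have "\<dots> \<le> c * (c ^ k * mk_dist (m 1) (m 0))"
        using Suc c_nonneg by (rule mult_left_mono)
      finally show ?case by (simp add: mult.assoc)
    qed simp
    have "m k \<in> cabv_ball a" for k using m A(2) by blast
    from cabv_ball_weakly_seq_compact[where \<mu> = m, OF compact_T this] obtain s \<mu>
      where s: "strict_mono (s :: nat \<Rightarrow> nat)" and \<mu>: "\<mu> \<in> cabv"
        and lim_all: "\<forall>f. continuous_on UNIV f \<longrightarrow> (\<lambda>j. vintegral (m (s j)) f) \<longlonglongrightarrow> vintegral \<mu> f"
      by (elim exE conjE) (rule that)
    have lim: "(\<lambda>j. vintegral (m (s j)) f) \<longlonglongrightarrow> vintegral \<mu> f" if "continuous_on UNIV f" for f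
      using lim_all that by blast
    have \<mu>A: "\<mu> \<in> A"
      by (rule weak_star_closed_limit[OF A(4) m \<mu> lim])
    have H\<mu>A: "H \<mu> \<in> A" using \<mu>A A(3) by blast
    \<comment> \<open>The integrals of \<open>f\<close> against \<open>m (s j)\<close> and \<open>H (m (s j))\<close> differ by at most \<open>c ^ s
    j\<close> times a constant, and they converge to the two sides.\<close>
    have same: "vintegral (H \<mu>) f = vintegral \<mu> f" if f: "\<And>s t. dist (f s) (f t) \<le> dist s t" for f
    proof (rule LIMSEQ_unique)
      note cf = continuous_if_nonexpansive[OF f]
      show "(\<lambda>j. vintegral (H (m (s j))) f) \<longlonglongrightarrow> vintegral (H \<mu>) f"
        unfolding H by (rule vintegral_iter_op_tendsto[OF A_cabv[OF m] \<mu> compact_T \<omega>_cont R lim cf])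
      have "norm (vintegral (H (m k)) f - vintegral (m k) f) \<le> c ^ k * mk_dist (m 1) (m 0)" for k
      proof -
        have c2: "H (m k) \<in> cabv" "m k \<in> cabv" using A_cabv[OF m] by (simp_all add: Hm)
        have "vintegral (H (m k)) f - vintegral (m k) f = vintegral (\<lambda>B. H (m k) B - m k B) f"
          by (rule vintegral_diff_measure[OF c2 cabv_diff[OF c2] compact_T cf, symmetric])
        also have "norm \<dots> \<le> 1 * mk_norm (\<lambda>B. H (m k) B - m k B)"
          using f A_mass[OF m]
          by (intro norm_vintegral_le_mk_norm cabv_mass_diff[of _ v] compact_T) (simp_all add: Hm)
        also have "\<dots> \<le> c ^ k * mk_dist (m 1) (m 0)"
          using m_dist[of k] by (simp add: Hm mk_dist_def)
        finally show ?thesis .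
      qed
      then have "\<forall>\<^sub>F k in sequentially.
          norm (vintegral (H (m k)) f - vintegral (m k) f) \<le> c ^ k * mk_dist (m 1) (m 0)"
        by simp
      moreover have "(\<lambda>k. c ^ k * mk_dist (m 1) (m 0)) \<longlonglongrightarrow> 0"
        using c1 c_nonneg by (intro tendsto_mult_left_zero LIMSEQ_realpow_zero) auto
      ultimately have "(\<lambda>k. vintegral (H (m k)) f - vintegral (m k) f) \<longlonglongrightarrow> 0"
        by (rule Lim_null_comparison)
      from LIMSEQ_subseq_LIMSEQ[OF this s]
      have "(\<lambda>j. vintegral (H (m (s j))) f - vintegral (m (s j)) f) \<longlonglongrightarrow> 0"
        unfolding o_def .
      from tendsto_add[OF this lim[OF cf]]
      show "(\<lambda>j. vintegral (H (m (s j))) f) \<longlonglongrightarrow> vintegral \<mu> f" by simp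
    qed
    \<comment> \<open>The distance only involves integrals of Lipschitz functions, so it vanishes.\<close>
    have "mk_dist (H \<mu>) \<mu> \<le> 0"
      unfolding mk_dist_def
    proof (rule mk_norm_le)
      fix f :: "'t \<Rightarrow> 'k ^ 'n" assume f: "\<And>s t. dist (f s) (f t) \<le> dist s t"
      show "norm (vintegral (\<lambda>B. H \<mu> B - \<mu> B) f) \<le> 0"
        using vintegral_diff_measure[OF A_cabv[OF H\<mu>A] \<mu> cabv_diff[OF A_cabv[OF H\<mu>A] \<mu>] compact_T
            continuous_if_nonexpansive[OF f]] same[OF f] by simp
    qed simp
    then have "mk_dist (H \<mu>) \<mu> = 0" by (simp add: order.antisym)
    then have "H \<mu> = \<mu>" using H\<mu>A \<mu>A by simp
    then have "\<exists>!\<mu>. \<mu> \<in> A \<and> H \<mu> = \<mu>" using \<mu>A uniq by blast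
    with metric contr lip show ?thesis by blast
  qed
  have part3: "c < 1" if contr: "\<forall>i\<in>{1..M}. contraction_on UNIV dist (\<omega> i)" and sum1: "(\<Sum>i=1..M. onorm (R i)) = 1"
  proof -
    have r1: "r i < 1" if i: "i \<in> {1..M}" for i
    proof -
      have less: "lip_norm (\<omega> i) < ennreal 1" using contr i by (auto simp: contraction_on_def)
      moreover have "lip_norm (\<omega> i) < \<infinity>" using less by (rule less_trans) simp
      ultimately show ?thesis unfolding r[OF i] by (simp add: enn2real_less_iff)
    qed
    have "\<exists>i\<in>{1..M}. onorm (R i) \<noteq> 0"
    proof (rule ccontr)
      assume "\<not> ?thesis"
      then have "(\<Sum>i=1..M. onorm (R i)) = 0" by (intro sum.neutral) auto
      then show False using sum1 by simp
    qed
    then obtain i where i: "i \<in> {1..M}" "0 < onorm (R i)" using onorm_nonneg by force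
    have "c < (\<Sum>i=1..M. onorm (R i))"
      unfolding c
    proof (rule sum_strict_mono_ex1)
      show "\<forall>i\<in>{1..M}. onorm (R i) * r i \<le> onorm (R i)"
        by (intro ballI mult_left_le less_imp_le[OF r1] onorm_nonneg)
      show "\<exists>i\<in>{1..M}. onorm (R i) * r i < onorm (R i)"
        using i r1[OF i(1)] by (intro bexI[of _ i]) auto
    qed simp
    then show ?thesis using sum1 by simp
  qed
  have part4: "let A = cabv_ball a \<inter> cabv_mass v in
        A \<noteq> {} \<and> H ` A \<subseteq> A \<and> closedin weak_star A"
    if var: "\<forall>\<mu>\<in>cabv. variation (H \<mu>) \<le> variation \<mu>"
    unfolding Let_def
  proof (intro conjI)
    show "cabv_ball a \<inter> cabv_mass v \<noteq> ({} :: ('t set \<Rightarrow> 'k ^ 'n) set)" by (rule ball_mass_nonempty[OF v])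
    show "H ` (cabv_ball a \<inter> cabv_mass v) \<subseteq> cabv_ball a \<inter> cabv_mass v"
      using var H_cabv H_mass by (auto simp: cabv_ball_def cabv_mass_def intro: order_trans)
    show "closedin weak_star (cabv_ball a \<inter> cabv_mass v :: ('t set \<Rightarrow> 'k ^ 'n) set)"
      by (rule closedin_weak_star_ball_mass[OF compact_T a])
  qed
  have part5: "variation (H \<mu>) \<le> variation \<mu>" if "(\<Sum>i=1..M. onorm (R i)) = 1" "\<mu> \<in> cabv" for \<mu>
  proof -
    have "variation (H \<mu>) \<le> ennreal (\<Sum>i=1..M. onorm (R i)) * variation \<mu>"
      unfolding H by (rule variation_iter_op_le[OF that(2) \<omega>_meas bl])
    then show ?thesis by (simp only: that(1) ennreal_1 mult_1)
  qed
  show ?thesis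
  proof (intro conjI[of "H \<in> cabv \<rightarrow> cabv"] conjI[of "c < 1 \<longrightarrow> _"] conjI[of "_ \<longrightarrow> c < 1"]
      conjI[of "_ \<longrightarrow> Let _ _"] impI allI ballI)
    show "H \<in> cabv \<rightarrow> cabv" using H_cabv by (rule Pi_I)
  qed (use part2 part3 part4 part5 in simp_all)
qed

end
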